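(* Let $\mathbf G$ and $\mathbf H$ be groups such that $\mathcal G(\mathbf G)\cong\mathcal G(\mathbf H)$ (isomorphic power graphs). If $\mathbf G$ has no intersection-free quasicyclic subgroup, then $\vec{\mathcal G}(\mathbf G)\cong\vec{\mathcal G}(\mathbf H)$ (isomorphic directed power graphs).
   Context: For a group $\mathbf G$ with underlying set $G$: the directed power graph $\vec{\mathcal G}(\mathbf G)$ is the simple digraph with vertex set $G$ in which there is an arc from $x$ to $y$, $x\neq y$, if and only if $y=x^n$ for some $n\in\mathbb Z$. The power graph $\mathcal G(\mathbf G)$ is the simple graph with vertex set $G$ in which $x\neq y$ are adjacent if and only if there is $n\in\mathbb Z$ with $y=x^n$ or $x=y^n$. A quasicyclic group is a Prüfer group $\mathbf C_{p^\infty}$ for some prime $p$. A subgroup $\mathbf L$ of $\mathbf G$ is intersection-free if $\mathbf L\cap\mathbf K$ is trivial for every cyclic subgroup $\mathbf K$ of $\mathbf G$ such that $\mathbf K\not\leq\mathbf L$. *)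

theory Defs
  imports
    "HOL-Algebra.Elementary_Groups"
    "HOL-Computational_Algebra.Primes"
    "Graph_Theory.Pair_Digraph"
    "Graph_Theory.Digraph_Isomorphism"
    Complex_Main
begin

definition directed_power_graph :: "('a, 'm) monoid_scheme \<Rightarrow> 'a pair_pre_digraph" where
  "directed_power_graph G =
    \<lparr> pverts = carrier G,
      parcs = {(x, y). x \<in> carrier G \<and> y \<in> carrier G \<and> x \<noteq> y \<and>
                 (\<exists>n::int. y = x [^]\<^bsub>G\<^esub> n)} \<rparr>"

text \<open>As usual in \<^theory>\<open>Graph_Theory.Digraph\<close>, an undirected graph is a symmetric digraph:
  an edge between \<open>x\<close> and \<open>y\<close> is the pair of opposite arcs \<open>(x, y)\<close>, \<open>(y, x)\<close>.\<close>

definition power_graph :: "('a, 'm) monoid_scheme \<Rightarrow> 'a pair_pre_digraph" where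
  "power_graph G =
    \<lparr> pverts = carrier G,
      parcs = {(x, y). x \<in> carrier G \<and> y \<in> carrier G \<and> x \<noteq> y \<and>
                 (\<exists>n::int. y = x [^]\<^bsub>G\<^esub> n \<or> x = y [^]\<^bsub>G\<^esub> n)} \<rparr>"

text \<open>The Pruefer \<open>p\<close>-group, realised as the multiplicative group of all complex roots of unity
  of \<open>p\<close>-power order.\<close>

definition prufer_group :: "nat \<Rightarrow> complex monoid" where
  "prufer_group p = \<lparr> carrier = {z. \<exists>k. z ^ (p ^ k) = 1}, monoid.mult = (*), one = 1 \<rparr>"

definition quasicyclic_group :: "('a, 'm) monoid_scheme \<Rightarrow> bool" where
  "quasicyclic_group G \<longleftrightarrow> (\<exists>p::nat. prime p \<and> G \<cong> prufer_group p)"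

definition intersection_free :: "'a set \<Rightarrow> ('a, 'm) monoid_scheme \<Rightarrow> bool" where
  "intersection_free L G \<longleftrightarrow>
    subgroup L G \<and>
    (\<forall>K. subgroup K G \<and> cyclic_group (G\<lparr>carrier := K\<rparr>) \<and> \<not> K \<subseteq> L \<longrightarrow> L \<inter> K = {\<one>\<^bsub>G\<^esub>})"

lemma pair_loopfree_directed_power_graph: "pair_loopfree_digraph (directed_power_graph G)"
  by unfold_locales (auto simp: directed_power_graph_def)

lemma pair_bidirected_power_graph: "pair_bidirected_digraph (power_graph G)"
proof -
  have "symmetric (with_proj (power_graph G))"
    unfolding symmetric_def with_proj_simps power_graph_def by (auto simp: sym_def)
  then show ?thesis
    by unfold_locales (auto simp: power_graph_def)
qed

lemma group_prufer_group:
  assumes "p > 0"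
  shows "group (prufer_group p)"
proof (rule groupI)
  fix x y assume "x \<in> carrier (prufer_group p)" "y \<in> carrier (prufer_group p)"
  then obtain k l where kl: "x ^ (p ^ k) = 1" "y ^ (p ^ l) = 1"
    by (auto simp: prufer_group_def)
  have "(x * y) ^ (p ^ (k + l)) = (x ^ (p ^ k)) ^ (p ^ l) * (y ^ (p ^ l)) ^ (p ^ k)"
    by (simp add: power_add power_mult_distrib mult.commute flip: power_mult)
  also have "\<dots> = 1"
    by (simp add: kl)
  finally show "x \<otimes>\<^bsub>prufer_group p\<^esub> y \<in> carrier (prufer_group p)"
    by (auto simp: prufer_group_def)
next
  fix x assume "x \<in> carrier (prufer_group p)"
  then obtain k where k: "x ^ (p ^ k) = 1"
    by (auto simp: prufer_group_def)
  then have "x \<noteq> 0"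
    using assms by (auto simp: power_0_left)
  with k show "\<exists>y\<in>carrier (prufer_group p). y \<otimes>\<^bsub>prufer_group p\<^esub> x = \<one>\<^bsub>prufer_group p\<^esub>"
    by (intro bexI[of _ "inverse x"]) (auto simp: prufer_group_def power_inverse)
qed (auto simp: prufer_group_def)

text \<open>On digraphs given by pairs, \<^const>\<open>digraph_iso\<close> amounts to a bijection between the
  vertex sets that preserves and reflects arcs.\<close>

lemma digraph_iso_with_proj_iff:
  assumes "pair_wf_digraph A" "pair_wf_digraph B"
  shows "digraph_iso (with_proj A) (with_proj B) \<longleftrightarrow>
    (\<exists>f. bij_betw f (pverts A) (pverts B) \<and>
         (\<forall>x\<in>pverts A. \<forall>y\<in>pverts A. (x, y) \<in> parcs A \<longleftrightarrow> (f x, f y) \<in> parcs B))"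
    (is "?L \<longleftrightarrow> ?R")
proof
  interpret A: pair_wf_digraph A by fact
  assume ?L
  then obtain h where h: "pre_digraph.digraph_isomorphism (with_proj A) h"
    and B: "with_proj B = app_iso h (with_proj A)"
    by (auto simp: digraph_iso_def)
  let ?f = "iso_verts h"
  have proj: "iso_tail h = fst" "iso_head h = snd"
    and v: "pverts B = ?f ` pverts A" and a: "parcs B = iso_arcs h ` parcs A"
    using B by (auto simp: with_proj_def app_iso_def)
  have inj: "inj_on ?f (pverts A)"
    and arc: "e \<in> parcs A \<Longrightarrow> iso_arcs h e = (?f (fst e), ?f (snd e))" for e
    using h by (auto simp: pre_digraph.digraph_isomorphism_def proj prod_eq_iff)
  have "(x, y) \<in> parcs A" if xy: "x \<in> pverts A" "y \<in> pverts A" "(?f x, ?f y) \<in> parcs B" for x y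
  proof -
    obtain u w where uw: "(u, w) \<in> parcs A" "(?f x, ?f y) = iso_arcs h (u, w)"
      using xy(3) unfolding a by auto
    then have "?f x = ?f u" "?f y = ?f w"
      by (auto simp: arc)
    then have "x = u" "y = w"
      using xy(1,2) uw(1) inj_onD[OF inj] A.in_arcsD1 A.in_arcsD2 by metis+
    with uw(1) show ?thesis by simp
  qed
  moreover have "(?f x, ?f y) \<in> parcs B" if "(x, y) \<in> parcs A" for x y
    using that arc[OF that] unfolding a by force
  ultimately show ?R
    using inj v by (intro exI[of _ ?f]) (auto simp: bij_betw_def)
next
  interpret A: pair_wf_digraph A by fact
  interpret B: pair_wf_digraph B by fact
  assume ?R
  then obtain f where bij: "bij_betw f (pverts A) (pverts B)"
    and arc: "\<And>x y. x \<in> pverts A \<Longrightarrow> y \<in> pverts A \<Longrightarrow>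
                (x, y) \<in> parcs A \<longleftrightarrow> (f x, f y) \<in> parcs B"
    by blast
  let ?h = "\<lparr> iso_verts = f, iso_arcs = map_prod f f, iso_head = snd, iso_tail = fst \<rparr>"
  have inj: "inj_on f (pverts A)" and im: "f ` pverts A = pverts B"
    using bij by (auto simp: bij_betw_def)
  have "inj_on (map_prod f f) (parcs A)"
    by (intro map_prod_inj_on[OF inj inj, THEN inj_on_subset])
       (auto dest: A.in_arcsD1 A.in_arcsD2)
  then have "pre_digraph.digraph_isomorphism (with_proj A) ?h"
    using inj A.wf_digraph by (auto simp: pre_digraph.digraph_isomorphism_def)
  moreover have "parcs B = map_prod f f ` parcs A"
  proof (intro equalityI subsetI)
    fix e assume e: "e \<in> parcs B"
    then obtain x y where "x \<in> pverts A" "y \<in> pverts A" "e = (f x, f y)"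
      using B.in_arcsD1 B.in_arcsD2 im by (metis imageE surj_pair)
    with e arc show "e \<in> map_prod f f ` parcs A" by force
  next
    fix e assume "e \<in> map_prod f f ` parcs A"
    with arc show "e \<in> parcs B" by (auto dest: A.in_arcsD1 A.in_arcsD2)
  qed
  then have "with_proj B = app_iso ?h (with_proj A)"
    using im by (simp add: with_proj_def app_iso_def)
  ultimately show ?L
    by (auto simp: digraph_iso_def)
qed

end

theory Submission
  imports
    Defs
    "HOL-Number_Theory.Totient"
    "HOL-Number_Theory.Prime_Powers"
    "HOL-Algebra.Multiplicative_Group"
begin

text \<open>Write \<open>y \<in> cyc x\<close> when \<open>y\<close> is a power of \<open>x\<close>. The directed power graph is this preorder and the
power graph is its comparability graph, so the task is to recover the preorder, up to isomorphism,
from comparability. The identity is comparable with everything, and a transposition of two dominating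
vertices is an automorphism, so one may start from an isomorphism \<open>f\<close> of power graphs that sends
\<open>\<one>\<close> to \<open>\<one>\<close>. In general \<open>f\<close> itself does not respect directions: replacing each nonzero rational by its
reciprocal is an automorphism of the power graph of the additive group of rationals that reverses the
arcs between nonzero elements. It has to be corrected on parts of
the group.

Two vertices are twins if they have the same closed neighbourhood. An element \<open>x\<close> of infinite order has
only the twins \<open>x\<close> and its inverse, besides possibly \<open>\<one>\<close>. If \<open>f\<close> sent it to a torsion element, then the images of
the powers \<open>x\<close>, \<open>x\<^sup>2\<close>, \<open>x\<^sup>4\<close>, \<dots> would generate cyclic groups with at most two generators each, so
infinitely many pairwise comparable elements of order at most 6, which is impossible. Hence \<open>f\<close>
preserves infinite order (\<open>f_ord_zero\<close>), and torsion elements and elements of infinite order can be treated separately.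

Torsion elements: for comparable elements of finite order the direction can be read off from the
orders, so it suffices to move \<open>f\<close> within twin classes until it preserves orders. Consider
first an element \<open>x\<close> whose order is not a prime power. Incomparable divisors tie the directions of all
arcs leaving \<open>x\<close> together, and counting generators excludes that all of them are reversed
(\<open>mixed_forward\<close>). Therefore \<open>f\<close> maps the cyclic group of \<open>x\<close> onto that of \<open>f x\<close> and preserves the
orders of all its elements (\<open>shared_ord\<close>). The remaining nontrivial torsion elements have prime
power order, and the elements whose closed neighbourhood contains that of such an element form a
chain of cyclic \<open>p\<close>-groups. The orders that occur in its twin class are the powers of \<open>p\<close> above
the number of non-twins in the chain and up to the size of the chain (\<open>twin_orders\<close>). These numbers are
invariants of the graph. They determine \<open>p\<close>, except if the chain is infinite and consists of \<open>\<one>\<close> and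
twins only. Then the chain is a quasicyclic subgroup, and it is intersection-free because a cyclic
group that meets it nontrivially is generated by a neighbour of all of its elements. The
hypothesis rules this out, so twin classes can be matched by order (\<open>pure_matching\<close>).

Elements of infinite order: the connected components are the classes of commensurable elements, and
the classes are matched one by one (\<open>class_iso\<close>). Within a class that has no greatest cyclic
subgroup, any two arcs are linked by pairs of incomparable elements, so \<open>f\<close> preserves all
directions or reverses all of them (\<open>noncyclic_forward_constant\<close>). In the reversing case the elements above \<open>x\<close> look like
the powers of \<open>f x\<close>, which forces all roots to exist and to be unique; both classes then look like
the nonzero rationals and are isomorphic. A class with a greatest cyclic subgroup consists of the
nontrivial powers of one element.\<close>

section \<open>Cyclic subgroups and closed neighbourhoods\<close>

context group
begin

definition cyc :: "'a \<Rightarrow> 'a set" where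
  "cyc x = range (\<lambda>n::int. x [^] n)"

definition adj :: "'a \<Rightarrow> 'a \<Rightarrow> bool" where
  "adj x y \<longleftrightarrow> x \<in> cyc y \<or> y \<in> cyc x"

text \<open>Inclusion of closed neighbourhoods in the power graph: as \<open>adj\<close> is reflexive on the carrier, every
  vertex counts as its own neighbour.\<close>

definition nsub :: "'a \<Rightarrow> 'a \<Rightarrow> bool" where
  "nsub x y \<longleftrightarrow> (\<forall>z\<in>carrier G. adj z x \<longrightarrow> adj z y)"

definition gens :: "'a \<Rightarrow> 'a set" where
  "gens x = {y\<in>cyc x. x \<in> cyc y}"

lemma cyc_I [intro]: "x [^] (n::int) \<in> cyc x"
  by (auto simp: cyc_def)

lemma cyc_nat_I [intro]: "x [^] (n::nat) \<in> cyc x"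
  by (metis cyc_I int_pow_int)

lemma cyc_subset_carrier: "x \<in> carrier G \<Longrightarrow> cyc x \<subseteq> carrier G"
  by (auto simp: cyc_def)

lemma cyc_carrier: "\<lbrakk>x \<in> carrier G; y \<in> cyc x\<rbrakk> \<Longrightarrow> y \<in> carrier G"
  using cyc_subset_carrier by blast

lemma cyc_refl [simp]: "x \<in> carrier G \<Longrightarrow> x \<in> cyc x"
  using cyc_I[of x 1] by simp

lemma one_cyc [simp]: "\<one> \<in> cyc x"
  using cyc_I[of x 0] by simp

lemma cyc_one [simp]: "cyc \<one> = {\<one>}"
  by (auto simp: cyc_def)

lemma cyc_trans: "\<lbrakk>x \<in> carrier G; y \<in> cyc x; z \<in> cyc y\<rbrakk> \<Longrightarrow> z \<in> cyc x"
  by (auto simp: cyc_def int_pow_pow)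

lemma adj_sym: "adj x y \<longleftrightarrow> adj y x"
  by (auto simp: adj_def)

lemma adj_refl [simp]: "x \<in> carrier G \<Longrightarrow> adj x x"
  by (auto simp: adj_def)

lemma adj_one [simp]: "adj \<one> x" "adj x \<one>"
  by (auto simp: adj_def)

lemma nsub_refl [simp]: "nsub x x"
  by (simp add: nsub_def)

lemma nsub_trans: "nsub x y \<Longrightarrow> nsub y z \<Longrightarrow> nsub x z"
  by (simp add: nsub_def)

lemma nsub_one [simp]: "nsub x \<one>"
  by (simp add: nsub_def)

lemma nsub_adj: "\<lbrakk>nsub x y; x \<in> carrier G\<rbrakk> \<Longrightarrow> adj x y"
  by (simp add: nsub_def)

lemma gens_sym: "\<lbrakk>x \<in> carrier G; y \<in> gens x\<rbrakk> \<Longrightarrow> x \<in> gens y"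
  by (auto simp: gens_def intro: cyc_carrier)

lemma gens_refl: "x \<in> carrier G \<Longrightarrow> x \<in> gens x"
  by (auto simp: gens_def)

lemma gens_nsub: "\<lbrakk>x \<in> carrier G; y \<in> gens x\<rbrakk> \<Longrightarrow> nsub x y"
  unfolding gens_def nsub_def adj_def by (auto intro: cyc_trans cyc_carrier)

lemma cyc_ord_dvd: "\<lbrakk>x \<in> carrier G; y \<in> cyc x\<rbrakk> \<Longrightarrow> ord y dvd ord x"
proof -
  assume x: "x \<in> carrier G" "y \<in> cyc x"
  then obtain n :: int where n: "y = x [^] n" by (auto simp: cyc_def)
  have "y [^] int (ord x) = x [^] (int (ord x) * n)"
    using x n by (simp add: int_pow_pow mult.commute)
  also have "\<dots> = \<one>"
    using x by (simp add: int_pow_eq_id)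
  finally show ?thesis
    using x n by (simp add: int_pow_eq_id)
qed


lemma cyc_ord_nonzero: "\<lbrakk>x \<in> carrier G; y \<in> cyc x; ord x \<noteq> 0\<rbrakk> \<Longrightarrow> ord y \<noteq> 0"
  using cyc_ord_dvd by force

lemma int_pow_mod_ord: "x \<in> carrier G \<Longrightarrow> x [^] (n::int) = x [^] (n mod int (ord x))"
proof -
  assume x: "x \<in> carrier G"
  have "x [^] n = x [^] (int (ord x) * (n div int (ord x)) + n mod int (ord x))" by simp
  also have "\<dots> = x [^] (int (ord x) * (n div int (ord x))) \<otimes> x [^] (n mod int (ord x))"
    by (rule int_pow_mult) (use x in auto)
  also have "x [^] (int (ord x) * (n div int (ord x))) = \<one>"
    using x by (subst int_pow_eq_id) auto
  finally show ?thesis using x by simp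
qed

lemma int_pow_eq_iff: "x \<in> carrier G \<Longrightarrow> x [^] (m::int) = x [^] n \<longleftrightarrow> int (ord x) dvd m - n"
  by (metis int_pow_eq dvd_diff_commute)

lemma cyc_eq_image: "\<lbrakk>x \<in> carrier G; ord x \<noteq> 0\<rbrakk> \<Longrightarrow> cyc x = (\<lambda>n::nat. x [^] n) ` {..<ord x}"
proof (intro equalityI subsetI)
  fix y assume x: "x \<in> carrier G" "ord x \<noteq> 0" and "y \<in> cyc x"
  then obtain n :: int where n: "y = x [^] n" by (auto simp: cyc_def)
  have "y = x [^] (int (nat (n mod int (ord x))))"
    using n int_pow_mod_ord[OF x(1)] x(2) by simp
  moreover have "nat (n mod int (ord x)) < ord x"
    using x(2) by (simp add: nat_less_iff)
  ultimately show "y \<in> (\<lambda>n::nat. x [^] n) ` {..<ord x}"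
    unfolding int_pow_int by blast
qed auto

lemma pow_inj_on: "x \<in> carrier G \<Longrightarrow> inj_on (\<lambda>n::nat. x [^] n) {..<ord x}"
proof (rule inj_onI)
  fix m n assume x: "x \<in> carrier G" and mn: "m \<in> {..<ord x}" "n \<in> {..<ord x}" "x [^] m = x [^] n"
  then have "int (ord x) dvd int m - int n"
    using int_pow_eq_iff[OF x, of "int m" "int n"] by (simp add: int_pow_int)
  then show "m = n"
    using mn zdvd_imp_le[of "int (ord x)" "int m - int n"]
      zdvd_imp_le[of "int (ord x)" "int n - int m"] by (cases m n rule: linorder_cases) (auto simp: dvd_diff_commute[of _ "int m"])
qed

lemma finite_cyc: "\<lbrakk>x \<in> carrier G; ord x \<noteq> 0\<rbrakk> \<Longrightarrow> finite (cyc x)"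
  by (simp add: cyc_eq_image)

lemma card_cyc: "\<lbrakk>x \<in> carrier G; ord x \<noteq> 0\<rbrakk> \<Longrightarrow> card (cyc x) = ord x"
  by (simp add: cyc_eq_image card_image pow_inj_on)

text \<open>For finite order \<open>n\<close>, the power \<open>x\<^sup>k\<close> is trivial to the exponent \<open>m\<close> iff \<open>n\<close> divides \<open>k m\<close>, that is, iff
  \<open>n / gcd k n\<close> divides \<open>m\<close>.\<close>

lemma ord_mult_gcd:
  assumes "x \<in> carrier G" "ord x \<noteq> 0"
  shows "ord (x [^] (k::nat)) * gcd k (ord x) = ord x"
proof -
  obtain k' n' where kn: "k = k' * gcd k (ord x)" "ord x = n' * gcd k (ord x)" "coprime k' n'"
    using gcd_coprime_exists[of k "ord x"] assms by auto
  have g: "gcd k (ord x) \<noteq> 0" using assms by simp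
  then have n': "ord x div gcd k (ord x) = n'"
    using kn(2) by (metis nonzero_mult_div_cancel_right)
  have "ord (x [^] k) dvd m \<longleftrightarrow> ord x div gcd k (ord x) dvd m" for m
  proof -
    have "ord (x [^] k) dvd m \<longleftrightarrow> ord x dvd k * m"
      using assms by (simp add: nat_pow_pow flip: pow_eq_id)
    also have "k * m = k' * m * gcd k (ord x)"
      by (subst kn(1)) (simp add: mult_ac)
    also have "ord x dvd k' * m * gcd k (ord x) \<longleftrightarrow> n' * gcd k (ord x) dvd k' * m * gcd k (ord x)"
      using kn(2) by simp
    also have "\<dots> \<longleftrightarrow> n' dvd k' * m"
      using g by simp
    also have "\<dots> \<longleftrightarrow> ord x div gcd k (ord x) dvd m"
      using kn(3) n' by (simp add: coprime_commute coprime_dvd_mult_right_iff)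
    finally show ?thesis .
  qed
  then have "ord (x [^] k) = ord x div gcd k (ord x)"
    by (meson dvd_antisym dvd_refl)
  then show ?thesis by simp
qed

text \<open>A subgroup of a finite cyclic group is determined by its order: if the order of \<open>y = x\<^sup>i\<close>
  divides that of \<open>z = x\<^sup>j\<close>, then \<open>gcd j n\<close> divides \<open>i\<close>, and \<open>x\<close> to the power \<open>gcd j n\<close> lies in
  \<open>\<langle>z\<rangle>\<close> by Bezout.\<close>

lemma cyc_iff_ord_dvd:
  assumes x: "x \<in> carrier G" "ord x \<noteq> 0" and yz: "y \<in> cyc x" "z \<in> cyc x"
  shows "y \<in> cyc z \<longleftrightarrow> ord y dvd ord z"
proof
  have zc: "z \<in> carrier G" using x yz cyc_carrier by blast
  then show "y \<in> cyc z \<Longrightarrow> ord y dvd ord z" by (rule cyc_ord_dvd)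
  assume d: "ord y dvd ord z"
  obtain i j :: nat where ij: "y = x [^] i" "z = x [^] j"
    using yz cyc_eq_image[OF x] by auto
  define g where "g = gcd j (ord x)"
  have oz: "ord z * g = ord x" using ord_mult_gcd[OF x, of j] ij g_def by simp
  have "y [^] ord z = \<one>"
    using d x ij by (simp add: pow_eq_id)
  then have "ord x dvd i * ord z"
    using x ij by (simp add: nat_pow_pow pow_eq_id)
  then have "g * ord z dvd i * ord z" using oz by (simp add: mult.commute)
  then have "g dvd i" using oz x by auto
  then obtain i' where i': "i = g * i'" by blast
  obtain u v :: int where uv: "u * int j + v * int (ord x) = int g"
    using bezout_int[of "int j" "int (ord x)"] unfolding g_def by (auto simp: gcd_int_int_eq)
  have "x [^] int g = x [^] (int j * u)"
    using x by (subst int_pow_eq_iff) (simp_all add: algebra_simps flip: uv)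
  then have "x [^] int g = z [^] u"
    using x ij by (simp add: int_pow_pow flip: int_pow_int)
  then have "y = z [^] (u * int i')"
  proof -
    have "y = (x [^] int g) [^] int i'" using x ij i' by (simp add: int_pow_pow flip: int_pow_int)
    also have "\<dots> = (z [^] u) [^] int i'" using \<open>x [^] int g = z [^] u\<close> by simp
    finally show ?thesis using zc by (simp add: int_pow_pow)
  qed
  then show "y \<in> cyc z" by auto
qed

text \<open>The reason why orders determine directions: for comparable torsion elements the larger cyclic
  subgroup contains both, and there subgroups are compared by their orders.\<close>

lemma adj_iff_ord_dvd:
  assumes "y \<in> carrier G" "z \<in> carrier G" "adj y z" "ord y \<noteq> 0" "ord z \<noteq> 0"
  shows "y \<in> cyc z \<longleftrightarrow> ord y dvd ord z"
  using assms cyc_iff_ord_dvd[of y y z] cyc_iff_ord_dvd[of z y z] unfolding adj_def by auto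

lemma cyc_ex_ord:
  assumes x: "x \<in> carrier G" "ord x \<noteq> 0" and d: "d dvd ord x"
  obtains y where "y \<in> cyc x" "ord y = d"
proof -
  obtain e where e: "ord x = d * e" using d by blast
  then have "d \<noteq> 0" "e \<noteq> 0" using x by auto
  then have "ord x div d = e" "gcd e (ord x) = e" using e by (auto simp: gcd_proj1_iff)
  then have "ord (x [^] (ord x div d)) * e = d * e"
    using ord_mult_gcd[OF x, of "ord x div d"] e by simp
  then have "ord (x [^] (ord x div d)) = d" using \<open>e \<noteq> 0\<close> by simp
  then show ?thesis using that[of "x [^] (ord x div d)"] by auto
qed

lemma gens_iff_ord:
  assumes x: "x \<in> carrier G" "ord x \<noteq> 0" and y: "y \<in> cyc x"
  shows "y \<in> gens x \<longleftrightarrow> ord y = ord x"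
  using cyc_iff_ord_dvd[OF x cyc_refl[OF x(1)] y] y x cyc_ord_dvd[OF x(1) y]
  by (auto simp: gens_def intro: dvd_antisym)

lemma gens_ord: "\<lbrakk>x \<in> carrier G; y \<in> gens x\<rbrakk> \<Longrightarrow> ord y = ord x"
  unfolding gens_def by (auto intro!: dvd_antisym cyc_ord_dvd intro: cyc_carrier)

lemma finite_gens: "\<lbrakk>x \<in> carrier G; ord x \<noteq> 0\<rbrakk> \<Longrightarrow> finite (gens x)"
  by (simp add: finite_cyc gens_def)

text \<open>The exponents below the order of \<open>x\<close> and coprime to it are exactly those that give generators.\<close>

lemma card_gens:
  assumes x: "x \<in> carrier G" "ord x \<noteq> 0"
  shows "card (gens x) = totient (ord x)"
proof (cases "ord x = 1")
  case True
  then have "x = \<one>" using x by (metis ord_eq_1)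
  then have "gens x = {\<one>}" by (auto simp: gens_def)
  with True show ?thesis by simp
next
  case False
  have inj: "inj_on (\<lambda>n::nat. x [^] n) (totatives (ord x))"
    using pow_inj_on[OF x(1)] by (rule inj_on_subset)
      (use False x in \<open>auto simp: totatives_def order_le_less\<close>)
  have "gens x = (\<lambda>n::nat. x [^] n) ` totatives (ord x)"
  proof (intro equalityI subsetI)
    fix y assume y: "y \<in> gens x"
    then obtain n where n: "y = x [^] n" "n < ord x"
      using cyc_eq_image[OF x] by (auto simp: gens_def)
    have "coprime n (ord x)"
      using ord_mult_gcd[OF x, of n] gens_ord[OF x(1) y] n x by (simp add: coprime_iff_gcd_eq_1)
    moreover from this False have "n \<noteq> 0" by (cases "n = 0") auto
    ultimately show "y \<in> (\<lambda>n::nat. x [^] n) ` totatives (ord x)"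
      using n by (auto simp: totatives_def)
  next
    fix y assume "y \<in> (\<lambda>n::nat. x [^] n) ` totatives (ord x)"
    then obtain n where n: "y = x [^] n" "coprime n (ord x)" by (auto simp: totatives_def)
    then have "ord y = ord x" using ord_mult_gcd[OF x, of n] by (simp add: coprime_iff_gcd_eq_1)
    with n show "y \<in> gens x" using gens_iff_ord[OF x] by auto
  qed
  with inj show ?thesis by (simp add: card_image totient_def)
qed

lemma inf_pow_eq: "\<lbrakk>x \<in> carrier G; ord x = 0\<rbrakk> \<Longrightarrow> x [^] (m::int) = x [^] n \<longleftrightarrow> m = n"
  using int_pow_eq_iff[of x m n] by simp

lemma inf_pow_one: "\<lbrakk>x \<in> carrier G; ord x = 0\<rbrakk> \<Longrightarrow> x [^] (m::int) = \<one> \<longleftrightarrow> m = 0"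
  using inf_pow_eq[of x m 0] by simp

lemma ord_int_pow_inf: "\<lbrakk>x \<in> carrier G; ord x = 0; m \<noteq> 0\<rbrakk> \<Longrightarrow> ord (x [^] (m::int)) = 0"
  using int_pow_eq_id[of "x [^] m" "int (ord (x [^] m))"]
  by (simp add: int_pow_pow inf_pow_one)

lemma cyc_inf: "\<lbrakk>x \<in> carrier G; ord x = 0; y \<in> cyc x; y \<noteq> \<one>\<rbrakk> \<Longrightarrow> ord y = 0"
  unfolding cyc_def using ord_int_pow_inf[of x] by (auto, metis int_pow_0)

lemma adj_ord_zero:
  assumes "x \<in> carrier G" "y \<in> carrier G" "x \<noteq> \<one>" "y \<noteq> \<one>" "adj x y"
  shows "ord x = 0 \<longleftrightarrow> ord y = 0"
  using assms cyc_inf cyc_ord_nonzero unfolding adj_def by metis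

lemma inf_pow_cyc:
  assumes "x \<in> carrier G" "ord x = 0"
  shows "x [^] (a::int) \<in> cyc (x [^] (b::int)) \<longleftrightarrow> b dvd a"
proof -
  have "x [^] a \<in> cyc (x [^] b) \<longleftrightarrow> (\<exists>k. x [^] a = x [^] (b * k))"
    using assms by (auto simp: cyc_def int_pow_pow)
  also have "\<dots> \<longleftrightarrow> b dvd a" using assms by (simp add: inf_pow_eq dvd_def)
  finally show ?thesis .
qed

lemma inf_adj_pow:
  assumes "x \<in> carrier G" "ord x = 0"
  shows "adj (x [^] (a::int)) (x [^] (b::int)) \<longleftrightarrow> b dvd a \<or> a dvd b"
  using inf_pow_cyc[OF assms] by (auto simp: adj_def)

lemma inf_gens:
  assumes x: "x \<in> carrier G" "ord x = 0"
  shows "y \<in> gens x \<longleftrightarrow> y = x \<or> y = inv x"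
proof -
  have i1: "inv x = x [^] (-1::int)" using x by (simp add: int_pow_neg)
  have x1: "x = x [^] (1::int)" using x by simp
  have *: "x [^] k \<in> gens x \<longleftrightarrow> k dvd 1" for k :: int
    using inf_pow_cyc[OF x, of k 1] inf_pow_cyc[OF x, of 1 k] x by (auto simp: gens_def)
  show ?thesis
  proof
    assume y: "y \<in> gens x"
    then obtain k :: int where "y = x [^] k" by (auto simp: gens_def cyc_def)
    with y * have "k = 1 \<or> k = -1" by (simp add: zdvd1_eq) linarith
    with \<open>y = x [^] k\<close> i1 x show "y = x \<or> y = inv x" by auto
  next
    assume "y = x \<or> y = inv x"
    then show "y \<in> gens x" using *[of 1] *[of "-1"] i1 x by auto
  qed
qed

text \<open>An element of infinite order has no twins besides its inverse: \<open>x\<^sup>m\<close> with \<open>|m| > 1\<close> is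
  not adjacent to \<open>x\<close> to the power \<open>|m| + 1\<close>.\<close>

lemma inf_twin_gens:
  assumes x: "x \<in> carrier G" "ord x = 0" and y: "y \<in> carrier G" "y \<noteq> \<one>" and t: "nsub x y" "nsub y x"
  shows "y \<in> gens x"
proof -
  have *: "v \<in> gens u" if u: "u \<in> carrier G" "ord u = 0" and v: "v \<in> cyc u" "v \<noteq> \<one>" "nsub u v" for u v
  proof -
    obtain m :: int where m: "v = u [^] m" using v by (auto simp: cyc_def)
    have "adj (u [^] (\<bar>m\<bar> + 1)) (u [^] (1::int))"
      using u by (subst inf_adj_pow) auto
    then have "adj (u [^] (\<bar>m\<bar> + 1)) (u [^] m)"
      using v m u by (simp add: nsub_def)
    then have "m dvd \<bar>m\<bar> + 1 \<or> \<bar>m\<bar> + 1 dvd m" using u by (simp add: inf_adj_pow)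
    moreover have "m \<noteq> 0" using m v by auto
    ultimately have "m dvd 1"
      using dvd_imp_le_int[of m "\<bar>m\<bar> + 1"] by (auto simp: dvd_add_right_iff)
    then have "m = 1 \<or> m = -1" by auto
    then have "v = u \<or> v = inv u"
      using m u(1) by (elim disjE) (simp_all add: int_pow_neg)
    then show ?thesis
      using inf_gens[OF u] by blast
  qed
  have "adj x y" using t x nsub_adj by blast
  then consider "y \<in> cyc x" | "x \<in> cyc y" by (auto simp: adj_def)
  then show ?thesis
  proof cases
    case 1 then show ?thesis using * x y t by blast
  next
    case 2
    have "x \<noteq> \<one>" using x ord_eq_1 by force
    moreover have "ord y = 0" using 2 y x cyc_ord_nonzero by blast
    ultimately show ?thesis using * 2 x y t gens_sym by blast
  qed
qed

end

section \<open>Totients and prime powers\<close>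

text \<open>Besides \<open>1\<close> and \<open>n - 1\<close> there is a third unit: \<open>2\<close> for odd \<open>n\<close>, and for even \<open>n\<close> the odd one
  of \<open>n/2 - 1\<close> and \<open>n/2 - 2\<close>, whose common divisors with \<open>n\<close> divide 4.\<close>

lemma totient_gt_2:
  assumes "n > 6"
  shows "totient n > 2"
proof -
  obtain k where k: "1 < k" "k < n - 1" "coprime k n"
  proof (cases "odd n")
    case True
    with assms show ?thesis by (intro that[of 2]) auto
  next
    case False
    then obtain m where m: "n = 2 * m" by blast
    define k where "k = (if even m then m - 1 else m - 2)"
    have "odd k" "1 < k" "k < n - 1" using assms m by (auto simp: k_def)
    moreover have "coprime k n"
    proof (rule coprimeI)
      fix d assume d: "d dvd k" "d dvd n"
      have "n = 2 * k + (if even m then 2 else 4)" using m assms by (auto simp: k_def)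
      then have "d dvd (if even m then 2 else 4)" using d by (metis dvd_add_right_iff dvd_mult)
      then have "d dvd 2 ^ 2" by (auto split: if_splits intro: dvd_trans[of d 2 4])
      moreover have "odd d" using d(1) \<open>odd k\<close> dvd_trans by blast
      then have "coprime d (2 ^ 2)" by (simp only: coprime_power_right_iff coprime_right_2_iff_odd simp_thms)
      ultimately show "d dvd 1" using coprime_common_divisor[of d "2 ^ 2" d] by simp
    qed
    ultimately show ?thesis using that by blast
  qed
  then have "{1, k, n - 1} \<subseteq> totatives n"
    using assms k coprime_diff_one_left_nat[of n] by (auto simp: totatives_def)
  then have "card {1, k, n - 1} \<le> totient n"
    unfolding totient_def by (intro card_mono) auto
  then show ?thesis using k by simp
qed

lemma two_primes_not_primepow:
  fixes n :: nat
  assumes "prime p" "prime q" "p \<noteq> q" "p dvd n" "q dvd n"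
  shows "\<not> primepow n"
proof
  assume "primepow n"
  then obtain r k where "prime r" "n = r ^ k" by (auto simp: primepow_def)
  then show False using assms by (metis prime_dvd_power primes_dvd_imp_eq)
qed

lemma not_primepow_two_primes:
  fixes n :: nat
  assumes "\<not> primepow n" "n \<noteq> 0" "n \<noteq> 1" "prime p"
  obtains q where "prime q" "q \<noteq> p" "q dvd n"
proof (rule ccontr)
  assume no: "\<not> thesis"
  have pf: "prime_factors n \<subseteq> {p}"
    using no that assms by (auto simp: in_prime_factors_iff)
  have "prime_factors n \<noteq> {}"
    using assms by (auto simp: prime_factorization_empty_iff)
  with pf have "prime_factors n = {p}" by blast
  then have "n = p ^ multiplicity p n" "p dvd n"
    using prod_prime_factors[of n] assms by auto
  have "multiplicity p n > 0"
    using assms \<open>p dvd n\<close> by (simp add: prime_multiplicity_gt_zero_iff)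
  then have "primepow (p ^ multiplicity p n)" using assms by simp
  with \<open>n = p ^ _\<close> show False using assms by simp
qed

lemma primepow_dvd_total:
  fixes a b r :: nat
  assumes "primepow r" "a dvd r" "b dvd r"
  shows "a dvd b \<or> b dvd a"
proof -
  obtain p k where p: "prime p" "r = p ^ k" using assms by (auto simp: primepow_def)
  then obtain i j where "a = p ^ i" "b = p ^ j" using assms by (metis divides_primepow_nat)
  then show ?thesis by (metis le_imp_power_dvd linear)
qed

lemma primepow_dvd: "\<lbrakk>primepow (r::nat); d dvd r; d \<noteq> 1\<rbrakk> \<Longrightarrow> primepow d"
proof -
  assume r: "primepow r" "d dvd r" "d \<noteq> 1"
  then obtain p k where p: "prime p" "r = p ^ k" by (auto simp: primepow_def)
  then obtain i where "d = p ^ i" using r by (metis divides_primepow_nat)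
  moreover from this r have "i > 0" by (cases i) auto
  ultimately show "primepow d" using p by simp
qed

text \<open>In the divisor lattice of a number that is not a prime power, the full prime components
  witness that every proper nontrivial divisor is incomparable with some other divisor.\<close>

lemma exists_incomparable_component:
  fixes n d :: nat
  assumes n: "n \<noteq> 0" "\<not> primepow n" and d: "d dvd n" "d \<noteq> 1" "d \<noteq> n"
  obtains p where "prime p" "p dvd n" "\<not> p ^ multiplicity p n dvd d" "\<not> d dvd p ^ multiplicity p n"
proof (cases "primepow d")
  case True
  then obtain r i where r: "prime r" "i > 0" "d = r ^ i" by (auto simp: primepow_def)
  have "n \<noteq> 1" using d by auto
  then obtain q where q: "prime q" "q \<noteq> r" "q dvd n"
    using not_primepow_two_primes[OF n(2,1) _ r(1)] by blast
  have "multiplicity q n > 0" using q n by (simp add: prime_multiplicity_gt_zero_iff)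
  have "\<not> q ^ multiplicity q n dvd d"
    using q r \<open>multiplicity q n > 0\<close> by (metis dvd_power dvd_trans prime_dvd_power primes_dvd_imp_eq)
  moreover have "\<not> d dvd q ^ multiplicity q n"
    using q r by (metis dvd_power dvd_trans prime_dvd_power primes_dvd_imp_eq)
  ultimately show ?thesis using that q by blast
next
  case False
  have "\<exists>p. prime p \<and> multiplicity p d < multiplicity p n"
  proof (rule ccontr)
    assume "\<not> ?thesis"
    then have "n dvd d" using d n by (intro multiplicity_le_imp_dvd) (auto simp: not_less)
    then show False using d by (auto dest: dvd_antisym)
  qed
  then obtain p where p: "prime p" "multiplicity p d < multiplicity p n" by blast
  have "p dvd n" using p(2) by (cases "p dvd n") (simp_all add: not_dvd_imp_multiplicity_0)
  moreover have "\<not> p ^ multiplicity p n dvd d"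
    using p d n by (subst power_dvd_iff_le_multiplicity) auto
  moreover have "\<not> d dvd p ^ multiplicity p n"
    using False p d(2) primepow_dvd[of "p ^ multiplicity p n" d] by force
  ultimately show ?thesis using that p by blast
qed

lemma component_incomparable:
  fixes n :: nat
  assumes "prime p" "prime q" "p \<noteq> q" "p dvd n" "n \<noteq> 0"
  shows "\<not> p ^ multiplicity p n dvd q ^ multiplicity q n"
proof -
  have "multiplicity p n > 0" using assms by (simp add: prime_multiplicity_gt_zero_iff)
  then show ?thesis
    using assms by (metis dvd_power dvd_trans prime_dvd_power primes_dvd_imp_eq)
qed

lemma totient_gt_prime_pred:
  assumes "prime p" "prime q" "p < q" "q dvd n" "n > 0"
  shows "p - 1 < totient n"
proof -
  have "q - 1 \<le> totient n" using totient_dvd_mono[of q n] assms by (simp add: totient_prime)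
  then show ?thesis using assms prime_gt_1_nat[of p] by linarith
qed

text \<open>A cyclic group of prime power order has at least as many generators as non-generators.\<close>

lemma primepow_totient_half:
  assumes "primepow (n::nat)"
  shows "n - totient n \<le> totient n"
proof -
  obtain p k where p: "prime p" "k > 0" "n = p ^ k" using assms by (auto simp: primepow_def)
  have "p \<ge> 2" using p prime_ge_2_nat by blast
  have "n = p ^ (k - 1) * p" using p by (metis power_minus_mult)
  moreover have "totient n = p ^ (k - 1) * (p - 1)" using p totient_prime_power by blast
  ultimately have "n - totient n = p ^ (k - 1)"
    using \<open>p \<ge> 2\<close> by (simp flip: diff_mult_distrib2)
  also have "\<dots> \<le> p ^ (k - 1) * (p - 1)" using \<open>p \<ge> 2\<close> by simp
  finally show ?thesis using \<open>totient n = _\<close> by simp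
qed

section \<open>Twins, mixed orders and isomorphisms of power graphs\<close>

context group
begin

text \<open>The identity is left out because its closed neighbourhood is everything; it could
  otherwise be a twin of other dominating vertices.\<close>

definition twins :: "'a \<Rightarrow> 'a set" where
  "twins x = {y \<in> carrier G. y \<noteq> \<one> \<and> nsub x y \<and> nsub y x}"

text \<open>Since \<open>0\<close> encodes infinite order, these are the torsion elements whose order has at least two
  prime divisors.\<close>

definition mixed :: "'a \<Rightarrow> bool" where
  "mixed x \<longleftrightarrow> x \<in> carrier G \<and> ord x \<noteq> 0 \<and> ord x \<noteq> 1 \<and> \<not> primepow (ord x)"

lemma gens_subset_twins: "\<lbrakk>x \<in> carrier G; x \<noteq> \<one>\<rbrakk> \<Longrightarrow> gens x \<subseteq> twins x"
proof
  fix y assume x: "x \<in> carrier G" "x \<noteq> \<one>" and y: "y \<in> gens x"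
  then have "y \<in> carrier G" "y \<noteq> \<one>" by (auto simp: gens_def intro: cyc_carrier)
  then show "y \<in> twins x"
    using gens_nsub[OF x(1) y] gens_nsub[OF _ gens_sym[OF x(1) y]] by (simp add: twins_def)
qed

lemma ord_one_iff: "x \<in> carrier G \<Longrightarrow> ord x = 1 \<longleftrightarrow> x = \<one>"
  using ord_eq_1 by auto

lemma mixedI:
  assumes "x \<in> carrier G" "ord x \<noteq> 0" "prime p" "prime q" "p \<noteq> q" "p dvd ord x" "q dvd ord x"
  shows "mixed x"
  unfolding mixed_def using assms two_primes_not_primepow[of p q "ord x"] by auto

lemma mixed_two_primes:
  assumes "mixed x"
  obtains p q where "prime p" "prime q" "p < q" "p dvd ord x" "q dvd ord x"
proof -
  obtain p where p: "prime p" "p dvd ord x"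
    using assms prime_factor_nat[of "ord x"] by (auto simp: mixed_def)
  obtain q where q: "prime q" "q \<noteq> p" "q dvd ord x"
    using not_primepow_two_primes[of "ord x" p] p assms by (auto simp: mixed_def)
  show ?thesis using that[of p q] that[of q p] p q by (cases "p < q") auto
qed

lemma mixed_upward:
  assumes "mixed x" "y \<in> carrier G" "ord y \<noteq> 0" "x \<in> cyc y"
  shows "mixed y"
proof -
  obtain p q where "prime p" "prime q" "p < q" "p dvd ord x" "q dvd ord x"
    using mixed_two_primes assms(1) by blast
  then show ?thesis using assms cyc_ord_dvd[of y x] by (intro mixedI[of y p q]) (auto intro: dvd_trans)
qed

text \<open>The subgroups of a cyclic group of prime power order form a chain.\<close>

lemma incomparable_mixed:
  assumes "x \<in> carrier G" "ord x \<noteq> 0" "y \<in> cyc x" "z \<in> cyc x" "\<not> adj y z"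
  shows "mixed x"
proof (rule ccontr)
  assume "\<not> mixed x"
  then have "ord x = 1 \<or> primepow (ord x)" using assms by (auto simp: mixed_def)
  then have "ord y dvd ord z \<or> ord z dvd ord y"
    using primepow_dvd_total[of "ord x" "ord y" "ord z"] cyc_ord_dvd[of x] assms by auto
  then show False using assms cyc_iff_ord_dvd[of x y z] cyc_iff_ord_dvd[of x z y] by (auto simp: adj_def)
qed

text \<open>Let \<open>y\<close> be a nontrivial power of \<open>x\<close> that does not generate the same subgroup. The order of \<open>y\<close> is
  incomparable with a full prime component of the order of \<open>x\<close>, and a power of \<open>x\<close> of this order
  distinguishes \<open>y\<close> from \<open>x\<close>. Elements above \<open>x\<close> are of mixed order again.\<close>

lemma mixed_twins:
  assumes x: "mixed x"
  shows "twins x = gens x"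
proof
  have *: "y \<in> gens x" if "mixed x" "y \<in> cyc x" "y \<noteq> \<one>" "nsub x y" for x y
  proof (rule ccontr)
    assume ng: "y \<notin> gens x"
    have x: "x \<in> carrier G" "ord x \<noteq> 0" "\<not> primepow (ord x)" using that by (auto simp: mixed_def)
    have y: "y \<in> carrier G" using x that cyc_carrier by blast
    have "ord y dvd ord x" "ord y \<noteq> 1" "ord y \<noteq> ord x"
      using that x y cyc_ord_dvd gens_iff_ord[of x y] ng ord_one_iff by auto
    then obtain p where p: "\<not> p ^ multiplicity p (ord x) dvd ord y" "\<not> ord y dvd p ^ multiplicity p (ord x)"
      using exists_incomparable_component[of "ord x" "ord y"] x by blast
    obtain z where z: "z \<in> cyc x" "ord z = p ^ multiplicity p (ord x)"
      using cyc_ex_ord[OF x(1,2), of "p ^ multiplicity p (ord x)"] by (auto simp: multiplicity_dvd)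
    have "\<not> adj z y"
      using cyc_iff_ord_dvd[of x y z] cyc_iff_ord_dvd[of x z y] x z p that by (auto simp: adj_def)
    moreover have "adj z x" using z by (simp add: adj_def)
    ultimately show False using that(4) z x cyc_carrier unfolding nsub_def by blast
  qed
  have xc: "x \<in> carrier G" "x \<noteq> \<one>" "ord x \<noteq> 0" using x by (auto simp: mixed_def)
  show "twins x \<subseteq> gens x"
  proof
    fix y assume "y \<in> twins x"
    then have y: "y \<in> carrier G" "y \<noteq> \<one>" "nsub x y" "nsub y x" by (auto simp: twins_def)
    then have "adj x y" using xc nsub_adj by blast
    then consider "y \<in> cyc x" | "x \<in> cyc y" by (auto simp: adj_def)
    then show "y \<in> gens x"
    proof cases
      case 1 then show ?thesis using * x y by blast
    next
      case 2
      have "ord y \<noteq> 0" using adj_ord_zero[of x y] xc y \<open>adj x y\<close> by auto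
      then have "mixed y" using mixed_upward x y 2 by blast
      then have "x \<in> gens y" using * 2 xc y by blast
      then show ?thesis using gens_sym y by blast
    qed
  qed
  show "gens x \<subseteq> twins x" using gens_subset_twins xc by blast
qed

end

text \<open>Isomorphisms of power graphs that fix the identity. The locale is symmetric in both groups, so each
  fact about \<open>f\<close> also holds for its inverse.\<close>

locale power_graph_iso = G: group G + H: group H
  for G :: "('a, 'm) monoid_scheme" and H :: "('b, 'n) monoid_scheme" +
  fixes f :: "'a \<Rightarrow> 'b"
  assumes bij: "bij_betw f (carrier G) (carrier H)"
    and f_adj: "\<lbrakk>x \<in> carrier G; y \<in> carrier G\<rbrakk> \<Longrightarrow> H.adj (f x) (f y) \<longleftrightarrow> G.adj x y"
    and f_one [simp]: "f \<one>\<^bsub>G\<^esub> = \<one>\<^bsub>H\<^esub>"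
begin

abbreviation finv :: "'b \<Rightarrow> 'a" where "finv \<equiv> inv_into (carrier G) f"

lemma f_closed [simp]: "x \<in> carrier G \<Longrightarrow> f x \<in> carrier H"
  using bij by (auto simp: bij_betw_def)

lemma f_inj: "\<lbrakk>x \<in> carrier G; y \<in> carrier G\<rbrakk> \<Longrightarrow> f x = f y \<longleftrightarrow> x = y"
  using bij by (auto simp: bij_betw_def inj_on_eq_iff)

lemma finv_closed [simp]: "y \<in> carrier H \<Longrightarrow> finv y \<in> carrier G"
  using bij by (metis bij_betw_def inv_into_into)

lemma f_finv [simp]: "y \<in> carrier H \<Longrightarrow> f (finv y) = y"
  using bij by (metis bij_betw_def f_inv_into_f)

lemma finv_f [simp]: "x \<in> carrier G \<Longrightarrow> finv (f x) = x"
  using bij by (metis bij_betw_def inv_into_f_f)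

lemma f_eq_one_iff: "x \<in> carrier G \<Longrightarrow> f x = \<one>\<^bsub>H\<^esub> \<longleftrightarrow> x = \<one>\<^bsub>G\<^esub>"
  using f_inj[of x "\<one>\<^bsub>G\<^esub>"] by simp

lemma power_graph_iso_inverse: "power_graph_iso H G finv"
proof unfold_locales
  show "bij_betw finv (carrier H) (carrier G)" using bij by (rule bij_betw_inv_into)
  show "G.adj (finv x) (finv y) \<longleftrightarrow> H.adj x y" if "x \<in> carrier H" "y \<in> carrier H" for x y
    using f_adj[of "finv x" "finv y"] that by simp
  show "finv \<one>\<^bsub>H\<^esub> = \<one>\<^bsub>G\<^esub>" using finv_f[of "\<one>\<^bsub>G\<^esub>"] by simp
qed

lemma f_surj: 
  assumes "y \<in> carrier H"
  obtains x where "x \<in> carrier G" "y = f x"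
  using assms that[of "finv y"] by simp

lemma f_nsub: "\<lbrakk>x \<in> carrier G; y \<in> carrier G\<rbrakk> \<Longrightarrow> H.nsub (f x) (f y) \<longleftrightarrow> G.nsub x y"
  unfolding G.nsub_def H.nsub_def using f_adj by (metis f_closed f_surj)

lemma f_twins: "x \<in> carrier G \<Longrightarrow> H.twins (f x) = f ` G.twins x"
proof (intro equalityI subsetI)
  fix y assume x: "x \<in> carrier G" and y: "y \<in> H.twins (f x)"
  then obtain w where w: "w \<in> carrier G" "y = f w" using f_surj by (auto simp: H.twins_def)
  then have "w \<in> G.twins x" using y x f_nsub by (auto simp: H.twins_def G.twins_def)
  then show "y \<in> f ` G.twins x" using w by blast
qed (auto simp: H.twins_def G.twins_def f_nsub f_eq_one_iff)

lemma f_inj_on: "A \<subseteq> carrier G \<Longrightarrow> inj_on f A"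
  using bij by (auto simp: bij_betw_def intro: inj_on_subset)

lemma card_f_twins: "x \<in> carrier G \<Longrightarrow> card (H.twins (f x)) = card (G.twins x)"
  by (simp add: f_twins card_image f_inj_on G.twins_def)

text \<open>Twin classes of elements of infinite order have two elements, whereas the generators of a finite
  cyclic group are twins of each other. So if the image of \<open>x\<close> had finite order, then all powers
  \<open>x\<close> to \<open>2\<^sup>i\<close> would go to elements of order at most 6. Two of these have equal order, and as they are
  comparable they are twins, but the powers are not.\<close>

lemma f_ord_zero:
  assumes x: "x \<in> carrier G" "G.ord x = 0"
  shows "H.ord (f x) = 0"
proof (rule ccontr)
  assume fx: "H.ord (f x) \<noteq> 0"
  define u where "u i = x [^]\<^bsub>G\<^esub> (2 ^ i :: int)" for i :: nat
  have u: "u i \<in> carrier G" "G.ord (u i) = 0" "u i \<noteq> \<one>\<^bsub>G\<^esub>" for i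
    using x G.ord_int_pow_inf[of x "2 ^ i"] G.inf_pow_one[of x "2 ^ i"] by (auto simp: u_def)
  have x1: "x \<noteq> \<one>\<^bsub>G\<^esub>" using x by auto
  have adj: "G.adj (u i) (u j)" for i j
    using G.inf_adj_pow[OF x] le_imp_power_dvd[of _ _ "2::int"] by (auto simp: u_def) (meson linear)
  have ux: "G.adj (u i) x" for i
    by (simp add: G.adj_def u_def G.cyc_I)
  have fu: "H.ord (f (u i)) \<noteq> 0" for i
    using H.adj_ord_zero[of "f (u i)" "f x"] f_adj u[of i] x x1 ux[of i] fx by (simp add: f_eq_one_iff)
  have tw: "G.twins (u i) \<subseteq> {u i, inv\<^bsub>G\<^esub> (u i)}" for i
    using G.inf_twin_gens[OF u(1,2)[of i]] G.inf_gens[OF u(1,2)[of i]] by (auto simp: G.twins_def)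
  have "totient (H.ord (f (u i))) \<le> 2" for i
  proof -
    have "totient (H.ord (f (u i))) = card (H.gens (f (u i)))"
      using H.card_gens fu u by simp
    also have "\<dots> \<le> card (H.twins (f (u i)))"
    proof (rule card_mono)
      show "finite (H.twins (f (u i)))"
        using u tw[of i] by (simp add: f_twins) (meson finite.emptyI finite.insertI finite_subset finite_imageI)
      show "H.gens (f (u i)) \<subseteq> H.twins (f (u i))" 
        using H.gens_subset_twins[of "f (u i)"] u[of i] by (simp add: f_eq_one_iff)
    qed
    also have "\<dots> = card (G.twins (u i))" using card_f_twins u by blast
    also have "\<dots> \<le> card {u i, inv\<^bsub>G\<^esub> (u i)}" using tw[of i] by (intro card_mono) auto
    also have "\<dots> \<le> 2" by (simp add: card_insert_if)
    finally show ?thesis .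
  qed
  then have "H.ord (f (u i)) \<in> {..6}" for i
    using totient_gt_2[of "H.ord (f (u i))"] by (metis atMost_iff not_le)
  then have "\<not> inj (\<lambda>i. H.ord (f (u i)))"
    by (metis finite_atMost finite_subset image_subsetI infinite_UNIV_nat finite_imageD)
  then obtain a b where "a \<noteq> b" "H.ord (f (u a)) = H.ord (f (u b))"
    by (auto simp: inj_def)
  then obtain i j where ij: "i < j" "H.ord (f (u i)) = H.ord (f (u j))"
    by (cases "a < b") (auto simp: not_less order_le_less)
  have "f (u j) \<in> H.gens (f (u i))"
    using H.adj_iff_ord_dvd[of "f (u i)" "f (u j)"] H.adj_iff_ord_dvd[of "f (u j)" "f (u i)"]
      ij fu u adj f_adj by (simp add: H.gens_def)
  then have "f (u j) \<in> H.twins (f (u i))"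
    using H.gens_subset_twins[of "f (u i)"] u[of i] by (auto simp: f_eq_one_iff)
  then have "u j \<in> G.twins (u i)"
    using u f_twins[of "u i"] f_inj by (auto simp: G.twins_def)
  then have "u j \<in> G.gens (u i)"
    using G.inf_twin_gens[OF u(1,2)[of i]] by (auto simp: G.twins_def)
  then have "(2::int) ^ j dvd 2 ^ i"
    using G.inf_pow_cyc[OF x, of "2 ^ i" "2 ^ j"] by (simp add: G.gens_def u_def)
  then show False using zdvd_imp_le[of "2 ^ j" "2 ^ i"] ij by simp
qed

lemma f_ord_zero_iff: "x \<in> carrier G \<Longrightarrow> H.ord (f x) = 0 \<longleftrightarrow> G.ord x = 0"
  using f_ord_zero power_graph_iso.f_ord_zero[OF power_graph_iso_inverse, of "f x"] by auto

end

section \<open>Elements of mixed order keep their direction\<close>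

context group
begin

text \<open>If \<open>u\<close> had smaller order than \<open>v\<close>, then a power of \<open>Y\<close> whose order is the order of \<open>u\<close> times a new
  prime would be comparable with \<open>u\<close> and not with \<open>v\<close>.\<close>

lemma twin_below_same_order:
  assumes Y: "Y \<in> carrier G" "ord Y \<noteq> 0" "\<not> primepow (ord Y)"
    and uv: "u \<in> cyc Y" "v \<in> cyc Y" "u \<noteq> \<one>" "primepow (ord v)" "u \<in> cyc v" "nsub u v"
  shows "u \<in> gens v"
proof -
  have c: "u \<in> carrier G" "v \<in> carrier G" using Y uv cyc_carrier by blast+
  obtain r j where v: "prime r" "ord v = r ^ j" using uv(4) by (auto simp: primepow_def)
  have d: "ord u dvd ord v" "ord v dvd ord Y" "ord u dvd ord Y" 
    using cyc_ord_dvd c Y uv by auto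
  then obtain i where u: "ord u = r ^ i" "i \<le> j"
    using v divides_primepow_nat[of r "ord u" j] by auto
  have "i > 0" using u(1) uv(3) ord_one_iff c by (cases i) auto
  have "ord Y \<noteq> 1" using d(3) u \<open>i > 0\<close> v(1) by (auto simp: prime_nat_iff)
  then obtain k where k: "prime k" "k \<noteq> r" "k dvd ord Y"
    using not_primepow_two_primes[OF Y(3,2) _ v(1)] by blast
  have cop: "coprime (r ^ l) k" for l using k v primes_coprime[of r k] by auto
  have "ord u * k dvd ord Y" using d(3) u k cop[of i] by (auto intro: divides_mult)
  then obtain e where e: "e \<in> cyc Y" "ord e = ord u * k"
    using cyc_ex_ord[OF Y(1,2)] by blast
  then have ec: "e \<in> carrier G" using Y cyc_carrier by blast
  have "adj e u" using cyc_iff_ord_dvd[OF Y(1,2) uv(1) e(1)] e by (auto simp: adj_def)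
  then have "adj e v" using uv(6) ec by (auto simp: nsub_def)
  then have "ord e dvd ord v \<or> ord v dvd ord e" using cyc_ord_dvd c ec by (auto simp: adj_def)
  moreover have "\<not> ord e dvd ord v"
    using e(2) v k by (metis dvd_mult_right prime_dvd_power primes_dvd_imp_eq)
  ultimately have "r ^ j dvd r ^ i * k" using e u v by simp
  then have "r ^ j dvd r ^ i" using cop[of j] by (simp add: coprime_dvd_mult_left_iff)
  then have "ord u = ord v" using d(1) u v by (auto intro: dvd_antisym)
  then show ?thesis using gens_iff_ord[of v u] c uv(5) Y v d(2) by auto
qed

end

context power_graph_iso
begin

text \<open>If \<open>v\<close> and \<open>w\<close> are incomparable powers of \<open>x\<close>, then their arcs to \<open>x\<close> have the same direction
  in the image, since otherwise transitivity would make the images comparable. Every nontrivial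
  non-generator is incomparable with an element whose order is a full prime component, and
  elements for different components are incomparable, which links all arcs.\<close>

lemma mixed_reversed_all:
  assumes x: "G.mixed x"
    and y: "y \<in> G.cyc x" "y \<noteq> \<one>\<^bsub>G\<^esub>" "y \<notin> G.gens x" "f y \<notin> H.cyc (f x)"
    and z: "z \<in> G.cyc x" "z \<noteq> \<one>\<^bsub>G\<^esub>" "z \<notin> G.gens x"
  shows "f x \<in> H.cyc (f z)"
proof -
  have xc: "x \<in> carrier G" "G.ord x \<noteq> 0" "\<not> primepow (G.ord x)" "G.ord x \<noteq> 1"
    using x by (auto simp: G.mixed_def)
  have step: "f w \<notin> H.cyc (f x)" if "v \<in> G.cyc x" "w \<in> G.cyc x" "\<not> G.adj v w" "f v \<notin> H.cyc (f x)" for v w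
  proof
    assume w: "f w \<in> H.cyc (f x)"
    have c: "v \<in> carrier G" "w \<in> carrier G" using that xc G.cyc_carrier by blast+
    have "G.adj v x" using that by (simp add: G.adj_def)
    then have "f x \<in> H.cyc (f v)" using f_adj[of v x] c xc that by (auto simp: H.adj_def)
    then have "f w \<in> H.cyc (f v)" using w H.cyc_trans[of "f v" "f x" "f w"] c by simp
    then show False using that(3) f_adj[of v w] c by (auto simp: H.adj_def)
  qed
  have comp: "\<exists>p. prime p \<and> p dvd G.ord x \<and> (\<forall>w\<in>G.cyc x. G.ord w = p ^ multiplicity p (G.ord x) \<longrightarrow> \<not> G.adj v w)"
    if v: "v \<in> G.cyc x" "v \<noteq> \<one>\<^bsub>G\<^esub>" "v \<notin> G.gens x" for v
  proof -
    have vc: "v \<in> carrier G" using v xc G.cyc_carrier by blast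
    have "G.ord v dvd G.ord x" "G.ord v \<noteq> 1" "G.ord v \<noteq> G.ord x"
      using v G.cyc_ord_dvd[OF xc(1) v(1)] G.gens_iff_ord[OF xc(1,2) v(1)] G.ord_one_iff[OF vc] by simp_all
    then obtain p where "prime p" "p dvd G.ord x"
      "\<not> p ^ multiplicity p (G.ord x) dvd G.ord v" "\<not> G.ord v dvd p ^ multiplicity p (G.ord x)"
      using exists_incomparable_component[of "G.ord x" "G.ord v"] xc by blast
    then show ?thesis
      using G.cyc_iff_ord_dvd[OF xc(1,2)] v by (auto simp: G.adj_def)
  qed
  obtain p where p: "prime p" "p dvd G.ord x"
    "\<And>w. \<lbrakk>w\<in>G.cyc x; G.ord w = p ^ multiplicity p (G.ord x)\<rbrakk> \<Longrightarrow> \<not> G.adj y w"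
    using comp[OF y(1-3)] by blast
  obtain q where q: "prime q" "q dvd G.ord x"
    "\<And>w. \<lbrakk>w\<in>G.cyc x; G.ord w = q ^ multiplicity q (G.ord x)\<rbrakk> \<Longrightarrow> \<not> G.adj z w"
    using comp[OF z(1-3)] by blast
  obtain P where P: "P \<in> G.cyc x" "G.ord P = p ^ multiplicity p (G.ord x)"
    using G.cyc_ex_ord[OF xc(1,2), of "p ^ multiplicity p (G.ord x)"] by (auto simp: multiplicity_dvd)
  obtain Q where Q: "Q \<in> G.cyc x" "G.ord Q = q ^ multiplicity q (G.ord x)"
    using G.cyc_ex_ord[OF xc(1,2), of "q ^ multiplicity q (G.ord x)"] by (auto simp: multiplicity_dvd)
  have "f P \<notin> H.cyc (f x)" using step[OF y(1) P(1)] p(3)[OF P] y(4) by blast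
  moreover have "f Q \<notin> H.cyc (f x)"
  proof (cases "p = q")
    case True
    then show ?thesis using step[OF y(1) Q(1)] p(3)[OF Q(1)] Q(2) y(4) by blast
  next
    case False
    have "\<not> G.adj P Q"
      using G.cyc_iff_ord_dvd[OF xc(1,2) P(1) Q(1)] G.cyc_iff_ord_dvd[OF xc(1,2) Q(1) P(1)] P Q
        component_incomparable[OF p(1) q(1) False p(2) xc(2)]
        component_incomparable[OF q(1) p(1) _ q(2) xc(2)] False by (auto simp: G.adj_def)
    then show ?thesis using step[OF P(1) Q(1)] \<open>f P \<notin> _\<close> by blast
  qed
  ultimately have "f z \<notin> H.cyc (f x)"
    using step[OF Q(1) z(1)] q(3)[OF Q] G.adj_sym by blast
  moreover have "G.adj z x" using z by (simp add: G.adj_def)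
  ultimately show ?thesis
    using f_adj[of z x] z xc G.cyc_carrier by (auto simp: H.adj_def)
qed

text \<open>Suppose that some arc is reversed, and hence all are. Take powers \<open>a\<close> and \<open>b\<close> of \<open>x\<close> of prime orders
  \<open>p < q\<close>; then \<open>f x\<close> lies below the incomparable elements \<open>f a\<close> and \<open>f b\<close>. The twins of \<open>a\<close> are its \<open>p - 1\<close>
  generators, so \<open>f a\<close> has at most \<open>p - 1\<close> generators, while \<open>f x\<close> has \<open>totient (ord x) > p - 1\<close> twins.
  But all twins of \<open>f x\<close> are non-generators of the cyclic group of \<open>f a\<close>. If its order is a prime
  power, these are no more numerous than its generators; otherwise the twins of \<open>f x\<close> generate the
  same subgroup, whose number of generators is at most that of the larger group.\<close>

lemma mixed_forward:
  assumes x: "G.mixed x" and y: "y \<in> G.cyc x" "y \<notin> G.gens x"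
  shows "f y \<in> H.cyc (f x)"
proof (rule ccontr)
  assume reversing: "f y \<notin> H.cyc (f x)"
  have xc: "x \<in> carrier G" "G.ord x \<noteq> 0" "\<not> primepow (G.ord x)" "x \<noteq> \<one>\<^bsub>G\<^esub>"
    using x by (auto simp: G.mixed_def)
  have y1: "y \<noteq> \<one>\<^bsub>G\<^esub>" using reversing by auto
  obtain p q where pq: "prime p" "prime q" "p < q" "p dvd G.ord x" "q dvd G.ord x"
    using G.mixed_two_primes[OF x] by blast
  have cop: "coprime p q" using pq primes_coprime by auto
  obtain a where a: "a \<in> G.cyc x" "G.ord a = p" using G.cyc_ex_ord[OF xc(1,2) pq(4)] by blast
  obtain b where b: "b \<in> G.cyc x" "G.ord b = q" using G.cyc_ex_ord[OF xc(1,2) pq(5)] by blast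
  have "p * q dvd G.ord x" using pq cop by (intro divides_mult)
  then obtain w where w: "w \<in> G.cyc x" "G.ord w = p * q" using G.cyc_ex_ord[OF xc(1,2)] by blast
  have c: "a \<in> carrier G" "b \<in> carrier G" "w \<in> carrier G" using a b w xc G.cyc_carrier by blast+
  have ndvd: "\<not> p dvd q" "\<not> q dvd p" using pq primes_dvd_imp_eq by auto
  have nab: "\<not> G.adj a b"
    using G.cyc_iff_ord_dvd[OF xc(1,2)] a b ndvd by (auto simp: G.adj_def)
  have ne1: "a \<noteq> \<one>\<^bsub>G\<^esub>" "b \<noteq> \<one>\<^bsub>G\<^esub>" using nab by auto
  have "a \<notin> G.gens x" "b \<notin> G.gens x"
    using G.gens_ord[OF xc(1), of a] G.gens_ord[OF xc(1), of b] a b pq xc by auto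
  then have XY: "f x \<in> H.cyc (f a)" "f x \<in> H.cyc (f b)"
    using mixed_reversed_all[OF x y(1) y1 y(2) reversing] a b ne1 by blast+
  have fin: "H.ord (f a) \<noteq> 0" "H.ord (f b) \<noteq> 0" "H.ord (f x) \<noteq> 0"
    using f_ord_zero_iff c xc a b pq by auto
  have nfab: "\<not> H.adj (f a) (f b)" using nab f_adj c by blast
  have ntw: "\<not> G.nsub x a" using nab b c unfolding G.nsub_def by (metis G.adj_def G.adj_sym)
  have twa: "G.twins a \<subseteq> G.gens a"
  proof
    fix t assume "t \<in> G.twins a"
    then have t: "t \<in> carrier G" "t \<noteq> \<one>\<^bsub>G\<^esub>" "G.nsub a t" "G.nsub t a" by (auto simp: G.twins_def)
    have "G.adj x a" using a by (simp add: G.adj_def)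
    then have "G.adj x t" using t xc by (auto simp: G.nsub_def)
    have nbt: "\<not> G.adj b t" using t(4) nab c by (auto simp: G.nsub_def G.adj_sym)
    then have tx: "t \<in> G.cyc x"
      using \<open>G.adj x t\<close> b t G.cyc_trans unfolding G.adj_def by blast
    then have nq: "\<not> q dvd G.ord t" using nbt G.cyc_iff_ord_dvd[OF xc(1,2) b(1) tx] b by (auto simp: G.adj_def)
    have "G.adj w a" using G.cyc_iff_ord_dvd[OF xc(1,2) a(1) w(1)] a w by (simp add: G.adj_def)
    then have "G.adj w t" using t c by (auto simp: G.nsub_def)
    then have "G.ord t dvd p * q"
      using G.cyc_ord_dvd[of t w] G.cyc_ord_dvd[of w t] c t w nq by (auto simp: G.adj_def dest: dvd_mult_right)
    moreover have "coprime (G.ord t) q" using nq pq by (meson coprime_commute prime_imp_coprime)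
    ultimately have "G.ord t dvd p" by (simp add: coprime_dvd_mult_left_iff)
    moreover have "G.ord t \<noteq> 1" using t G.ord_one_iff by blast
    ultimately have "G.ord t = p" using pq(1) by (auto simp: prime_nat_iff)
    then show "t \<in> G.gens a"
      using G.cyc_iff_ord_dvd[OF xc(1,2) a(1) tx] G.cyc_iff_ord_dvd[OF xc(1,2) tx a(1)] a
      by (simp add: G.gens_def)
  qed
  have "totient (H.ord (f a)) = card (H.gens (f a))" using H.card_gens fin c by simp
  also have "\<dots> \<le> card (f ` G.twins a)"
    using H.gens_subset_twins[of "f a"] c ne1 twa G.finite_gens[of a] a pq
    by (intro card_mono) (auto simp: f_twins f_eq_one_iff intro: finite_subset)
  also have "\<dots> \<le> card (G.twins a)" 
    by (rule card_image_le) (use twa G.finite_gens[of a] a pq c in \<open>auto intro: finite_subset\<close>)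
  also have "\<dots> \<le> card (G.gens a)"
    by (rule card_mono) (use twa G.finite_gens[of a] a pq c in auto)
  also have "\<dots> = p - 1" using G.card_gens[of a] c a pq by (simp add: totient_prime)
  finally have up: "totient (H.ord (f a)) \<le> p - 1" .
  have "card (H.twins (f x)) = totient (G.ord x)"
    using card_f_twins G.mixed_twins[OF x] G.card_gens xc by simp
  moreover have "p - 1 < totient (G.ord x)" using totient_gt_prime_pred pq xc by auto
  ultimately have lo: "p - 1 < card (H.twins (f x))" by simp
  have below: "t \<in> H.cyc (f a) \<and> t \<notin> H.gens (f a) \<and> t \<noteq> \<one>\<^bsub>H\<^esub>" if "t \<in> H.twins (f x)" for t
  proof -
    have t: "t \<in> carrier H" "t \<noteq> \<one>\<^bsub>H\<^esub>" "H.nsub (f x) t" "H.nsub t (f x)"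
      using that by (auto simp: H.twins_def)
    have at: "H.adj (f a) t" "H.adj (f b) t"
      using t(3) XY c unfolding H.nsub_def H.adj_def by auto
    have "f a \<notin> H.cyc t"
    proof
      assume fa: "f a \<in> H.cyc t"
      then have fb: "f b \<in> H.cyc t"
        using at nfab c t H.cyc_trans unfolding H.adj_def by (metis f_closed)
      have "H.ord t \<noteq> 0" using H.adj_ord_zero[of "f a" t] c ne1 t at fin by (auto simp: f_eq_one_iff)
      then have "H.mixed t" using H.incomparable_mixed fa fb nfab t by blast
      moreover have "f x \<in> H.twins t" using t xc by (simp add: H.twins_def f_eq_one_iff)
      ultimately have "f x \<in> H.gens t" using H.mixed_twins by blast
      then have "t \<in> H.cyc (f x)" by (simp add: H.gens_def)
      then have "f a \<in> H.cyc (f x)" using fa H.cyc_trans xc by simp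
      then have "f a \<in> H.gens (f x)" using XY by (simp add: H.gens_def)
      then show False using H.gens_nsub[of "f x" "f a"] ntw f_nsub xc c by simp
    qed
    then have "t \<in> H.cyc (f a)" "t \<notin> H.gens (f a)" using at by (auto simp: H.adj_def H.gens_def)
    then show ?thesis using t by blast
  qed
  have "card (H.twins (f x)) \<le> totient (H.ord (f a))"
  proof (cases "primepow (H.ord (f a))")
    case True
    have "card (H.twins (f x)) \<le> card (H.cyc (f a) - H.gens (f a))"
      using below H.finite_cyc[of "f a"] c fin by (intro card_mono) auto
    also have "\<dots> = H.ord (f a) - totient (H.ord (f a))"
      using H.card_cyc[of "f a"] H.card_gens[of "f a"] H.finite_gens[of "f a"] c fin
      by (subst card_Diff_subset) (auto simp: H.gens_def)
    also have "\<dots> \<le> totient (H.ord (f a))" using primepow_totient_half True by blast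
    finally show ?thesis .
  next
    case False
    have "H.twins (f x) \<subseteq> H.gens (f x)"
    proof (cases "H.mixed (f x)")
      case True then show ?thesis using H.mixed_twins by blast
    next
      case nm: False
      show ?thesis
      proof
        fix t assume tt: "t \<in> H.twins (f x)"
        then have t: "t \<in> carrier H" "t \<noteq> \<one>\<^bsub>H\<^esub>" "H.nsub (f x) t" "H.nsub t (f x)"
          by (auto simp: H.twins_def)
        have fx: "f x \<in> carrier H" "f x \<noteq> \<one>\<^bsub>H\<^esub>" using xc by (auto simp: f_eq_one_iff)
        have at: "H.adj (f x) t" using H.nsub_adj t fx by blast
        have ot: "H.ord t \<noteq> 0" using H.adj_ord_zero[OF fx(1) t(1)] fx t at fin by blast
        have ppx: "primepow (H.ord (f x))" using nm fin fx H.ord_one_iff[of "f x"] by (auto simp: H.mixed_def)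
        show "t \<in> H.gens (f x)"
        proof (cases "H.mixed t")
          case True
          then have "f x \<in> H.gens t" using H.mixed_twins t fx by (auto simp: H.twins_def)
          then show ?thesis using H.gens_sym t by blast
        next
          case nmt: False
          have ppt: "primepow (H.ord t)" using nmt ot t H.ord_one_iff[of t] by (auto simp: H.mixed_def)
          consider "t \<in> H.cyc (f x)" | "f x \<in> H.cyc t" using at by (auto simp: H.adj_def)
          then show ?thesis
          proof cases
            case 1
            then show ?thesis
              using H.twin_below_same_order[of "f a" t "f x"] c fin False below[OF tt] XY t ppx by simp
          next
            case 2
            then have "f x \<in> H.gens t"
              using H.twin_below_same_order[of "f a" "f x" t] c fin False below[OF tt] XY t ppt fx by simp
            then show ?thesis using H.gens_sym t by blast
          qed
        qed
      qed
    qed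
    then have "card (H.twins (f x)) \<le> card (H.gens (f x))"
      using H.finite_gens xc fin by (intro card_mono) auto
    also have "\<dots> = totient (H.ord (f x))" using H.card_gens xc fin by simp
    also have "\<dots> \<le> totient (H.ord (f a))"
      using H.cyc_ord_dvd[of "f a" "f x"] XY c fin by (intro totient_dvd_mono) auto
    finally show ?thesis .
  qed
  with up lo show False by simp
qed

text \<open>Powers of two different prime orders are incomparable, and they stay powers of \<open>f x\<close>.\<close>

lemma mixed_image:
  assumes x: "G.mixed x"
  shows "H.mixed (f x)"
proof -
  have xc: "x \<in> carrier G" "G.ord x \<noteq> 0" using x by (auto simp: G.mixed_def)
  obtain p q where pq: "prime p" "prime q" "p < q" "p dvd G.ord x" "q dvd G.ord x"
    using G.mixed_two_primes[OF x] by blast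
  obtain a where a: "a \<in> G.cyc x" "G.ord a = p" using G.cyc_ex_ord[OF xc pq(4)] by blast
  obtain b where b: "b \<in> G.cyc x" "G.ord b = q" using G.cyc_ex_ord[OF xc pq(5)] by blast
  have np: "\<not> primepow (G.ord x)" using x by (auto simp: G.mixed_def)
  have "a \<notin> G.gens x" "b \<notin> G.gens x"
    using G.gens_ord[OF xc(1), of a] G.gens_ord[OF xc(1), of b] a b pq np by auto
  then have "f a \<in> H.cyc (f x)" "f b \<in> H.cyc (f x)" using mixed_forward[OF x] a b by blast+
  moreover have c: "a \<in> carrier G" "b \<in> carrier G" using a b G.cyc_carrier[OF xc(1)] by blast+
  have "\<not> p dvd q" "\<not> q dvd p" using pq primes_dvd_imp_eq by auto
  then have "\<not> G.adj a b"
    using G.cyc_iff_ord_dvd[OF xc a(1) b(1)] G.cyc_iff_ord_dvd[OF xc b(1) a(1)] a b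
    by (simp add: G.adj_def)
  then have "\<not> H.adj (f a) (f b)" using f_adj[OF c] by simp
  ultimately show ?thesis using H.incomparable_mixed[of "f x"] xc f_ord_zero_iff by simp
qed

lemma mixed_cyc_image_subset:
  assumes x: "G.mixed x"
  shows "f ` G.cyc x \<subseteq> H.cyc (f x)"
proof
  fix z assume "z \<in> f ` G.cyc x"
  then obtain y where y: "y \<in> G.cyc x" "z = f y" by (rule imageE)
  have xc: "x \<in> carrier G" using x by (auto simp: G.mixed_def)
  show "z \<in> H.cyc (f x)"
  proof (cases "y \<in> G.gens x")
    case True
    then have "f y \<in> H.twins (f x)" by (simp add: f_twins[OF xc] G.mixed_twins[OF x])
    then show ?thesis using H.mixed_twins[OF mixed_image[OF x]] y(2) by (simp add: H.gens_def)
  qed (use mixed_forward[OF x] y in blast)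
qed


lemma mixed_iff: "x \<in> carrier G \<Longrightarrow> H.mixed (f x) \<longleftrightarrow> G.mixed x"
  using mixed_image power_graph_iso.mixed_image[OF power_graph_iso_inverse, of "f x"] by auto

lemma mixed_cyc_image:
  assumes x: "G.mixed x"
  shows "f ` G.cyc x = H.cyc (f x)"
proof
  have xc: "x \<in> carrier G" using x by (auto simp: G.mixed_def)
  show "f ` G.cyc x \<subseteq> H.cyc (f x)" by (rule mixed_cyc_image_subset[OF x])
  have *: "finv ` H.cyc (f x) \<subseteq> G.cyc x"
    using power_graph_iso.mixed_cyc_image_subset[OF power_graph_iso_inverse mixed_image[OF x]] xc by simp
  show "H.cyc (f x) \<subseteq> f ` G.cyc x"
  proof
    fix y assume y: "y \<in> H.cyc (f x)"
    then have "y \<in> carrier H" using xc H.cyc_carrier f_closed by blast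
    then show "y \<in> f ` G.cyc x" using * y by (metis f_finv image_subset_iff image_eqI)
  qed
qed

lemma mixed_ord:
  assumes x: "G.mixed x"
  shows "H.ord (f x) = G.ord x"
proof -
  have xc: "x \<in> carrier G" "G.ord x \<noteq> 0" using x by (auto simp: G.mixed_def)
  have "H.ord (f x) = card (H.cyc (f x))" using H.card_cyc[of "f x"] xc f_ord_zero_iff[of x] by simp
  also have "\<dots> = card (G.cyc x)"
    using mixed_cyc_image[OF x] f_inj_on[of "G.cyc x"] G.cyc_subset_carrier[OF xc(1)] by (metis card_image)
  finally show ?thesis using G.card_cyc xc by simp
qed

end

section \<open>Powers of elements of mixed order\<close>

context group
begin

text \<open>If \<open>y\<close> generates a full primary component of the cyclic group of \<open>z\<close>, then this component can be
  seen in the graph, together with the knowledge of which elements are of mixed order.\<close>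

lemma full_component_nbrs:
  assumes z: "z \<in> carrier G" "ord z = r * s" "ord z \<noteq> 0" "coprime r s" "primepow r"
    and y: "y \<in> cyc z" "ord y = r"
  shows "{w \<in> cyc z. \<not> mixed w \<and> w \<noteq> \<one> \<and> adj w y} = cyc y - {\<one>}"
proof -
  have yc: "y \<in> carrier G" "ord y \<noteq> 0" using y z cyc_carrier by auto
  have 1: "w \<in> cyc y" if w: "w \<in> cyc z" "\<not> mixed w" "w \<noteq> \<one>" "y \<in> cyc w" for w
  proof -
    have wc: "w \<in> carrier G" "ord w \<noteq> 0" using w z cyc_carrier cyc_ord_nonzero by blast+
    have "primepow (ord w)" using w wc ord_one_iff by (auto simp: mixed_def)
    then obtain p k where p: "prime p" "ord w = p ^ k" by (auto simp: primepow_def)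
    obtain i where i: "r = p ^ i" using cyc_ord_dvd[OF wc(1) w(4)] y p divides_primepow_nat[of p r k] by auto
    have "i > 0" using i z(5) by (cases i) auto
    then have "coprime p s" using z(4) i by (simp add: coprime_power_left_iff)
    then have "coprime (ord w) s" using p by (simp add: coprime_power_left_iff)
    moreover have "ord w dvd r * s" using cyc_ord_dvd[OF z(1) w(1)] z by simp
    ultimately have "ord w dvd ord y" using y by (simp add: coprime_dvd_mult_left_iff)
    then show ?thesis using cyc_iff_ord_dvd[OF z(1,3) w(1) y(1)] by simp
  qed
  have 2: "w \<in> cyc z \<and> \<not> mixed w" if w: "w \<in> cyc y" "w \<noteq> \<one>" for w
  proof -
    have wc: "w \<in> carrier G" using w yc cyc_carrier by blast
    have "primepow (ord w)"
      using primepow_dvd[OF z(5), of "ord w"] cyc_ord_dvd[OF yc(1) w(1)] y w ord_one_iff[OF wc] by simp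
    then show ?thesis using cyc_trans[OF z(1) y(1) w(1)] by (simp add: mixed_def)
  qed
  show ?thesis using 1 2 by (auto simp: adj_def)
qed

end

context power_graph_iso
begin

text \<open>For \<open>y\<close> of order \<open>p\<^sup>i\<close> choose \<open>t\<close> above it of order \<open>p\<^sup>i q\<close>, with a second prime \<open>q\<close>. The order of \<open>f y\<close>
  is a prime power that divides \<open>p\<^sup>i q\<close>. It is not \<open>q\<close>, since then the primary components of \<open>y\<close> and \<open>f y\<close>
  would correspond and have equal cardinality \<open>p\<^sup>i = q\<close>.\<close>

lemma shared_ord_dvd:
  assumes z: "G.mixed z" and y: "y \<in> G.cyc z"
  shows "H.ord (f y) dvd G.ord y"
proof (cases "G.mixed y \<or> y = \<one>\<^bsub>G\<^esub>")
  case True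
  then show ?thesis using mixed_ord by auto
next
  case False
  have zc: "z \<in> carrier G" "G.ord z \<noteq> 0" "G.ord z \<noteq> 1" "\<not> primepow (G.ord z)"
    using z by (auto simp: G.mixed_def)
  have yc: "y \<in> carrier G" "G.ord y \<noteq> 0" using y zc G.cyc_carrier G.cyc_ord_nonzero by blast+
  have pp: "primepow (G.ord y)" using False yc G.ord_one_iff by (auto simp: G.mixed_def)
  then obtain p i where p: "prime p" "i > 0" "G.ord y = p ^ i" by (auto simp: primepow_def)
  obtain q where q: "prime q" "q \<noteq> p" "q dvd G.ord z"
    using not_primepow_two_primes[OF zc(4,2,3) p(1)] by blast
  have cop: "coprime (p ^ i) q" using primes_coprime[of p q] p q by simp
  have "p ^ i * q dvd G.ord z" using cop q p G.cyc_ord_dvd[OF zc(1) y] by (intro divides_mult) auto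
  then obtain t where t: "t \<in> G.cyc z" "G.ord t = p ^ i * q" using G.cyc_ex_ord[OF zc(1,2)] by blast
  have tc: "t \<in> carrier G" "G.ord t \<noteq> 0" using t zc G.cyc_carrier G.cyc_ord_nonzero by blast+
  have yt: "y \<in> G.cyc t" using G.cyc_iff_ord_dvd[OF zc(1,2) y t(1)] t p by simp
  have tm: "G.mixed t" using G.mixedI[OF tc p(1) q(1)] q(2) t p(2) by auto
  have ft: "H.ord (f t) = p ^ i * q" "f t \<in> carrier H" "H.ord (f t) \<noteq> 0" using mixed_ord[OF tm] t tc by auto
  have fim: "f ` G.cyc t = H.cyc (f t)" by (rule mixed_cyc_image[OF tm])
  have fy: "f y \<in> H.cyc (f t)" "f y \<in> carrier H" "f y \<noteq> \<one>\<^bsub>H\<^esub>" "\<not> H.mixed (f y)" "H.ord (f y) \<noteq> 0"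
    using fim yt yc False mixed_iff f_eq_one_iff f_ord_zero_iff by auto
  have ppf: "primepow (H.ord (f y))" using fy H.ord_one_iff by (auto simp: H.mixed_def)
  have fd: "H.ord (f y) dvd p ^ i * q" using H.cyc_ord_dvd[OF ft(2) fy(1)] ft by simp
  show ?thesis
  proof (cases "q dvd H.ord (f y)")
    case False
    then have "coprime (H.ord (f y)) q" using q by (meson coprime_commute prime_imp_coprime)
    then show ?thesis using fd p by (simp add: coprime_dvd_mult_left_iff)
  next
    case True
    have "\<not> p dvd H.ord (f y)" using two_primes_not_primepow[OF p(1) q(1), of "H.ord (f y)"] q True ppf by auto
    then have "coprime (H.ord (f y)) (p ^ i)" using p(1) by (simp add: prime_imp_coprime coprime_commute)
    then have "H.ord (f y) dvd q" using fd by (simp add: coprime_dvd_mult_right_iff)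
    then have oq: "H.ord (f y) = q" using True by (rule dvd_antisym)
    let ?W = "{w \<in> G.cyc t. \<not> G.mixed w \<and> w \<noteq> \<one>\<^bsub>G\<^esub> \<and> G.adj w y}"
    let ?W' = "{w \<in> H.cyc (f t). \<not> H.mixed w \<and> w \<noteq> \<one>\<^bsub>H\<^esub> \<and> H.adj w (f y)}"
    have "?W' = f ` ?W"
      unfolding fim[symmetric] using G.cyc_subset_carrier[OF tc(1)] yc(1)
      by (auto simp: mixed_iff f_eq_one_iff f_adj subset_iff)
    moreover have "?W \<subseteq> carrier G" using G.cyc_subset_carrier[OF tc(1)] by blast
    ultimately have "card ?W' = card ?W" by (simp only: card_image[OF f_inj_on])
    moreover have "?W = G.cyc y - {\<one>\<^bsub>G\<^esub>}"
      using G.full_component_nbrs[OF tc(1) t(2) tc(2) cop _ yt p(3)] pp p by simp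
    moreover have "?W' = H.cyc (f y) - {\<one>\<^bsub>H\<^esub>}"
      using H.full_component_nbrs[of "f t" q "p ^ i" "f y"] ft cop fy oq q by (simp add: coprime_commute mult.commute)
    moreover have "card (G.cyc y - {\<one>\<^bsub>G\<^esub>}) = p ^ i - 1"
      using G.card_cyc[OF yc] G.finite_cyc[OF yc] p by simp
    moreover have "card (H.cyc (f y) - {\<one>\<^bsub>H\<^esub>}) = q - 1"
      using H.card_cyc[of "f y"] H.finite_cyc[of "f y"] fy oq by simp
    ultimately have "p ^ i - 1 = q - 1" by simp
    moreover have "p ^ i > 0" "q > 0" using p(1) q(1) by (auto simp: prime_gt_0_nat)
    ultimately have "p ^ i = q" by linarith
    then show ?thesis using p oq by simp
  qed
qed

text \<open>Divisibility in the other direction is the same fact for the inverse of \<open>f\<close>.\<close>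

lemma shared_ord:
  assumes z: "G.mixed z" and y: "y \<in> G.cyc z"
  shows "H.ord (f y) = G.ord y"
proof (rule dvd_antisym)
  show "H.ord (f y) dvd G.ord y" by (rule shared_ord_dvd[OF z y])
  have zc: "z \<in> carrier G" using z by (auto simp: G.mixed_def)
  have yc: "y \<in> carrier G" using y zc G.cyc_carrier by blast
  have "G.ord (finv (f y)) dvd H.ord (f y)"
    by (rule power_graph_iso.shared_ord_dvd[OF power_graph_iso_inverse mixed_image[OF z]])
       (use y mixed_cyc_image[OF z] in blast)
  then show "G.ord y dvd H.ord (f y)" using yc by simp
qed

end

section \<open>Recognising quasicyclic subgroups\<close>

definition root_cis :: "nat \<Rightarrow> nat \<Rightarrow> complex" where
  "root_cis n a = cis (2 * pi * real a / real n)"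

lemma root_cis_mod:
  assumes "n > 0"
  shows "root_cis n a = root_cis n (a mod n)"
proof -
  have eq: "2 * pi * real a / real n = 2 * pi * real (a div n) + 2 * pi * real (a mod n) / real n"
  proof -
    have "real a = real (a div n) * real n + real (a mod n)"
      by (metis div_mult_mod_eq of_nat_add of_nat_mult)
    then have "2 * pi * real a / real n = 2 * pi * (real (a div n) * real n + real (a mod n)) / real n"
      by simp
    then show ?thesis using assms by (simp add: field_simps)
  qed
  have "root_cis n a = cis (2 * pi * real (a div n)) * root_cis n (a mod n)"
    unfolding root_cis_def by (subst eq) (simp only: cis_mult)
  then show ?thesis using cis_multiple_2pi[of "real (a div n)"] by simp
qed

lemma root_cis_eq_iff:
  assumes "n > 0"
  shows "root_cis n a = root_cis n b \<longleftrightarrow> a mod n = b mod n"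
proof
  have inj: "inj_on (root_cis n) {..<n}"
    using bij_betw_roots_unity[OF assms] by (simp add: bij_betw_def root_cis_def[abs_def])
  assume "root_cis n a = root_cis n b"
  then have "root_cis n (a mod n) = root_cis n (b mod n)"
    using root_cis_mod[OF assms] by metis
  then show "a mod n = b mod n" using inj assms by (auto dest: inj_onD)
qed (metis root_cis_mod[OF assms])

lemma root_cis_mult: "root_cis n a * root_cis n b = root_cis n (a + b)"
  by (simp add: root_cis_def cis_mult add_divide_distrib distrib_left)

lemma root_cis_scale: "m > 0 \<Longrightarrow> root_cis (n * m) (a * m) = root_cis n a"
  by (simp add: root_cis_def mult.assoc)

lemma root_cis_power: "n > 0 \<Longrightarrow> root_cis n a ^ n = 1"
  using cis_multiple_2pi[of "real a"] by (simp add: root_cis_def DeMoivre)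

lemma root_cis_surj:
  assumes "n > 0" "z ^ n = 1"
  obtains a where "z = root_cis n a"
  using bij_betw_roots_unity[OF assms(1)] assms(2)
  by (auto simp: bij_betw_def root_cis_def[abs_def] set_eq_iff image_iff)

context group
begin

text \<open>A union of a chain of cyclic subgroups, described by its elements.\<close>

definition cyclic_chain :: "'a set \<Rightarrow> bool" where
  "cyclic_chain A \<longleftrightarrow> A \<subseteq> carrier G \<and> A \<noteq> {} \<and> (\<forall>w\<in>A. cyc w \<subseteq> A) \<and> (\<forall>v\<in>A. \<forall>w\<in>A. adj v w)"

lemma cyclic_chainD:
  assumes "cyclic_chain A"
  shows "A \<subseteq> carrier G" "A \<noteq> {}" "\<lbrakk>w \<in> A; v \<in> cyc w\<rbrakk> \<Longrightarrow> v \<in> A" "\<lbrakk>v \<in> A; w \<in> A\<rbrakk> \<Longrightarrow> adj v w"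
  using assms unfolding cyclic_chain_def by blast+

text \<open>An element of maximal order generates the whole chain.\<close>

lemma finite_chain_cyclic:
  assumes cA: "cyclic_chain A"
    and bnd: "\<And>w. w \<in> A \<Longrightarrow> ord w \<noteq> 0 \<and> ord w \<le> N"
  obtains m where "m \<in> A" "A = cyc m"
proof -
  note A = cyclic_chainD(1,3)[OF cA] and chain = cyclic_chainD(4)[OF cA] and ne = cyclic_chainD(2)[OF cA]
  have fin: "finite (ord ` A)" by (rule finite_subset[of _ "{..N}"]) (use bnd in blast, simp)
  then have "Max (ord ` A) \<in> ord ` A" using ne by (intro Max_in) auto
  then obtain m where m: "m \<in> A" "ord m = Max (ord ` A)" by auto
  have max: "ord w \<le> ord m" if "w \<in> A" for w using fin that m(2) by simp
  have "w \<in> cyc m" if w: "w \<in> A" for w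
  proof (rule ccontr)
    assume "w \<notin> cyc m"
    then have mw: "m \<in> cyc w" using chain[OF w m(1)] by (auto simp: adj_def)
    have c: "w \<in> carrier G" "ord w \<noteq> 0" using A w bnd by auto
    have "ord m = ord w" using max[OF w] cyc_ord_dvd[OF c(1) mw] c by (auto dest: dvd_imp_le)
    then have "m \<in> gens w" using gens_iff_ord[OF c mw] by simp
    then show False using \<open>w \<notin> cyc m\<close> by (simp add: gens_def)
  qed
  then have "A = cyc m" using A(2)[OF m(1)] by blast
  then show ?thesis using that m by blast
qed

lemma subgroup_chain:
  assumes cA: "cyclic_chain A"
  shows "subgroup A G"
proof (rule subgroupI)
  note A = cyclic_chainD(1,3)[OF cA] and chain = cyclic_chainD(4)[OF cA] and ne = cyclic_chainD(2)[OF cA]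
  show "A \<subseteq> carrier G" "A \<noteq> {}" by fact+
  show "inv a \<in> A" if "a \<in> A" for a
  proof -
    have "inv a = a [^] (-1::int)" using that A(1) by (auto simp: int_pow_neg)
    then show ?thesis using A(2)[OF that] cyc_I by metis
  qed
  have mult: "a \<otimes> b \<in> cyc b" if b: "b \<in> carrier G" "a \<in> cyc b" for a b
  proof -
    obtain k :: int where "a = b [^] k" using b by (auto simp: cyc_def)
    then have "a \<otimes> b = b [^] (k + 1)" using b int_pow_mult[of b k 1] by simp
    then show ?thesis by auto
  qed
  have mult': "a \<otimes> b \<in> cyc a" if a: "a \<in> carrier G" "b \<in> cyc a" for a b
  proof -
    obtain k :: int where "b = a [^] k" using a by (auto simp: cyc_def)
    then have "a \<otimes> b = a [^] (1 + k)" using a int_pow_mult[of a 1 k] by simp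
    then show ?thesis by auto
  qed
  show "a \<otimes> b \<in> A" if "a \<in> A" "b \<in> A" for a b
    using chain[OF that] mult[of b a] mult'[of a b] A that by (auto simp: adj_def)
qed

text \<open>The orders in an infinite chain are unbounded, so there is a sequence of generators \<open>g\<^sub>n\<close> of order
  \<open>p\<^sup>n\<close>, each the \<open>p\<close>-th power of the next. The isomorphism sends \<open>g\<^sub>n\<close> to \<open>cis (2 * pi / p\<^sup>n)\<close>;
  equality of powers of \<open>g\<^sub>i\<close> and \<open>g\<^sub>j\<close>, and of the corresponding roots of unity, is decided by the same
  congruence after passing to level \<open>i + j\<close>.\<close>

lemma infinite_p_chain_quasicyclic:
  assumes p: "prime p"
    and cA: "cyclic_chain A"
    and inf: "infinite A" and ords: "\<And>w. w \<in> A \<Longrightarrow> \<exists>i. ord w = p ^ i"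
  shows "quasicyclic_group (G\<lparr>carrier := A\<rparr>)"
proof -
  note A = cyclic_chainD(1,3)[OF cA] and chain = cyclic_chainD(4)[OF cA]
  have p0: "p > 0" "p > 1" using p prime_gt_0_nat prime_gt_1_nat by auto
  have ord0: "ord w \<noteq> 0" if "w \<in> A" for w using ords[OF that] p0 by auto
  have ex: "\<exists>w\<in>A. ord w = p ^ n" for n
  proof -
    have "\<not> (\<forall>w\<in>A. ord w \<le> p ^ n)"
    proof
      assume "\<forall>w\<in>A. ord w \<le> p ^ n"
      then obtain m where "m \<in> A" "A = cyc m"
        using finite_chain_cyclic[OF cA, of "p ^ n"] ord0 by blast
      moreover have "finite (cyc m)" using \<open>m \<in> A\<close> A(1) ord0 finite_cyc by blast
      ultimately show False using inf by simp
    qed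
    then obtain w where w: "w \<in> A" "ord w > p ^ n" by auto
    then obtain i where i: "ord w = p ^ i" using ords by blast
    then have "n \<le> i" using w p0 by (metis nat_le_linear not_less power_increasing_iff)
    then have "p ^ n dvd ord w" using i by (simp add: le_imp_power_dvd)
    then obtain v where "v \<in> cyc w" "ord v = p ^ n" using cyc_ex_ord[of w "p ^ n"] A(1) w ord0 by blast
    then show ?thesis using A(2) w by blast
  qed
  have "\<exists>g. \<forall>n. (g n \<in> A \<and> ord (g n) = p ^ n) \<and> g (Suc n) [^] p = g n"
  proof (rule dependent_nat_choice)
    show "\<exists>x. x \<in> A \<and> ord x = p ^ 0" using ex[of 0] by auto
    fix x n assume x: "x \<in> A \<and> ord x = p ^ n"
    obtain w where w: "w \<in> A" "ord w = p ^ Suc n" using ex by blast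
    have wc: "w \<in> carrier G" "ord w \<noteq> 0" using w(1) A(1) ord0 by blast+
    have "x \<in> carrier G" "ord x \<noteq> 0" "adj x w" using x w(1) A(1) ord0 chain by blast+
    then have "x \<in> cyc w" using adj_iff_ord_dvd[of x w] wc x w(2) by simp
    then obtain k :: nat where k: "x = w [^] k" using cyc_eq_image[OF wc] by auto
    have "ord (w [^] k) = p ^ n" using x k by simp
    then have "p ^ n * gcd k (p ^ Suc n) = p ^ n * p"
      using ord_mult_gcd[OF wc, of k] unfolding w(2) by (simp only: power_Suc mult.commute)
    then have g: "gcd k (p ^ Suc n) = p" using p0 by simp
    then obtain l where l: "k = p * l" by (metis dvdE gcd_dvd1)
    show "\<exists>y. (y \<in> A \<and> ord y = p ^ Suc n) \<and> y [^] p = x"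
    proof (cases "n = 0")
      case True
      have "x = \<one>" using x True ord_eq_1 A by auto
      moreover have "w [^] p = \<one>" using w True wc by (simp add: pow_eq_id)
      ultimately show ?thesis using w by blast
    next
      case False
      then have "p * gcd l (p ^ n) = p * 1" using g l by (simp add: gcd_mult_distrib_nat)
      then have "gcd l (p ^ n) = 1" using p0 by simp
      then have "coprime l (p ^ n)" by (rule coprime_iff_gcd_eq_1[THEN iffD2])
      then have "coprime l p" using False by (simp add: coprime_power_right_iff)
      then have "coprime l (p ^ Suc n)" by (simp add: coprime_power_right_iff del: power_Suc)
      then have "gcd l (p ^ Suc n) = 1" by (rule coprime_imp_gcd_eq_1)
      then have "ord (w [^] l) = p ^ Suc n" using ord_mult_gcd[OF wc, of l] w by simp
      moreover have "w [^] l \<in> A" using A(2)[OF w(1)] by blast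
      moreover have "(w [^] l) [^] p = x" using k l wc by (simp add: nat_pow_pow mult.commute)
      ultimately show ?thesis by blast
    qed
  qed
  then obtain g where gA: "\<And>n. g n \<in> A" and go: "\<And>n. ord (g n) = p ^ n"
    and gs: "\<And>n. g (Suc n) [^] p = g n" by blast
  have gc: "g n \<in> carrier G" for n using gA A by blast
  have gp: "g n = g (n + d) [^] (p ^ d)" for n d
  proof (induction d)
    case 0 then show ?case using gc by simp
  next
    case (Suc d)
    have "g (n + Suc d) [^] (p ^ Suc d) = (g (Suc (n + d)) [^] p) [^] (p ^ d)"
      using gc by (simp add: nat_pow_pow)
    then show ?case using Suc gs by simp
  qed
  have geq: "g n [^] a = g n [^] b \<longleftrightarrow> a mod p ^ n = b mod p ^ n" for n and a b :: nat
  proof -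
    have "g n [^] a = g n [^] b \<longleftrightarrow> int (p ^ n) dvd int a - int b"
      using int_pow_eq_iff[OF gc, of n "int a" "int b"] go by (simp add: int_pow_int)
    then show ?thesis by (metis mod_eq_dvd_iff zmod_int of_nat_eq_iff)
  qed
  have pn: "p ^ n > 0" for n using p0 by simp
  have common: "g i [^] a = g (i + j) [^] (a * p ^ j)" "root_cis (p ^ i) a = root_cis (p ^ (i + j)) (a * p ^ j)"
    for i j and a :: nat
  proof -
    show "g i [^] a = g (i + j) [^] (a * p ^ j)"
      using gp[of i j] gc[of "i + j"] by (metis nat_pow_pow mult.commute)
    show "root_cis (p ^ i) a = root_cis (p ^ (i + j)) (a * p ^ j)"
      using root_cis_scale[OF pn[of j], of "p ^ i" a] by (simp add: power_add)
  qed
  have eq: "g i [^] a = g j [^] b \<longleftrightarrow> root_cis (p ^ i) a = root_cis (p ^ j) b" for i j and a b :: nat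
    using common[of i a j] common[of j b i] geq[of "i + j" "a * p ^ j" "b * p ^ i"]
      root_cis_eq_iff[OF pn[of "i + j"], of "a * p ^ j" "b * p ^ i"] by (simp add: add.commute)
  have rep: "\<exists>i a::nat. w = g i [^] a" if w: "w \<in> A" for w
  proof -
    obtain i where i: "ord w = p ^ i" using ords w by blast
    have "w \<in> carrier G" "adj w (g i)" using w A(1) chain gA by blast+
    then have "w \<in> cyc (g i)" using adj_iff_ord_dvd[of w "g i"] gc go i p0 by simp
    then show ?thesis using cyc_eq_image[OF gc, of i] go p0 by auto
  qed
  define h where "h w = (THE z. \<exists>i a::nat. w = g i [^] a \<and> z = root_cis (p ^ i) a)" for w
  have h: "h (g i [^] a) = root_cis (p ^ i) a" for i and a :: nat
    unfolding h_def
  proof (rule the_equality)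
    show "\<exists>j b::nat. g i [^] a = g j [^] b \<and> root_cis (p ^ i) a = root_cis (p ^ j) b"
      by (intro exI conjI) (rule refl)+
  next
    fix z assume "\<exists>j b::nat. g i [^] a = g j [^] b \<and> z = root_cis (p ^ j) b"
    then obtain j and b :: nat where "g i [^] a = g j [^] b" "z = root_cis (p ^ j) b" by blast
    then show "z = root_cis (p ^ i) a" using eq[of i a j b] by simp
  qed
  have gpowA: "g i [^] (a::nat) \<in> A" for i a using A(2)[OF gA] by blast
  have "h \<in> iso (G\<lparr>carrier := A\<rparr>) (prufer_group p)"
  proof (rule isoI)
    show "h \<in> hom (G\<lparr>carrier := A\<rparr>) (prufer_group p)"
    proof (rule homI)
      fix x assume "x \<in> carrier (G\<lparr>carrier := A\<rparr>)"
      then obtain i and a :: nat where "x = g i [^] a" using rep[of x] by auto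
      then show "h x \<in> carrier (prufer_group p)"
        using root_cis_power[OF pn[of i], of a] h by (auto simp: prufer_group_def)
    next
      fix x y assume "x \<in> carrier (G\<lparr>carrier := A\<rparr>)" "y \<in> carrier (G\<lparr>carrier := A\<rparr>)"
      then have "x \<in> A" "y \<in> A" by simp_all
      then obtain i j and a b :: nat where xy: "x = g i [^] a" "y = g j [^] b"
        using rep[of x] rep[of y] by blast
      let ?a = "a * p ^ j" and ?b = "b * p ^ i"
      have x: "x = g (i + j) [^] ?a" using xy common(1)[of i a j] by simp
      have y: "y = g (i + j) [^] ?b" using xy common(1)[of j b i] by (simp add: add.commute)
      have "x \<otimes> y = g (i + j) [^] (?a + ?b)" unfolding x y by (rule nat_pow_mult[OF gc])
      then have "h (x \<otimes> y) = h x * h y" by (simp only: x y h root_cis_mult)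
      then show "h (x \<otimes>\<^bsub>G\<lparr>carrier := A\<rparr>\<^esub> y) = h x \<otimes>\<^bsub>prufer_group p\<^esub> h y"
        by (simp add: prufer_group_def)
    qed
    have "inj_on h A"
    proof (rule inj_onI)
      fix x y assume xy: "x \<in> A" "y \<in> A" "h x = h y"
      obtain i and a :: nat where x: "x = g i [^] a" using rep xy by blast
      obtain j and b :: nat where y: "y = g j [^] b" using rep xy by blast
      show "x = y" using xy(3) unfolding x y h by (simp add: eq)
    qed
    moreover have "h ` A = {z. \<exists>k. z ^ (p ^ k) = 1}"
    proof (intro equalityI subsetI)
      fix z assume "z \<in> h ` A"
      then obtain i and a :: nat where "z = h (g i [^] a)" using rep by blast
      then show "z \<in> {z. \<exists>k. z ^ (p ^ k) = 1}" using root_cis_power[OF pn[of i], of a] h by auto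
    next
      fix z :: complex assume "z \<in> {z. \<exists>k. z ^ (p ^ k) = 1}"
      then obtain k where "z ^ (p ^ k) = 1" by blast
      then obtain a where "z = root_cis (p ^ k) a" using root_cis_surj[OF pn] by blast
      then have "z = h (g k [^] a)" using h by simp
      then show "z \<in> h ` A" using gpowA by blast
    qed
    ultimately show "bij_betw h (carrier (G\<lparr>carrier := A\<rparr>)) (carrier (prufer_group p))"
      by (simp add: bij_betw_def prufer_group_def)
  qed
  then show ?thesis using p unfolding quasicyclic_group_def is_iso_def by blast
qed

end

section \<open>Torsion elements below no element of mixed order\<close>

text \<open>The fibres will be indexed by a twin class and an order; on these only cardinalities are known.\<close>

lemma bij_betw_fibres:
  assumes "\<And>k. \<exists>h. bij_betw h {x \<in> A. \<kappa> x = k} {y \<in> B. \<mu> y = k}"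
  shows "\<exists>h. bij_betw h A B \<and> (\<forall>x\<in>A. \<mu> (h x) = \<kappa> x)"
proof -
  obtain h where h: "\<And>k. bij_betw (h k) {x \<in> A. \<kappa> x = k} {y \<in> B. \<mu> y = k}"
    using assms by metis
  define g where "g x = h (\<kappa> x) x" for x
  have g: "g x \<in> B \<and> \<mu> (g x) = \<kappa> x" if "x \<in> A" for x
    using bij_betw_apply[OF h[of "\<kappa> x"], of x] that by (simp add: g_def)
  have "inj_on g A"
  proof (rule inj_onI)
    fix x y assume xy: "x \<in> A" "y \<in> A" "g x = g y"
    then have k: "\<kappa> x = \<kappa> y" using g by metis
    then have "h (\<kappa> x) x = h (\<kappa> x) y" using xy by (simp add: g_def)
    moreover have "inj_on (h (\<kappa> x)) {z \<in> A. \<kappa> z = \<kappa> x}" using h by (simp add: bij_betw_def)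
    ultimately show "x = y" using xy k by (auto dest: inj_onD)
  qed
  moreover have "g ` A = B"
  proof (intro equalityI subsetI)
    fix y assume y: "y \<in> B"
    then have "y \<in> h (\<mu> y) ` {x \<in> A. \<kappa> x = \<mu> y}" using h[of "\<mu> y"] by (simp add: bij_betw_def)
    then obtain x where "x \<in> A" "\<kappa> x = \<mu> y" "y = h (\<mu> y) x" by blast
    then have "y = g x" by (simp add: g_def)
    with \<open>x \<in> A\<close> show "y \<in> g ` A" by blast
  qed (use g in blast)
  ultimately show ?thesis using g unfolding bij_betw_def by blast
qed

context group
begin

text \<open>The torsion elements that are not covered by \<open>shared_ord\<close>; their orders are prime powers.\<close>

definition pure :: "'a \<Rightarrow> bool" where
  "pure x \<longleftrightarrow> x \<in> carrier G \<and> ord x \<noteq> 0 \<and> x \<noteq> \<one> \<and> (\<forall>z. mixed z \<longrightarrow> x \<notin> cyc z)"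

definition dominators :: "'a \<Rightarrow> 'a set" where
  "dominators x = {w \<in> carrier G. nsub x w}"

text \<open>For pure \<open>x\<close> these are the powers of \<open>x\<close> that come before the twin class of \<open>x\<close>.\<close>

definition core :: "'a \<Rightarrow> 'a set" where
  "core x = dominators x - twins x"

lemma pureD:
  assumes "pure x"
  shows "x \<in> carrier G" "ord x \<noteq> 0" "x \<noteq> \<one>" "mixed z \<Longrightarrow> x \<notin> cyc z" "\<not> mixed x"
  using assms cyc_refl by (auto simp: pure_def)

text \<open>Below an element of prime power order everything is comparable, and above it everything has \<open>w\<close> as
  a power.\<close>

lemma not_mixed_below_nsub:
  assumes u: "u \<in> carrier G" "ord u \<noteq> 0" "\<not> mixed u" and w: "w \<in> cyc u"
  shows "nsub u w"
  unfolding nsub_def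
proof (intro ballI impI)
  fix z assume z: "z \<in> carrier G" "adj z u"
  show "adj z w"
  proof (cases "z \<in> cyc u")
    case True
    then show ?thesis using incomparable_mixed[OF u(1,2) True w] u(3) by blast
  next
    case False
    then have "u \<in> cyc z" using z by (simp add: adj_def)
    then show ?thesis using cyc_trans[OF z(1) _ w] by (simp add: adj_def)
  qed
qed

lemma pure_up:
  assumes u: "pure u" and w: "w \<in> carrier G" "u \<in> cyc w"
  shows "pure w"
proof -
  have "adj u w" using w by (simp add: adj_def)
  moreover have "w \<noteq> \<one>" using w pureD(3)[OF u] by auto
  ultimately have "ord w \<noteq> 0" using adj_ord_zero[of u w] pureD[OF u] w by auto
  moreover have "w \<notin> cyc z" if z: "mixed z" for z
  proof
    assume "w \<in> cyc z"
    then have "u \<in> cyc z" using cyc_trans[of z w u] z w by (simp add: mixed_def)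
    then show False using pureD(4)[OF u z] by simp
  qed
  ultimately show ?thesis using w \<open>w \<noteq> \<one>\<close> by (simp add: pure_def)
qed

lemma pure_primepow:
  assumes "pure x"
  obtains p k where "prime p" "k > 0" "ord x = p ^ k"
proof -
  have "primepow (ord x)" using pureD[OF assms] ord_one_iff by (auto simp: mixed_def)
  then show ?thesis using that by (auto simp: primepow_def)
qed

lemma twins_eq: "\<lbrakk>x \<in> carrier G; x \<noteq> \<one>; y \<in> twins x\<rbrakk> \<Longrightarrow> twins y = twins x"
  unfolding twins_def using nsub_trans by blast

text \<open>Whether an element of mixed order is adjacent to \<open>u\<close> is visible in the closed neighbourhood, and
  adjacency to \<open>u\<close> can only mean having \<open>u\<close> as a power.\<close>

lemma pure_twin:
  assumes u: "pure u" and w: "w \<in> twins u"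
  shows "pure w"
proof -
  have wc: "w \<in> carrier G" "w \<noteq> \<one>" "nsub u w" "nsub w u" using w by (auto simp: twins_def)
  note U = pureD[OF u]
  have "adj u w" using nsub_adj[OF wc(3) U(1)] .
  then have "ord w \<noteq> 0" using adj_ord_zero[of u w] U wc by auto
  moreover have "w \<notin> cyc z" if z: "mixed z" for z
  proof
    assume "w \<in> cyc z"
    moreover have zc: "z \<in> carrier G" using z by (simp add: mixed_def)
    ultimately have "adj z u" using wc(4) by (simp add: nsub_def adj_def)
    then have "z \<in> cyc u" using U(4)[OF z] by (simp add: adj_def)
    then show False using mixed_upward[OF z U(1,2)] U(5) by simp
  qed
  ultimately show ?thesis using wc by (simp add: pure_def)
qed

text \<open>Elements above a pure element are pure themselves, so their closed neighbourhoods are included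
  in that of \<open>u\<close>.\<close>

lemma dom_cases:
  assumes u: "pure u" and w: "w \<in> dominators u" "w \<notin> cyc u"
  shows "u \<in> cyc w" "pure w" "w \<in> twins u"
proof -
  note U = pureD[OF u]
  have wc: "w \<in> carrier G" "nsub u w" using w by (auto simp: dominators_def)
  then show uw: "u \<in> cyc w" using nsub_adj[OF wc(2) U(1)] w by (simp add: adj_def)
  then show pw: "pure w" using pure_up[OF u wc(1)] by simp
  have "nsub w u" by (rule not_mixed_below_nsub[OF pureD(1,2,5)[OF pw] uw])
  then show "w \<in> twins u" using wc pureD(3)[OF pw] by (simp add: twins_def)
qed

lemma below_dom: "\<lbrakk>pure u; w \<in> cyc u\<rbrakk> \<Longrightarrow> w \<in> dominators u"
  using not_mixed_below_nsub[of u w] pureD[of u] cyc_carrier[of u w] by (simp add: dominators_def)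

lemma dom_closed:
  assumes u: "pure u" and w: "w \<in> dominators u" and v: "v \<in> cyc w"
  shows "v \<in> dominators u"
proof (cases "w \<in> cyc u")
  case True
  then show ?thesis using below_dom[OF u] cyc_trans[OF pureD(1)[OF u] True v] by simp
next
  case False
  have "v \<in> dominators w" using below_dom[OF dom_cases(2)[OF u w False] v] .
  then show ?thesis using w nsub_trans by (auto simp: dominators_def)
qed

lemma dom_chain:
  assumes u: "pure u"
  shows "cyclic_chain (dominators u)"
  unfolding cyclic_chain_def
proof (intro conjI ballI)
  show "dominators u \<subseteq> carrier G" by (auto simp: dominators_def)
  show "dominators u \<noteq> {}" using below_dom[OF u, of \<one>] by auto
  show "cyc w \<subseteq> dominators u" if "w \<in> dominators u" for w using dom_closed[OF u that] by blast
  show "adj v w" if "v \<in> dominators u" "w \<in> dominators u" for v w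
  proof -
    have *: "v \<in> carrier G" "w \<in> carrier G" "nsub u v" "nsub u w" using that by (auto simp: dominators_def)
    have "adj w u" using nsub_adj[OF *(4) pureD(1)[OF u]] adj_sym by blast
    then show ?thesis using * adj_sym by (auto simp: nsub_def)
  qed
qed

lemma dom_ord:
  assumes u: "pure u" "prime p" "ord u = p ^ k" "k > 0" and w: "w \<in> dominators u"
  shows "\<exists>i. ord w = p ^ i"
proof (cases "w \<in> cyc u")
  case True
  then have "ord w dvd p ^ k" using cyc_ord_dvd[OF pureD(1)[OF u(1)] True] u(3) by simp
  then show ?thesis using divides_primepow_nat[OF u(2)] by blast
next
  case False
  note W = dom_cases[OF u(1) w False]
  obtain q j where q: "prime q" "j > 0" "ord w = q ^ j" using pure_primepow[OF W(2)] by blast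
  have "p dvd q ^ j"
    using cyc_ord_dvd[OF pureD(1)[OF W(2)] W(1)] u q dvd_trans[OF dvd_power[of k p]] by simp
  then have "p = q" using u(2) q(1) by (metis prime_dvd_power primes_dvd_imp_eq)
  then show ?thesis using q by blast
qed

lemma core_below:
  assumes "pure u" "w \<in> core u"
  shows "w \<in> cyc u"
  using dom_cases(3)[OF assms(1), of w] assms(2) by (auto simp: core_def)

lemma one_core: "pure u \<Longrightarrow> \<one> \<in> core u"
  by (auto simp: core_def dominators_def twins_def)

lemma twin_above_twin:
  assumes u: "pure u" and v: "v \<in> twins u" and w: "w \<in> dominators u" "v \<in> cyc w"
  shows "w \<in> twins u"
proof (cases "w \<in> cyc u")
  case True
  have wc: "w \<in> carrier G" "nsub u w" using w by (auto simp: dominators_def)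
  have "pure w" using pure_up[OF pure_twin[OF u v] wc(1) w(2)] .
  note W = pureD[OF this]
  have "nsub w v" by (rule not_mixed_below_nsub[OF W(1,2,5) w(2)])
  then have "nsub w u" using v nsub_trans by (auto simp: twins_def)
  then show ?thesis using wc W by (simp add: twins_def)
qed (use dom_cases(3)[OF u w(1)] in simp)

lemma core_chain:
  assumes u: "pure u"
  shows "cyclic_chain (core u)"
  unfolding cyclic_chain_def
proof (intro conjI ballI)
  show "core u \<subseteq> carrier G" by (auto simp: core_def dominators_def)
  show "core u \<noteq> {}" using one_core[OF u] by auto
  show "cyc w \<subseteq> core u" if "w \<in> core u" for w
  proof
    fix v assume v: "v \<in> cyc w"
    have w: "w \<in> dominators u" "w \<notin> twins u" using that by (auto simp: core_def)
    show "v \<in> core u"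
      using dom_closed[OF u w(1) v] twin_above_twin[OF u _ w(1) v] w(2) by (auto simp: core_def)
  qed
  show "adj v w" if "v \<in> core u" "w \<in> core u" for v w
    using cyclic_chainD(4)[OF dom_chain[OF u]] that by (simp add: core_def)
qed

lemma finite_core: "pure u \<Longrightarrow> finite (core u)"
  using finite_cyc[of u] pureD[of u] core_below[of u] by (meson finite_subset subsetI)

lemma dom_split: "pure u \<Longrightarrow> dominators u = core u \<union> twins u"
  by (auto simp: core_def twins_def dominators_def)

lemma dom_ord_nonzero:
  assumes u: "pure u" and w: "w \<in> dominators u"
  shows "ord w \<noteq> 0"
proof -
  obtain p k where p: "prime p" "k > 0" "ord u = p ^ k" using pure_primepow[OF u] by blast
  obtain i where "ord w = p ^ i" using dom_ord[OF u p(1,3,2) w] by blast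
  then show ?thesis using p(1) by (simp add: prime_gt_0_nat)
qed

lemma finite_chain_card:
  assumes A: "cyclic_chain A" "A \<subseteq> dominators u" "finite A" and u: "pure u"
  obtains m where "m \<in> A" "A = cyc m" "card A = ord m"
proof -
  define N where "N = Max (ord ` A)"
  have "ord w \<noteq> 0 \<and> ord w \<le> N" if "w \<in> A" for w
    using that A dom_ord_nonzero[OF u] by (auto simp: N_def)
  then obtain m where m: "m \<in> A" "A = cyc m" using finite_chain_cyclic[OF A(1), of N] by blast
  then have "card A = ord m"
    using card_cyc[of m] A(2) dom_ord_nonzero[OF u] by (auto simp: dominators_def)
  then show ?thesis using that m by blast
qed

lemma card_core:
  assumes u: "pure u" "prime p" "ord u = p ^ k" "k > 0"
  shows "\<exists>i. card (core u) = p ^ i"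
proof -
  have s: "core u \<subseteq> dominators u" by (auto simp: core_def)
  obtain m where "m \<in> core u" "card (core u) = ord m"
    using finite_chain_card[OF core_chain[OF u(1)] s finite_core[OF u(1)] u(1)] by blast
  then show ?thesis using dom_ord[OF u, of m] s by auto
qed

lemma card_dom:
  assumes u: "pure u" "prime p" "ord u = p ^ k" "k > 0" and fin: "finite (dominators u)"
  shows "\<exists>i>0. card (dominators u) = p ^ i"
proof -
  obtain m where m: "m \<in> dominators u" "dominators u = cyc m" "card (dominators u) = ord m"
    using finite_chain_card[OF dom_chain[OF u(1)] subset_refl fin u(1)] by blast
  obtain i where i: "ord m = p ^ i" using dom_ord[OF u m(1)] by blast
  have "m \<noteq> \<one>" using m(2) below_dom[OF u(1) cyc_refl] pureD[OF u(1)] by auto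
  then have "i > 0" using i m(1) ord_one_iff[of m] by (cases i) (auto simp: dominators_def)
  then show ?thesis using i m by auto
qed

text \<open>A twin of order \<open>n\<close> properly contains the core and is contained in the chain of dominators, which
  gives the two bounds. Conversely, the chain has an element of order at least \<open>n\<close>, since otherwise it
  would be cyclic of order less than \<open>n\<close>; its subgroup of order \<open>n\<close> is too large for the core.\<close>

lemma twin_orders:
  assumes u: "pure u" "prime p" "ord u = p ^ k" "k > 0"
  shows "(\<exists>w\<in>twins u. ord w = n) \<longleftrightarrow>
    (\<exists>i. n = p ^ i) \<and> card (core u) < n \<and> (finite (dominators u) \<longrightarrow> n \<le> card (dominators u))"
proof
  assume "\<exists>w\<in>twins u. ord w = n"
  then obtain w where w: "w \<in> twins u" "ord w = n" by blast
  have wd: "w \<in> dominators u" using w by (auto simp: twins_def dominators_def)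
  have wc: "w \<in> carrier G" "ord w \<noteq> 0" using wd dom_ord_nonzero[OF u(1)] by (auto simp: dominators_def)
  have "core u \<subseteq> cyc w"
  proof
    fix v assume v: "v \<in> core u"
    then have "adj v w" using cyclic_chainD(4)[OF dom_chain[OF u(1)] _ wd] by (simp add: core_def)
    moreover have "w \<notin> cyc v"
      using cyclic_chainD(3)[OF core_chain[OF u(1)] v] w(1) by (auto simp: core_def)
    ultimately show "v \<in> cyc w" by (simp add: adj_def)
  qed
  then have "core u \<subset> cyc w" using w wc by (auto simp: core_def)
  then have "card (core u) < n" using psubset_card_mono[OF finite_cyc[OF wc]] card_cyc[OF wc] w by simp
  moreover have "n \<le> card (dominators u)" if "finite (dominators u)"
    using card_mono[OF that, of "cyc w"] dom_closed[OF u(1) wd] card_cyc[OF wc] w by auto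
  ultimately show "(\<exists>i. n = p ^ i) \<and> card (core u) < n \<and> (finite (dominators u) \<longrightarrow> n \<le> card (dominators u))"
    using dom_ord[OF u wd] w by auto
next
  assume n: "(\<exists>i. n = p ^ i) \<and> card (core u) < n \<and> (finite (dominators u) \<longrightarrow> n \<le> card (dominators u))"
  then obtain i where i: "n = p ^ i" by blast
  have "\<exists>w\<in>dominators u. n \<le> ord w"
  proof (rule ccontr)
    assume "\<not> ?thesis"
    then have small: "ord w < n" if "w \<in> dominators u" for w using that by auto
    then have "ord w \<noteq> 0 \<and> ord w \<le> n" if "w \<in> dominators u" for w
      using that dom_ord_nonzero[OF u(1) that] by (simp add: less_imp_le)
    then obtain m where m: "m \<in> dominators u" "dominators u = cyc m"
      using finite_chain_cyclic[OF dom_chain[OF u(1)], of n] by blast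
    have "m \<in> carrier G" "ord m \<noteq> 0" using m(1) dom_ord_nonzero[OF u(1)] by (auto simp: dominators_def)
    then have "finite (dominators u)" "card (dominators u) = ord m" using m finite_cyc[of m] card_cyc[of m] by auto
    then show False using n small[OF m(1)] by simp
  qed
  then obtain w where w: "w \<in> dominators u" "n \<le> ord w" by blast
  have wc: "w \<in> carrier G" "ord w \<noteq> 0" using w(1) dom_ord_nonzero[OF u(1)] by (auto simp: dominators_def)
  obtain j where j: "ord w = p ^ j" using dom_ord[OF u w(1)] by blast
  have "p > 1" using u(2) prime_gt_1_nat by blast
  then have "i \<le> j" using w(2) i j by (simp add: power_increasing_iff)
  then have "n dvd ord w" using i j by (simp add: le_imp_power_dvd)
  then obtain v where v: "v \<in> cyc w" "ord v = n" using cyc_ex_ord[OF wc] by blast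
  have vd: "v \<in> dominators u" using dom_closed[OF u(1) w(1) v(1)] .
  have "v \<notin> core u"
  proof
    assume vcore: "v \<in> core u"
    have "v \<in> carrier G" "ord v \<noteq> 0" using vd dom_ord_nonzero[OF u(1)] by (auto simp: dominators_def)
    then have "n \<le> card (core u)"
      using card_mono[OF finite_core[OF u(1)], of "cyc v"] cyclic_chainD(3)[OF core_chain[OF u(1)] vcore]
        card_cyc[of v] v(2) by auto
    then show False using n by simp
  qed
  then show "\<exists>w\<in>twins u. ord w = n" using vd v(2) dom_split[OF u(1)] by blast
qed

text \<open>Let \<open>k\<close> generate a cyclic group that contains a nontrivial element of the chain. With a trivial core
  this element is a twin of every nontrivial element of the chain, so \<open>k\<close> is comparable with all of them.
  As \<open>k\<close> has finite order and the chain is infinite, \<open>k\<close> is a power of one of them, and hence in the chain.\<close>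

lemma trivial_core_intersection_free:
  assumes u: "pure u" and inf: "infinite (dominators u)" and c1: "core u = {\<one>}"
  shows "intersection_free (dominators u) G"
  unfolding intersection_free_def
proof (intro conjI allI impI)
  have "dominators u \<noteq> {}" using inf by auto
  show sub: "subgroup (dominators u) G" by (rule subgroup_chain[OF dom_chain[OF u]])
  fix K assume K: "subgroup K G \<and> cyclic_group (G\<lparr>carrier := K\<rparr>) \<and> \<not> K \<subseteq> dominators u"
  interpret K: group "G\<lparr>carrier := K\<rparr>" using K subgroup_imp_group by blast
  obtain k where k: "k \<in> K" "K = range (\<lambda>n::int. k [^]\<^bsub>G\<lparr>carrier := K\<rparr>\<^esub> n)"
    using K K.cyclic_group by auto
  have Kk: "K = cyc k" 
    using k int_pow_consistent[of K k] K by (simp add: cyc_def)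
  have kc: "k \<in> carrier G" using k(1) K subgroup.subset by blast
  have nk: "k \<notin> dominators u" using dom_closed[OF u] Kk K by blast
  have "w = \<one>" if w: "w \<in> dominators u" "w \<in> K" for w
  proof (rule ccontr)
    assume w1: "w \<noteq> \<one>"
    have wt: "w \<in> twins u" using w w1 c1 dom_split[OF u] by blast
    have wk: "w \<in> cyc k" using w Kk by simp
    have "pure k" by (rule pure_up[OF pure_twin[OF u wt] kc wk])
    then have "finite (cyc k)" using finite_cyc pureD by blast
    then have "\<not> dominators u \<subseteq> cyc k" using inf finite_subset by blast
    then obtain a where a: "a \<in> dominators u" "a \<notin> cyc k" by blast
    then have "a \<noteq> \<one>" by auto
    then have at: "a \<in> twins u" using a c1 dom_split[OF u] by blast
    then have "nsub w a" using wt nsub_trans by (auto simp: twins_def)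
    moreover have "adj k w" using wk by (simp add: adj_def)
    ultimately have "adj k a" using kc by (simp add: nsub_def)
    then have "k \<in> cyc a" using a by (simp add: adj_def)
    then show False using dom_closed[OF u a(1)] nk by blast
  qed
  moreover have "\<one> \<in> dominators u" "\<one> \<in> K" using sub K subgroup.one_closed by blast+
  ultimately show "dominators u \<inter> K = {\<one>}" by blast
qed

end

context power_graph_iso
begin

lemma pure_image:
  assumes u: "G.pure u"
  shows "H.pure (f u)"
proof -
  note U = G.pureD[OF u]
  have "f u \<notin> H.cyc z" if z: "H.mixed z" for z
  proof
    assume fu: "f u \<in> H.cyc z"
    have zc: "z \<in> carrier H" using z by (simp add: H.mixed_def)
    have m: "G.mixed (finv z)" using mixed_iff[of "finv z"] zc z by simp
    have "f u \<in> f ` G.cyc (finv z)" using mixed_cyc_image[OF m] zc fu by simp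
    then obtain v where v: "v \<in> G.cyc (finv z)" "f u = f v" by blast
    have "v \<in> carrier G" using v(1) zc G.cyc_carrier[of "finv z"] by simp
    then have "u = v" using v(2) f_inj U(1) by simp
    then show False using U(4)[OF m] v by simp
  qed
  then show ?thesis using U f_ord_zero_iff f_eq_one_iff by (simp add: H.pure_def)
qed

lemma pure_iff: "x \<in> carrier G \<Longrightarrow> H.pure (f x) \<longleftrightarrow> G.pure x"
  using pure_image power_graph_iso.pure_image[OF power_graph_iso_inverse, of "f x"] by auto

lemma f_dominators: "u \<in> carrier G \<Longrightarrow> H.dominators (f u) = f ` G.dominators u"
proof (intro equalityI subsetI)
  fix y assume u: "u \<in> carrier G" and y: "y \<in> H.dominators (f u)"
  then obtain w where w: "w \<in> carrier G" "y = f w" using f_surj by (auto simp: H.dominators_def)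
  then have "w \<in> G.dominators u" using y u f_nsub by (auto simp: H.dominators_def G.dominators_def)
  then show "y \<in> f ` G.dominators u" using w by blast
qed (auto simp: H.dominators_def G.dominators_def f_nsub)

lemma f_core: "u \<in> carrier G \<Longrightarrow> H.core (f u) = f ` G.core u"
  unfolding H.core_def G.core_def f_dominators f_twins
  by (rule inj_on_image_set_diff[symmetric, OF f_inj_on[OF subset_refl]]) (auto simp: G.dominators_def G.twins_def)

text \<open>The sizes of the core and of the set of dominators are preserved by \<open>f\<close>, and are powers of the prime
  \<open>p\<close> of \<open>u\<close> as well as of the prime \<open>q\<close> of \<open>f u\<close>. So \<open>p = q\<close> as soon as one of them is finite and not 1;
  otherwise the dominators of \<open>u\<close> form an intersection-free quasicyclic subgroup.\<close>

lemma twin_orders_eq: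
  assumes no: "\<not> (\<exists>L. subgroup L G \<and> quasicyclic_group (G\<lparr>carrier := L\<rparr>) \<and> intersection_free L G)"
    and u: "G.pure u"
  shows "(\<exists>w\<in>G.twins u. G.ord w = n) \<longleftrightarrow> (\<exists>w\<in>H.twins (f u). H.ord w = n)"
proof -
  obtain p k where p: "prime p" "k > 0" "G.ord u = p ^ k" using G.pure_primepow[OF u] by blast
  obtain q l where q: "prime q" "l > 0" "H.ord (f u) = q ^ l"
    using H.pure_primepow[OF pure_image[OF u]] by blast
  note P = u p(1,3,2) and Q = pure_image[OF u] q(1,3,2)
  have uc: "u \<in> carrier G" using G.pureD[OF u] by simp
  have inj: "inj_on f (G.dominators u)" "inj_on f (G.core u)"
    by (rule f_inj_on; auto simp: G.dominators_def G.core_def)+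
  have cc: "card (H.core (f u)) = card (G.core u)" "card (H.dominators (f u)) = card (G.dominators u)"
    "finite (H.dominators (f u)) \<longleftrightarrow> finite (G.dominators u)"
    using inj f_core[OF uc] f_dominators[OF uc] by (simp_all add: card_image finite_image_iff)
  have same: "p = q" if "p ^ i = q ^ j" "i > 0" for i j
    using that p(1) q(1) by (metis dvd_power prime_dvd_power primes_dvd_imp_eq)
  have "p = q"
  proof (cases "finite (G.dominators u)")
    case True
    obtain i where "i > 0" "card (G.dominators u) = p ^ i" using G.card_dom[OF P True] by blast
    moreover obtain j where "card (H.dominators (f u)) = q ^ j" using H.card_dom[OF Q] True cc by auto
    ultimately show ?thesis using same cc by metis
  next
    case False
    obtain i where i: "card (G.core u) = p ^ i" using G.card_core[OF P] by blast
    obtain j where j: "card (H.core (f u)) = q ^ j" using H.card_core[OF Q] by blast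
    have "i > 0"
    proof (rule ccontr)
      assume "\<not> i > 0"
      then have "card (G.core u) = 1" using i by simp
      then have c1: "G.core u = {\<one>\<^bsub>G\<^esub>}" using G.one_core[OF u] by (metis card_1_singletonE singletonD)
      have "intersection_free (G.dominators u) G" by (rule G.trivial_core_intersection_free[OF u False c1])
      moreover have "quasicyclic_group (G\<lparr>carrier := G.dominators u\<rparr>)"
        by (rule G.infinite_p_chain_quasicyclic[OF p(1) G.dom_chain[OF u] False G.dom_ord[OF P]])
      moreover have "subgroup (G.dominators u) G" by (rule G.subgroup_chain[OF G.dom_chain[OF u]])
      ultimately show False using no by blast
    qed
    then show ?thesis using same i j cc by metis
  qed
  then show ?thesis using G.twin_orders[OF P, of n] H.twin_orders[OF Q, of n] cc by simp
qed

text \<open>The pure elements with a given twin class and a given order are the generators of one cyclic group.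
  Thus the corresponding sets in both groups have the same cardinality.\<close>

lemma pure_matching:
  assumes no: "\<not> (\<exists>L. subgroup L G \<and> quasicyclic_group (G\<lparr>carrier := L\<rparr>) \<and> intersection_free L G)"
  shows "\<exists>h. bij_betw h (Collect G.pure) (Collect H.pure) \<and>
    (\<forall>x. G.pure x \<longrightarrow> h x \<in> H.twins (f x) \<and> H.ord (h x) = G.ord x)"
proof -
  let ?k = "\<lambda>x. (f ` G.twins x, G.ord x)" and ?l = "\<lambda>y. (H.twins y, H.ord y)"
  have fibG: "{x'. G.pure x' \<and> ?k x' = ?k x} = G.gens x" if x: "G.pure x" for x
  proof (intro equalityI subsetI)
    note X = G.pureD[OF x]
    fix y assume "y \<in> {x'. G.pure x' \<and> ?k x' = ?k x}"
    then have y: "G.pure y" "f ` G.twins y = f ` G.twins x" "G.ord y = G.ord x" by auto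
    note Y = G.pureD[OF y(1)]
    have "G.twins y = G.twins x"
      using y(2) f_inj_on[OF subset_refl] by (subst (asm) inj_on_image_eq_iff) (auto simp: G.twins_def)
    then have "y \<in> G.twins x" using G.gens_subset_twins[of y] G.gens_refl Y by blast
    then have "G.adj x y" using G.nsub_adj X by (auto simp: G.twins_def)
    then show "y \<in> G.gens x"
      using G.adj_iff_ord_dvd[of x y] G.adj_iff_ord_dvd[of y x] X Y y(3) G.adj_sym by (simp add: G.gens_def)
  next
    note X = G.pureD[OF x]
    fix y assume y: "y \<in> G.gens x"
    then have "y \<in> G.twins x" using G.gens_subset_twins[of x] X by blast
    then show "y \<in> {x'. G.pure x' \<and> ?k x' = ?k x}"
      using G.pure_twin[OF x] G.twins_eq[of x y] G.gens_ord[of x y] X y by simp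
  qed
  have fibH: "{y'. H.pure y' \<and> ?l y' = ?l y} = H.gens y" if y: "H.pure y" for y
  proof (intro equalityI subsetI)
    note X = H.pureD[OF y]
    fix z assume "z \<in> {y'. H.pure y' \<and> ?l y' = ?l y}"
    then have z: "H.pure z" "H.twins z = H.twins y" "H.ord z = H.ord y" by auto
    note Z = H.pureD[OF z(1)]
    have "z \<in> H.twins y" using z(2) H.gens_subset_twins[of z] H.gens_refl Z by blast
    then have "H.adj y z" using H.nsub_adj X by (auto simp: H.twins_def)
    then show "z \<in> H.gens y"
      using H.adj_iff_ord_dvd[of y z] H.adj_iff_ord_dvd[of z y] X Z z(3) H.adj_sym by (simp add: H.gens_def)
  next
    note X = H.pureD[OF y]
    fix z assume z: "z \<in> H.gens y"
    then have "z \<in> H.twins y" using H.gens_subset_twins[of y] X by blast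
    then show "z \<in> {y'. H.pure y' \<and> ?l y' = ?l y}"
      using H.pure_twin[OF y] H.twins_eq[of y z] H.gens_ord[of y z] X z by simp
  qed
  have fib: "\<exists>h. bij_betw h {x \<in> Collect G.pure. ?k x = k} {y \<in> Collect H.pure. ?l y = k}" for k
  proof (cases "\<exists>x. G.pure x \<and> ?k x = k")
    case True
    then obtain x where x: "G.pure x" "?k x = k" by blast
    note X = G.pureD[OF x(1)]
    have "x \<in> G.twins x" using G.gens_subset_twins[of x] G.gens_refl X by blast
    then obtain y where y: "y \<in> H.twins (f x)" "H.ord y = G.ord x"
      using twin_orders_eq[OF no x(1), of "G.ord x"] by blast
    have py: "H.pure y" by (rule H.pure_twin[OF pure_image[OF x(1)] y(1)])
    note Y = H.pureD[OF py]
    have ky: "?l y = k" using H.twins_eq[OF _ _ y(1)] X f_twins[of x] x(2) y(2) by (simp add: f_eq_one_iff)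
    have "card (G.gens x) = card (H.gens y)" using G.card_gens[of x] H.card_gens[of y] X Y y(2) by simp
    then have "\<exists>h. bij_betw h (G.gens x) (H.gens y)"
      using G.finite_gens[of x] H.finite_gens[of y] X Y by (intro finite_same_card_bij) auto
    then show ?thesis using fibG[OF x(1)] fibH[OF py] x(2) ky by simp
  next
    case False
    have "\<not> (H.pure y \<and> ?l y = k)" for y
    proof
      assume y: "H.pure y \<and> ?l y = k"
      then have Y: "H.pure y" and k: "?l y = k" by auto
      note YY = H.pureD[OF Y]
      obtain u where u: "u \<in> carrier G" "y = f u" using f_surj YY by blast
      have pu: "G.pure u" using pure_iff u Y by simp
      have "y \<in> H.twins y" using H.gens_subset_twins[of y] H.gens_refl YY by blast
      then obtain w where w: "w \<in> G.twins u" "G.ord w = H.ord y"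
        using twin_orders_eq[OF no pu, of "H.ord y"] u by blast
      have "G.pure w" by (rule G.pure_twin[OF pu w(1)])
      moreover have "?k w = k"
        using G.twins_eq[OF _ _ w(1)] G.pureD[OF pu] f_twins[of u] u w(2) k by simp
      ultimately show False using False by blast
    qed
    then have empty: "{x \<in> Collect G.pure. ?k x = k} = {}" "{y \<in> Collect H.pure. ?l y = k} = {}"
      using False by auto
    show ?thesis unfolding empty by (simp add: bij_betw_def)
  qed
  obtain h where h: "bij_betw h (Collect G.pure) (Collect H.pure)" "\<And>x. G.pure x \<Longrightarrow> ?l (h x) = ?k x"
    using bij_betw_fibres[of "Collect G.pure" ?k "Collect H.pure" ?l, OF fib] by auto
  have "h x \<in> H.twins (f x) \<and> H.ord (h x) = G.ord x" if x: "G.pure x" for x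
  proof -
    have "H.pure (h x)" using bij_betwE[OF h(1)] x by blast
    then have "h x \<in> H.twins (h x)" using H.gens_subset_twins[of "h x"] H.gens_refl H.pureD by blast
    then show ?thesis using h(2)[OF x] f_twins G.pureD[OF x] by simp
  qed
  then show ?thesis using h(1) by blast
qed

end

section \<open>Commensurability classes of elements of infinite order\<close>

context group
begin

definition commens :: "'a \<Rightarrow> 'a \<Rightarrow> bool" where
  "commens x y \<longleftrightarrow> (\<exists>(i::int) (j::int). i \<noteq> 0 \<and> j \<noteq> 0 \<and> x [^] i = y [^] j)"

text \<open>For \<open>x\<close> of infinite order this is the connected component of \<open>x\<close> in the power graph without the identity.\<close>

definition cclass :: "'a \<Rightarrow> 'a set" where
  "cclass x = {y \<in> carrier G. ord y = 0 \<and> commens x y}"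

lemma commens_refl: "commens x x"
  unfolding commens_def by (intro exI[of _ 1]) auto

lemma commens_sym: "commens x y \<Longrightarrow> commens y x"
  unfolding commens_def by metis

lemma commens_trans:
  assumes "x \<in> carrier G" "y \<in> carrier G" "z \<in> carrier G" "commens x y" "commens y z"
  shows "commens x z"
proof -
  obtain i j where ij: "i \<noteq> 0" "j \<noteq> 0" "x [^] (i::int) = y [^] (j::int)" using assms by (auto simp: commens_def)
  obtain k l where kl: "k \<noteq> 0" "l \<noteq> 0" "y [^] (k::int) = z [^] (l::int)" using assms by (auto simp: commens_def)
  have "x [^] (i * k) = (y [^] j) [^] k" using assms ij by (simp flip: int_pow_pow)
  also have "\<dots> = (y [^] k) [^] j" using assms by (simp add: int_pow_pow mult.commute)
  also have "\<dots> = z [^] (l * j)" using assms kl by (simp add: int_pow_pow)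
  finally show ?thesis unfolding commens_def using ij kl by (intro exI[of _ "i * k"] exI[of _ "l * j"]) auto
qed

lemma cyc_commens:
  assumes "x \<in> carrier G" "y \<in> cyc x" "y \<noteq> \<one>"
  shows "commens x y"
proof -
  obtain n :: int where n: "y = x [^] n" using assms by (auto simp: cyc_def)
  then have "n \<noteq> 0" using assms by auto
  moreover have "x [^] n = y [^] (1::int)" using n assms by simp
  ultimately show ?thesis unfolding commens_def by (intro exI[of _ n] exI[of _ 1]) simp
qed

lemma adj_commens: "\<lbrakk>x \<in> carrier G; y \<in> carrier G; x \<noteq> \<one>; y \<noteq> \<one>; adj x y\<rbrakk> \<Longrightarrow> commens x y"
  unfolding adj_def using cyc_commens commens_sym by blast

lemma inf_not_one: "\<lbrakk>x \<in> carrier G; ord x = 0\<rbrakk> \<Longrightarrow> x \<noteq> \<one>"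
  by auto

lemma cclassD: "y \<in> cclass x \<Longrightarrow> y \<in> carrier G" "y \<in> cclass x \<Longrightarrow> ord y = 0" "y \<in> cclass x \<Longrightarrow> y \<noteq> \<one>"
  by (auto simp: cclass_def)

lemma cclass_refl: "\<lbrakk>x \<in> carrier G; ord x = 0\<rbrakk> \<Longrightarrow> x \<in> cclass x"
  by (simp add: cclass_def commens_refl)

lemma cclass_eq: 
  assumes "x \<in> carrier G" "y \<in> cclass x"
  shows "cclass y = cclass x"
proof -
  have y: "y \<in> carrier G" "commens x y" "commens y x" using assms commens_sym by (auto simp: cclass_def)
  show ?thesis
    using commens_trans[OF assms(1) y(1) _ y(2)] commens_trans[OF y(1) assms(1) _ y(3)] by (auto simp: cclass_def)
qed

lemma cclass_commens: 
  assumes "u \<in> cclass x" "v \<in> cclass x" "x \<in> carrier G"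
  shows "commens u v"
  using cclass_eq[OF assms(3,1)] assms(2) by (auto simp: cclass_def)

lemma cclass_adj:
  assumes "x \<in> carrier G" "u \<in> cclass x" "v \<in> carrier G" "v \<noteq> \<one>" "adj u v"
  shows "v \<in> cclass x"
proof -
  note U = cclassD[OF assms(2)]
  have "ord v = 0" using adj_ord_zero[of u v] U assms by auto
  moreover have "commens u v" using adj_commens[of u v] U assms by simp
  ultimately have "v \<in> cclass u" using assms by (simp add: cclass_def)
  then show ?thesis using cclass_eq[OF assms(1,2)] by simp
qed

lemma cclass_int_pow:
  assumes "x \<in> carrier G" "u \<in> cclass x" "n \<noteq> 0"
  shows "u [^] (n::int) \<in> cclass x"
proof (rule cclass_adj[OF assms(1,2)])
  note U = cclassD[OF assms(2)]
  show "u [^] n \<in> carrier G" using U by simp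
  show "u [^] n \<noteq> \<one>" using inf_pow_one[of u n] U assms by simp
  show "adj u (u [^] n)" by (auto simp: adj_def)
qed

lemma inf_twins:
  assumes "x \<in> carrier G" "ord x = 0"
  shows "twins x = gens x"
proof -
  have "x \<noteq> \<one>" using assms inf_not_one by blast
  then show ?thesis using inf_twin_gens[OF assms] gens_subset_twins[OF assms(1)] by (auto simp: twins_def)
qed

lemma inf_gens_pow:
  assumes "x \<in> carrier G" "ord x = 0"
  shows "x [^] (a::int) \<in> gens (x [^] (b::int)) \<longleftrightarrow> \<bar>a\<bar> = \<bar>b\<bar>"
proof -
  have "x [^] a \<in> gens (x [^] b) \<longleftrightarrow> b dvd a \<and> a dvd b"
    by (simp add: gens_def inf_pow_cyc[OF assms])
  also have "\<dots> \<longleftrightarrow> \<bar>a\<bar> = \<bar>b\<bar>"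
    using zdvd_antisym_abs[of a b] by (auto simp: abs_eq_iff)
  finally show ?thesis .
qed

text \<open>If \<open>y\<close> is a power \<open>w\<^sup>j\<close> of an element outside its cyclic group, then \<open>w\<close> to the exponent \<open>|j| + 1\<close> serves.\<close>

lemma noncyclic_class_incomparable:
  assumes x: "x \<in> carrier G" and nc: "\<And>y. y \<in> cclass x \<Longrightarrow> \<not> cclass x \<subseteq> cyc y"
    and y: "y \<in> cclass x"
  obtains w where "w \<in> cclass x" "\<not> adj w y"
proof -
  obtain w where w: "w \<in> cclass x" "w \<notin> cyc y" using nc[OF y] by blast
  note W = cclassD[OF w(1)]
  show ?thesis
  proof (cases "y \<in> cyc w")
    case False
    then show ?thesis using that w by (auto simp: adj_def)
  next
    case True
    then obtain j :: int where j: "y = w [^] j" by (auto simp: cyc_def)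
    have "\<not> j dvd 1"
    proof
      assume "j dvd 1"
      then have "w [^] (1::int) \<in> cyc (w [^] j)" using inf_pow_cyc[OF W(1,2)] by simp
      then show False using w(2) j W by simp
    qed
    have j0: "j \<noteq> 0" using j cclassD(3)[OF y] by auto
    have "\<not> j dvd \<bar>j\<bar> + 1" using \<open>\<not> j dvd 1\<close> by (simp add: dvd_add_right_iff)
    moreover have "\<not> \<bar>j\<bar> + 1 dvd j" using dvd_imp_le_int[OF j0, of "\<bar>j\<bar> + 1"] by auto
    ultimately have "\<not> adj (w [^] (\<bar>j\<bar> + 1)) y" using inf_adj_pow[OF W(1,2)] j by simp
    moreover have "w [^] (\<bar>j\<bar> + 1) \<in> cclass x" using cclass_int_pow[OF x w(1), of "\<bar>j\<bar> + 1"] by simp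
    ultimately show ?thesis using that by blast
  qed
qed

end

context power_graph_iso
begin

lemma f_inf: "\<lbrakk>x \<in> carrier G; G.ord x = 0\<rbrakk> \<Longrightarrow> f x \<in> carrier H \<and> H.ord (f x) = 0 \<and> f x \<noteq> \<one>\<^bsub>H\<^esub>"
  using f_ord_zero H.inf_not_one by auto

lemma f_gens_inf:
  assumes "x \<in> carrier G" "G.ord x = 0" "y \<in> carrier G"
  shows "f y \<in> H.gens (f x) \<longleftrightarrow> y \<in> G.gens x"
proof -
  have "f y \<in> f ` G.twins x \<longleftrightarrow> y \<in> G.twins x"
    by (rule inj_on_image_mem_iff[OF f_inj_on[OF subset_refl] assms(3)]) (auto simp: G.twins_def)
  then show ?thesis
    using G.inf_twins[OF assms(1,2)] H.inf_twins[of "f x"] f_inf[OF assms(1,2)] f_twins[OF assms(1)] by simp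
qed

lemma f_commens:
  assumes x: "x \<in> carrier G" "G.ord x = 0" and y: "y \<in> carrier G" "G.ord y = 0" and c: "G.commens x y"
  shows "H.commens (f x) (f y)"
proof -
  obtain i j where ij: "i \<noteq> 0" "j \<noteq> 0" "x [^]\<^bsub>G\<^esub> (i::int) = y [^]\<^bsub>G\<^esub> (j::int)"
    using c by (auto simp: G.commens_def)
  define w where "w = x [^]\<^bsub>G\<^esub> i"
  have w: "w \<in> carrier G" "G.ord w = 0" unfolding w_def using x ij(1) G.ord_int_pow_inf[OF x] by simp_all
  have "w \<in> G.cyc x" by (simp add: w_def G.cyc_I)
  moreover have "w \<in> G.cyc y" by (simp add: w_def ij(3) G.cyc_I)
  ultimately have a: "G.adj x w" "G.adj w y" by (auto simp: G.adj_def)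
  note F = f_inf[OF x] f_inf[OF y] f_inf[OF w]
  have "H.commens (f x) (f w)" "H.commens (f w) (f y)"
    using H.adj_commens[of "f x" "f w"] H.adj_commens[of "f w" "f y"] F a f_adj x y w by auto
  then show ?thesis using H.commens_trans[of "f x" "f w" "f y"] F by blast
qed

lemma f_cclass_subset:
  assumes "x \<in> carrier G" "G.ord x = 0"
  shows "f ` G.cclass x \<subseteq> H.cclass (f x)"
proof
  fix z assume "z \<in> f ` G.cclass x"
  then obtain y where y: "y \<in> carrier G" "G.ord y = 0" "G.commens x y" "z = f y"
    unfolding G.cclass_def by blast
  then show "z \<in> H.cclass (f x)"
    using f_commens[OF assms y(1-3)] f_inf[OF y(1,2)] by (simp add: H.cclass_def)
qed

lemma f_cclass:
  assumes "x \<in> carrier G" "G.ord x = 0"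
  shows "H.cclass (f x) = f ` G.cclass x"
proof
  have "finv ` H.cclass (f x) \<subseteq> G.cclass x"
    using power_graph_iso.f_cclass_subset[OF power_graph_iso_inverse, of "f x"] f_inf[OF assms] assms by simp
  then show "H.cclass (f x) \<subseteq> f ` G.cclass x"
    using H.cclassD(1) by (metis f_finv image_eqI image_subset_iff subsetI)
qed (rule f_cclass_subset[OF assms])

definition forward :: "'a \<Rightarrow> bool" where
  "forward x \<longleftrightarrow> (\<forall>y\<in>G.cyc x. y \<noteq> \<one>\<^bsub>G\<^esub> \<longrightarrow> f y \<in> H.cyc (f x))"

definition reversing :: "'a \<Rightarrow> bool" where
  "reversing x \<longleftrightarrow> (\<forall>y\<in>G.cyc x. y \<noteq> \<one>\<^bsub>G\<^esub> \<longrightarrow> f x \<in> H.cyc (f y))"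

text \<open>Arcs from \<open>x\<close> to incomparable powers agree in direction, and for any two exponents there is a
  third one that is incomparable with both.\<close>

lemma forward_or_reversing:
  assumes x: "x \<in> carrier G" "G.ord x = 0"
  shows "reversing x \<longleftrightarrow> \<not> forward x"
proof -
  define P where "P a \<longleftrightarrow> f (x [^]\<^bsub>G\<^esub> (a::int)) \<in> H.cyc (f x)" for a
  define Q where "Q a \<longleftrightarrow> f x \<in> H.cyc (f (x [^]\<^bsub>G\<^esub> (a::int)))" for a
  have PQ: "P a \<or> Q a" for a
  proof -
    have "G.adj (x [^]\<^bsub>G\<^esub> a) x" by (auto simp: G.adj_def)
    then show ?thesis using f_adj[of "x [^]\<^bsub>G\<^esub> a" x] x by (auto simp: P_def Q_def H.adj_def)
  qed
  have unit: "P a \<and> Q a" if "\<bar>a\<bar> = 1" for a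
    using f_gens_inf[OF x, of "x [^]\<^bsub>G\<^esub> a"] G.inf_gens_pow[OF x, of a 1] that x
    by (simp add: P_def Q_def H.gens_def)
  have excl: "\<not> (P a \<and> Q a)" if "\<bar>a\<bar> > 1" for a
    using f_gens_inf[OF x, of "x [^]\<^bsub>G\<^esub> a"] G.inf_gens_pow[OF x, of a 1] that x
    by (auto simp: P_def Q_def H.gens_def)
  have step: "P b" if "P a" "\<not> a dvd b" "\<not> b dvd a" for a b
  proof (rule ccontr)
    assume "\<not> P b"
    then have "f x \<in> H.cyc (f (x [^]\<^bsub>G\<^esub> b))" using PQ by (auto simp: Q_def)
    then have "f (x [^]\<^bsub>G\<^esub> a) \<in> H.cyc (f (x [^]\<^bsub>G\<^esub> b))"
      using H.cyc_trans[of "f (x [^]\<^bsub>G\<^esub> b)" "f x" "f (x [^]\<^bsub>G\<^esub> a)"] that x by (simp add: P_def)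
    then have "G.adj (x [^]\<^bsub>G\<^esub> a) (x [^]\<^bsub>G\<^esub> b)"
      using f_adj[of "x [^]\<^bsub>G\<^esub> a" "x [^]\<^bsub>G\<^esub> b"] x by (simp add: H.adj_def)
    then show False using G.inf_adj_pow[OF x] that by simp
  qed
  have all: "P b" if ab: "P a" "\<bar>a\<bar> > 1" "\<bar>b\<bar> > 1" for a b
  proof -
    (* this exponent is coprime to both a and b, and larger *)
    define r where "r = \<bar>a * b\<bar> + 1"
    have nd: "\<not> c dvd r \<and> \<not> r dvd c" if c: "c dvd a * b" "\<bar>c\<bar> > 1" for c
    proof
      have "a * b \<noteq> 0" using ab by auto
      then have "\<bar>c\<bar> \<le> \<bar>a * b\<bar>" using c(1) by (rule dvd_imp_le_int)
      moreover have "c \<noteq> 0" using c(2) by auto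
      ultimately show "\<not> r dvd c" using dvd_imp_le_int[of c r] by (auto simp: r_def)
      show "\<not> c dvd r" using c by (auto simp: r_def dvd_add_right_iff)
    qed
    have "P r" using step[OF ab(1), of r] nd[of a] ab by simp
    then show ?thesis using step[of r b] nd[of b] ab by simp
  qed
  have fwdP: "forward x \<longleftrightarrow> (\<forall>a. \<bar>a\<bar> > 1 \<longrightarrow> P a)"
  proof
    assume *: "\<forall>a. \<bar>a\<bar> > 1 \<longrightarrow> P a"
    show "forward x" unfolding forward_def
    proof (intro ballI impI)
      fix y assume y: "y \<in> G.cyc x" "y \<noteq> \<one>\<^bsub>G\<^esub>"
      then obtain a :: int where a: "y = x [^]\<^bsub>G\<^esub> a" by (auto simp: G.cyc_def)
      then have "a \<noteq> 0" using y by auto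
      then have "P a" using * unit by (cases "\<bar>a\<bar> = 1") auto
      then show "f y \<in> H.cyc (f x)" by (simp add: P_def a)
    qed
  next
    assume *: "forward x"
    have "P a" if "\<bar>a\<bar> > 1" for a
    proof -
      have "x [^]\<^bsub>G\<^esub> a \<noteq> \<one>\<^bsub>G\<^esub>" using G.inf_pow_one[OF x, of a] that by auto
      then show ?thesis using * G.cyc_I[of x a] by (simp add: forward_def P_def)
    qed
    then show "\<forall>a. \<bar>a\<bar> > 1 \<longrightarrow> P a" by blast
  qed
  have revQ: "reversing x \<longleftrightarrow> (\<forall>a. \<bar>a\<bar> > 1 \<longrightarrow> Q a)"
  proof
    assume *: "\<forall>a. \<bar>a\<bar> > 1 \<longrightarrow> Q a"
    show "reversing x" unfolding reversing_def
    proof (intro ballI impI)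
      fix y assume y: "y \<in> G.cyc x" "y \<noteq> \<one>\<^bsub>G\<^esub>"
      then obtain a :: int where a: "y = x [^]\<^bsub>G\<^esub> a" by (auto simp: G.cyc_def)
      then have "a \<noteq> 0" using y by auto
      then have "Q a" using * unit by (cases "\<bar>a\<bar> = 1") auto
      then show "f x \<in> H.cyc (f y)" by (simp add: Q_def a)
    qed
  next
    assume *: "reversing x"
    have "Q a" if "\<bar>a\<bar> > 1" for a
    proof -
      have "x [^]\<^bsub>G\<^esub> a \<noteq> \<one>\<^bsub>G\<^esub>" using G.inf_pow_one[OF x, of a] that by auto
      then show ?thesis using * G.cyc_I[of x a] by (simp add: reversing_def Q_def)
    qed
    then show "\<forall>a. \<bar>a\<bar> > 1 \<longrightarrow> Q a" by blast
  qed
  show ?thesis unfolding fwdP revQ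
  proof
    assume *: "\<forall>a. \<bar>a\<bar> > 1 \<longrightarrow> Q a"
    show "\<not> (\<forall>a. \<bar>a\<bar> > 1 \<longrightarrow> P a)"
    proof
      assume "\<forall>a. \<bar>a\<bar> > 1 \<longrightarrow> P a"
      then have "P 2" by simp
      then show False using * excl[of 2] by simp
    qed
  next
    assume "\<not> (\<forall>a. \<bar>a\<bar> > 1 \<longrightarrow> P a)"
    then obtain b where "\<bar>b\<bar> > 1" "\<not> P b" by blast
    then show "\<forall>a. \<bar>a\<bar> > 1 \<longrightarrow> Q a" using all PQ by blast
  qed
qed

text \<open>Both elements have arcs to a common power; if these behaved differently, then the images of \<open>x\<close> and \<open>y\<close>
  would be comparable by transitivity.\<close>

lemma forward_incomparable:
  assumes x: "x \<in> carrier G" "G.ord x = 0" and y: "y \<in> carrier G" "G.ord y = 0"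
    and c: "G.commens x y" and n: "\<not> G.adj x y"
  shows "forward x \<longleftrightarrow> forward y"
proof -
  obtain i j where ij: "i \<noteq> 0" "j \<noteq> 0" "x [^]\<^bsub>G\<^esub> (i::int) = y [^]\<^bsub>G\<^esub> (j::int)"
    using c by (auto simp: G.commens_def)
  define w where "w = x [^]\<^bsub>G\<^esub> i"
  have w: "w \<in> carrier G" "w \<noteq> \<one>\<^bsub>G\<^esub>" "w \<in> G.cyc x" "w \<in> G.cyc y"
  proof -
    show "w \<in> carrier G" "w \<in> G.cyc x" unfolding w_def using x by (simp_all add: G.cyc_I)
    show "w \<noteq> \<one>\<^bsub>G\<^esub>" unfolding w_def using ij(1) G.inf_pow_one[OF x] by simp
    show "w \<in> G.cyc y" unfolding w_def ij(3) by (rule G.cyc_I)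
  qed
  have nf: "\<not> H.adj (f x) (f y)" using n f_adj x y by simp
  have "\<not> reversing y" if "forward x"
  proof
    assume "reversing y"
    then have "f y \<in> H.cyc (f w)" using w by (simp add: reversing_def)
    moreover have "f w \<in> H.cyc (f x)" using that w by (simp add: forward_def)
    ultimately have "f y \<in> H.cyc (f x)" using H.cyc_trans[of "f x" "f w" "f y"] x by simp
    then show False using nf by (simp add: H.adj_def)
  qed
  moreover have "\<not> reversing x" if "forward y"
  proof
    assume "reversing x"
    then have "f x \<in> H.cyc (f w)" using w by (simp add: reversing_def)
    moreover have "f w \<in> H.cyc (f y)" using that w by (simp add: forward_def)
    ultimately have "f x \<in> H.cyc (f y)" using H.cyc_trans[of "f y" "f w" "f x"] y by simp
    then show False using nf by (simp add: H.adj_def)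
  qed
  ultimately show ?thesis using forward_or_reversing x y by blast
qed

text \<open>Incomparable elements agree by \<open>forward_incomparable\<close>. For a power \<open>b = a\<^sup>m\<close> choose \<open>w\<close> incomparable with
  \<open>a\<close>. If \<open>w\<close> is also incomparable with \<open>b\<close>, it links the two. Otherwise \<open>b\<close> is a power of \<open>w\<close>, and then the element
  \<open>t = a\<close> to the exponent \<open>|m| + 1\<close> is not, because \<open>b\<close> and \<open>t\<close> together generate \<open>a\<close>; so \<open>w\<close> and \<open>t\<close> link \<open>a\<close> to \<open>b\<close>.\<close>

lemma noncyclic_forward_constant:
  assumes x: "x \<in> carrier G" and nc: "\<And>y. y \<in> G.cclass x \<Longrightarrow> \<not> G.cclass x \<subseteq> G.cyc y"
    and uv: "u \<in> G.cclass x" "v \<in> G.cclass x"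
  shows "forward u \<longleftrightarrow> forward v"
proof -
  have inc: "forward a \<longleftrightarrow> forward b" if "a \<in> G.cclass x" "b \<in> G.cclass x" "\<not> G.adj a b" for a b
    using forward_incomparable[of a b] that G.cclassD[OF that(1)] G.cclassD[OF that(2)]
      G.cclass_commens[OF that(1,2) x] by blast
  have below: "forward a \<longleftrightarrow> forward b" if ab: "a \<in> G.cclass x" "b \<in> G.cclass x" "b \<in> G.cyc a" for a b
  proof -
    note A = G.cclassD[OF ab(1)] and B = G.cclassD[OF ab(2)]
    obtain w where w: "w \<in> G.cclass x" "\<not> G.adj w a"
      using G.noncyclic_class_incomparable[OF x nc ab(1)] by blast
    note W = G.cclassD[OF w(1)]
    have wa: "forward w \<longleftrightarrow> forward a" by (rule inc[OF w(1) ab(1) w(2)])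
    show ?thesis
    proof (cases "G.adj w b")
      case False
      then show ?thesis using inc[OF w(1) ab(2)] wa by simp
    next
      case True
      have "w \<notin> G.cyc b" using w(2) G.cyc_trans[OF A(1) ab(3)] by (auto simp: G.adj_def)
      then have bw: "b \<in> G.cyc w" using True by (simp add: G.adj_def)
      obtain m :: int where m: "b = a [^]\<^bsub>G\<^esub> m" using ab(3) by (auto simp: G.cyc_def)
      have m0: "m \<noteq> 0" using m B by auto
      have m1: "\<not> m dvd 1"
      proof
        assume "m dvd 1"
        then have "a [^]\<^bsub>G\<^esub> (1::int) \<in> G.cyc (a [^]\<^bsub>G\<^esub> m)" using G.inf_pow_cyc[OF A(1,2)] by simp
        then have "a \<in> G.cyc b" using m A by simp
        then show False using w(2) G.cyc_trans[OF W(1) bw] by (simp add: G.adj_def)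
      qed
      define r where "r = \<bar>m\<bar> + 1"
      define t where "t = a [^]\<^bsub>G\<^esub> r"
      have t: "t \<in> G.cclass x" "t \<in> G.cyc a"
        using G.cclass_int_pow[OF x ab(1), of r] by (auto simp: t_def r_def)
      have "\<not> m dvd r" using m1 by (simp add: r_def dvd_add_right_iff)
      moreover have "\<not> r dvd m" using dvd_imp_le_int[OF m0, of r] by (auto simp: r_def)
      ultimately have tb: "\<not> G.adj t b" using G.inf_adj_pow[OF A(1,2)] by (simp add: t_def m)
      have "w \<notin> G.cyc t" using w(2) G.cyc_trans[OF A(1) t(2)] by (auto simp: G.adj_def)
      moreover have "t \<notin> G.cyc w"
      proof
        assume "t \<in> G.cyc w"
        then obtain k :: int where k: "t = w [^]\<^bsub>G\<^esub> k" by (auto simp: G.cyc_def)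
        obtain l :: int where l: "b = w [^]\<^bsub>G\<^esub> l" using bw by (auto simp: G.cyc_def)
        have "a = a [^]\<^bsub>G\<^esub> (r + m * (- sgn m))" using A by (simp add: r_def mult_sgn_abs abs_sgn)
        also have "\<dots> = t \<otimes>\<^bsub>G\<^esub> b [^]\<^bsub>G\<^esub> (- sgn m)"
          using A by (simp only: G.int_pow_mult t_def m G.int_pow_pow)
        also have "\<dots> = w [^]\<^bsub>G\<^esub> (k + l * (- sgn m))"
          using W by (simp only: k l G.int_pow_mult G.int_pow_pow)
        finally show False using w(2) by (metis G.adj_def G.cyc_I)
      qed
      ultimately have "\<not> G.adj w t" by (simp add: G.adj_def)
      then show ?thesis using inc[OF w(1) t(1)] inc[OF t(1) ab(2) tb] wa by simp
    qed
  qed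
  show ?thesis
  proof (cases "G.adj u v")
    case False
    then show ?thesis using inc[OF uv] by simp
  next
    case True
    then show ?thesis using below[OF uv] below[OF uv(2,1)] by (auto simp: G.adj_def)
  qed
qed

lemma all_forward_iff:
  assumes x: "x \<in> carrier G" and all: "\<And>y. y \<in> G.cclass x \<Longrightarrow> forward y"
    and uv: "u \<in> G.cclass x" "v \<in> G.cclass x"
  shows "u \<in> G.cyc v \<longleftrightarrow> f u \<in> H.cyc (f v)"
proof
  note U = G.cclassD[OF uv(1)] and V = G.cclassD[OF uv(2)]
  show "u \<in> G.cyc v \<Longrightarrow> f u \<in> H.cyc (f v)" using all[OF uv(2)] U by (simp add: forward_def)
  assume fu: "f u \<in> H.cyc (f v)"
  then have "G.adj u v" using f_adj[of u v] U V by (simp add: H.adj_def)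
  moreover have "u \<in> G.cyc v" if "v \<in> G.cyc u"
  proof -
    have "f v \<in> H.cyc (f u)" using all[OF uv(1)] V that by (simp add: forward_def)
    then have "f u \<in> H.gens (f v)" using fu by (simp add: H.gens_def)
    then show ?thesis using f_gens_inf[OF V(1,2) U(1)] by (simp add: G.gens_def)
  qed
  ultimately show "u \<in> G.cyc v" by (auto simp: G.adj_def)
qed

lemma all_reversing_iff:
  assumes x: "x \<in> carrier G" and all: "\<And>y. y \<in> G.cclass x \<Longrightarrow> reversing y"
    and uv: "u \<in> G.cclass x" "v \<in> G.cclass x"
  shows "u \<in> G.cyc v \<longleftrightarrow> f v \<in> H.cyc (f u)"
proof
  note U = G.cclassD[OF uv(1)] and V = G.cclassD[OF uv(2)]
  show "u \<in> G.cyc v \<Longrightarrow> f v \<in> H.cyc (f u)" using all[OF uv(2)] U by (simp add: reversing_def)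
  assume fu: "f v \<in> H.cyc (f u)"
  then have "G.adj u v" using f_adj[of u v] U V by (simp add: H.adj_def)
  moreover have "u \<in> G.cyc v" if "v \<in> G.cyc u"
  proof -
    have "f u \<in> H.cyc (f v)" using all[OF uv(1)] V that by (simp add: reversing_def)
    then have "f u \<in> H.gens (f v)" using fu by (simp add: H.gens_def)
    then show ?thesis using f_gens_inf[OF V(1,2) U(1)] by (simp add: G.gens_def)
  qed
  ultimately show "u \<in> G.cyc v" by (auto simp: G.adj_def)
qed

end

section \<open>Matching commensurability classes\<close>

lemma bij_from_relation:
  assumes tot: "\<And>a. a \<in> A \<Longrightarrow> \<exists>b\<in>B. \<rho> a b" "\<And>b. b \<in> B \<Longrightarrow> \<exists>a\<in>A. \<rho> a b"
    and fn: "\<And>a b b'. \<lbrakk>a \<in> A; b \<in> B; b' \<in> B; \<rho> a b; \<rho> a b'\<rbrakk> \<Longrightarrow> b = b'"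
    and inj: "\<And>a a' b. \<lbrakk>a \<in> A; a' \<in> A; b \<in> B; \<rho> a b; \<rho> a' b\<rbrakk> \<Longrightarrow> a = a'"
  shows "\<exists>h. bij_betw h A B \<and> (\<forall>a\<in>A. \<rho> a (h a))"
proof -
  obtain h where h: "\<And>a. a \<in> A \<Longrightarrow> h a \<in> B \<and> \<rho> a (h a)" using tot(1) by metis
  have "inj_on h A" by (rule inj_onI) (metis h inj)
  moreover have "h ` A = B"
  proof (intro equalityI subsetI)
    fix b assume b: "b \<in> B"
    then obtain a where a: "a \<in> A" "\<rho> a b" using tot(2) by blast
    then have "b = h a" using fn[of a b "h a"] h b by blast
    then show "b \<in> h ` A" using a by blast
  qed (use h in blast)
  ultimately show ?thesis using h unfolding bij_betw_def by blast
qed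

context group
begin

definition uniquely_divisible :: "'a set \<Rightarrow> bool" where
  "uniquely_divisible C \<longleftrightarrow> (\<forall>z\<in>C. \<forall>n::int. n \<noteq> 0 \<longrightarrow> (\<exists>!y. y \<in> carrier G \<and> y [^] n = z))"

lemma root_cclass:
  assumes x: "x \<in> carrier G" and y: "y \<in> carrier G" "y [^] (n::int) \<in> cclass x"
  shows "y \<in> cclass x"
proof (rule cclass_adj[OF x y(2,1)])
  note Z = cclassD[OF y(2)]
  show "y \<noteq> \<one>" using Z(3) by auto
  show "adj (y [^] n) y" by (auto simp: adj_def)
qed

text \<open>Two roots that are powers of a common element of infinite order have the same exponent.\<close>

lemma directed_unique_root:
  assumes dir: "t \<in> carrier G" "ord t = 0" "y \<in> cyc t" "z \<in> cyc t" and n: "n \<noteq> 0" "y [^] (n::int) = z [^] n"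
  shows "y = z"
proof -
  obtain a b :: int where ab: "y = t [^] a" "z = t [^] b" using dir by (auto simp: cyc_def)
  then have "t [^] (a * n) = t [^] (b * n)" using n dir(1) by (simp add: int_pow_pow)
  then have "a * n = b * n" using inf_pow_eq[OF dir(1,2)] by blast
  then show ?thesis using n ab by simp
qed

end

text \<open>With \<open>x\<close> and \<open>x'\<close> as units, \<open>y\<close> and \<open>y'\<close> are represented by the same rational number \<open>k/m\<close>. In uniquely
  divisible classes this relation is a bijection; using it avoids choosing coordinates in the rationals.\<close>

definition common_power_ratio ::
  "('a, 'm) monoid_scheme \<Rightarrow> ('b, 'n) monoid_scheme \<Rightarrow> 'a \<Rightarrow> 'b \<Rightarrow> 'a \<Rightarrow> 'b \<Rightarrow> bool" where
  "common_power_ratio G H x x' y y' \<longleftrightarrow> (\<exists>(m::int) (k::int). m \<noteq> 0 \<and> k \<noteq> 0 \<and>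
     y [^]\<^bsub>G\<^esub> m = x [^]\<^bsub>G\<^esub> k \<and> y' [^]\<^bsub>H\<^esub> m = x' [^]\<^bsub>H\<^esub> k)"

lemma common_power_ratio_swap:
  "common_power_ratio G H x x' y y' \<longleftrightarrow> common_power_ratio H G x' x y' y"
  by (auto simp: common_power_ratio_def)

lemma common_power_ratio_total:
  assumes "group G" "group H" and x: "x \<in> carrier G" "group.ord G x = 0" "x' \<in> carrier H" "group.ord H x' = 0"
    and div: "group.uniquely_divisible H (group.cclass H x')" and y: "y \<in> group.cclass G x"
  shows "\<exists>y'\<in>group.cclass H x'. common_power_ratio G H x x' y y'"
proof -
  interpret G: group G by fact
  interpret H: group H by fact
  obtain k m :: int where km: "k \<noteq> 0" "m \<noteq> 0" "x [^]\<^bsub>G\<^esub> k = y [^]\<^bsub>G\<^esub> m"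
    using y by (auto simp: G.cclass_def G.commens_def)
  have xk: "x' [^]\<^bsub>H\<^esub> k \<in> H.cclass x'"
    by (rule H.cclass_int_pow[OF x(3) H.cclass_refl[OF x(3,4)] km(1)])
  then obtain y' where y': "y' \<in> carrier H" "y' [^]\<^bsub>H\<^esub> m = x' [^]\<^bsub>H\<^esub> k"
    using div km(2) unfolding H.uniquely_divisible_def by metis
  have "y' \<in> H.cclass x'" by (rule H.root_cclass[OF x(3) y'(1), of m]) (simp add: y'(2) xk)
  then show ?thesis using km y'(2) unfolding common_power_ratio_def by (metis (no_types))
qed

lemma common_power_ratio_unique:
  assumes "group G" "group H" and x: "x \<in> carrier G" "group.ord G x = 0" "x' \<in> carrier H" "group.ord H x' = 0"
    and div: "group.uniquely_divisible H (group.cclass H x')"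
    and y: "y \<in> carrier G" "y' \<in> carrier H" "y'' \<in> carrier H"
    and r: "common_power_ratio G H x x' y y'" "common_power_ratio G H x x' y y''"
  shows "y' = y''"
proof -
  interpret G: group G by fact
  interpret H: group H by fact
  obtain m k :: int where mk: "m \<noteq> 0" "k \<noteq> 0" "y [^]\<^bsub>G\<^esub> m = x [^]\<^bsub>G\<^esub> k" "y' [^]\<^bsub>H\<^esub> m = x' [^]\<^bsub>H\<^esub> k"
    using r(1) by (auto simp: common_power_ratio_def)
  obtain n l :: int where nl: "n \<noteq> 0" "l \<noteq> 0" "y [^]\<^bsub>G\<^esub> n = x [^]\<^bsub>G\<^esub> l" "y'' [^]\<^bsub>H\<^esub> n = x' [^]\<^bsub>H\<^esub> l"
    using r(2) by (auto simp: common_power_ratio_def)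
  have "x [^]\<^bsub>G\<^esub> (k * n) = (y [^]\<^bsub>G\<^esub> m) [^]\<^bsub>G\<^esub> n" using x by (simp add: mk(3) G.int_pow_pow)
  also have "\<dots> = (y [^]\<^bsub>G\<^esub> n) [^]\<^bsub>G\<^esub> m" using y by (simp only: G.int_pow_pow mult.commute)
  also have "\<dots> = x [^]\<^bsub>G\<^esub> (l * m)" using x by (simp add: nl(3) G.int_pow_pow)
  finally have kn: "k * n = l * m" using G.inf_pow_eq[OF x(1,2)] by simp
  have 1: "y' [^]\<^bsub>H\<^esub> (m * n) = x' [^]\<^bsub>H\<^esub> (k * n)"
    using x y mk(4) by (simp flip: H.int_pow_pow)
  have "y'' [^]\<^bsub>H\<^esub> (n * m) = x' [^]\<^bsub>H\<^esub> (l * m)"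
    using x y nl(4) by (simp flip: H.int_pow_pow)
  then have 2: "y'' [^]\<^bsub>H\<^esub> (m * n) = x' [^]\<^bsub>H\<^esub> (k * n)" by (simp only: kn mult.commute)
  have "x' [^]\<^bsub>H\<^esub> (k * n) \<in> H.cclass x'"
    by (rule H.cclass_int_pow[OF x(3) H.cclass_refl[OF x(3,4)]]) (use mk nl in simp)
  then show ?thesis
    using div 1 2 y mk(1) nl(1) unfolding H.uniquely_divisible_def by (metis mult_eq_0_iff)
qed

lemma common_power_ratio_mono:
  assumes "group G" "group H" and x: "x \<in> carrier G" "group.ord G x = 0" "x' \<in> carrier H" "group.ord H x' = 0"
    and div: "group.uniquely_divisible H (group.cclass H x')"
    and u: "u \<in> group.cclass G x" "u' \<in> carrier H" "common_power_ratio G H x x' u u'"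
    and v: "v \<in> carrier G" "v' \<in> carrier H" "common_power_ratio G H x x' v v'"
    and uv: "u \<in> group.cyc G v"
  shows "u' \<in> group.cyc H v'"
proof -
  interpret G: group G by fact
  interpret H: group H by fact
  obtain c :: int where c: "u = v [^]\<^bsub>G\<^esub> c" using uv by (auto simp: G.cyc_def)
  note U = G.cclassD[OF u(1)]
  have c0: "c \<noteq> 0" using c U by auto
  obtain m k :: int where mk: "m \<noteq> 0" "k \<noteq> 0" "v [^]\<^bsub>G\<^esub> m = x [^]\<^bsub>G\<^esub> k" "v' [^]\<^bsub>H\<^esub> m = x' [^]\<^bsub>H\<^esub> k"
    using v(3) by (auto simp: common_power_ratio_def)
  have "u [^]\<^bsub>G\<^esub> m = (v [^]\<^bsub>G\<^esub> m) [^]\<^bsub>G\<^esub> c" using c v(1) by (simp only: G.int_pow_pow mult.commute)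
  then have 1: "u [^]\<^bsub>G\<^esub> m = x [^]\<^bsub>G\<^esub> (k * c)" using x by (simp add: mk(3) G.int_pow_pow)
  have "(v' [^]\<^bsub>H\<^esub> c) [^]\<^bsub>H\<^esub> m = (v' [^]\<^bsub>H\<^esub> m) [^]\<^bsub>H\<^esub> c" using v(2) by (simp only: H.int_pow_pow mult.commute)
  then have 2: "(v' [^]\<^bsub>H\<^esub> c) [^]\<^bsub>H\<^esub> m = x' [^]\<^bsub>H\<^esub> (k * c)" using x by (simp add: mk(4) H.int_pow_pow)
  have "common_power_ratio G H x x' u (v' [^]\<^bsub>H\<^esub> c)"
    unfolding common_power_ratio_def using 1 2 mk c0 by (intro exI[of _ m] exI[of _ "k * c"]) simp
  then have "u' = v' [^]\<^bsub>H\<^esub> c"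
    using common_power_ratio_unique[OF assms(1,2) x div U(1) u(2) _ u(3)] v(2) by simp
  then show ?thesis by (simp add: H.cyc_I)
qed

lemma uniquely_divisible_classes_iso:
  assumes "group G" "group H" and x: "x \<in> carrier G" "group.ord G x = 0" "x' \<in> carrier H" "group.ord H x' = 0"
    and divG: "group.uniquely_divisible G (group.cclass G x)"
    and divH: "group.uniquely_divisible H (group.cclass H x')"
  shows "\<exists>h. bij_betw h (group.cclass G x) (group.cclass H x') \<and>
    (\<forall>u\<in>group.cclass G x. \<forall>v\<in>group.cclass G x. u \<in> group.cyc G v \<longleftrightarrow> h u \<in> group.cyc H (h v))"
proof -
  interpret G: group G by fact
  interpret H: group H by fact
  let ?r = "common_power_ratio G H x x'"
  note x' = x(3,4,1,2)
  have "\<exists>h. bij_betw h (G.cclass x) (H.cclass x') \<and> (\<forall>y\<in>G.cclass x. ?r y (h y))"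
  proof (rule bij_from_relation)
    show "\<exists>y'\<in>H.cclass x'. ?r y y'" if "y \<in> G.cclass x" for y
      by (rule common_power_ratio_total[OF assms(1,2) x divH that])
    show "\<exists>y\<in>G.cclass x. ?r y y'" if "y' \<in> H.cclass x'" for y'
      using common_power_ratio_total[OF assms(2,1) x' divG that] common_power_ratio_swap[of H G] by blast
    show "b = b'" if "a \<in> G.cclass x" "b \<in> H.cclass x'" "b' \<in> H.cclass x'" "?r a b" "?r a b'" for a b b'
      by (rule common_power_ratio_unique[OF assms(1,2) x divH G.cclassD(1)[OF that(1)]
            H.cclassD(1)[OF that(2)] H.cclassD(1)[OF that(3)] that(4,5)])
    show "a = a'" if "a \<in> G.cclass x" "a' \<in> G.cclass x" "b \<in> H.cclass x'" "?r a b" "?r a' b" for a a' b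
      by (rule common_power_ratio_unique[OF assms(2,1) x' divG H.cclassD(1)[OF that(3)]
            G.cclassD(1)[OF that(1)] G.cclassD(1)[OF that(2)]
            common_power_ratio_swap[THEN iffD1, OF that(4)] common_power_ratio_swap[THEN iffD1, OF that(5)]])
  qed
  then obtain h where h: "bij_betw h (G.cclass x) (H.cclass x')" "\<And>y. y \<in> G.cclass x \<Longrightarrow> ?r y (h y)"
    by blast
  have "u \<in> G.cyc v \<longleftrightarrow> h u \<in> H.cyc (h v)" if uv: "u \<in> G.cclass x" "v \<in> G.cclass x" for u v
  proof
    have c: "h u \<in> H.cclass x'" "h v \<in> H.cclass x'" using bij_betwE[OF h(1)] uv by blast+
    note C = H.cclassD(1)[OF c(1)] H.cclassD(1)[OF c(2)] G.cclassD(1)[OF uv(1)] G.cclassD(1)[OF uv(2)]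
    show "u \<in> G.cyc v \<Longrightarrow> h u \<in> H.cyc (h v)"
      by (rule common_power_ratio_mono[OF assms(1,2) x divH uv(1) C(1) h(2)[OF uv(1)] C(4,2) h(2)[OF uv(2)]])
    show "h u \<in> H.cyc (h v) \<Longrightarrow> u \<in> G.cyc v"
      by (rule common_power_ratio_mono[OF assms(2,1) x' divG c(1) C(3)
            common_power_ratio_swap[THEN iffD1, OF h(2)[OF uv(1)]] C(2,4)
            common_power_ratio_swap[THEN iffD1, OF h(2)[OF uv(2)]]])
  qed
  then show ?thesis using h(1) by blast
qed

lemma cyclic_classes_iso:
  assumes "group G" "group H" and x: "x \<in> carrier G" "group.ord G x = 0" "x' \<in> carrier H" "group.ord H x' = 0"
    and cyG: "group.cclass G x \<subseteq> group.cyc G x" and cyH: "group.cclass H x' \<subseteq> group.cyc H x'"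
  shows "\<exists>h. bij_betw h (group.cclass G x) (group.cclass H x') \<and>
    (\<forall>u\<in>group.cclass G x. \<forall>v\<in>group.cclass G x. u \<in> group.cyc G v \<longleftrightarrow> h u \<in> group.cyc H (h v))"
proof -
  interpret G: group G by fact
  interpret H: group H by fact
  have G: "y \<in> G.cclass x \<longleftrightarrow> (\<exists>k::int. k \<noteq> 0 \<and> y = x [^]\<^bsub>G\<^esub> k)" for y
  proof
    assume y: "y \<in> G.cclass x"
    then obtain k :: int where "y = x [^]\<^bsub>G\<^esub> k" using cyG by (auto simp: G.cyc_def)
    moreover from this have "k \<noteq> 0" using G.cclassD(3)[OF y] by auto
    ultimately show "\<exists>k::int. k \<noteq> 0 \<and> y = x [^]\<^bsub>G\<^esub> k" by blast
  qed (use G.cclass_int_pow[OF x(1) G.cclass_refl[OF x(1,2)]] in blast)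
  have H: "y \<in> H.cclass x' \<longleftrightarrow> (\<exists>k::int. k \<noteq> 0 \<and> y = x' [^]\<^bsub>H\<^esub> k)" for y
  proof
    assume y: "y \<in> H.cclass x'"
    then obtain k :: int where "y = x' [^]\<^bsub>H\<^esub> k" using cyH by (auto simp: H.cyc_def)
    moreover from this have "k \<noteq> 0" using H.cclassD(3)[OF y] by auto
    ultimately show "\<exists>k::int. k \<noteq> 0 \<and> y = x' [^]\<^bsub>H\<^esub> k" by blast
  qed (use H.cclass_int_pow[OF x(3) H.cclass_refl[OF x(3,4)]] in blast)
  let ?r = "\<lambda>y y'. \<exists>k::int. y = x [^]\<^bsub>G\<^esub> k \<and> y' = x' [^]\<^bsub>H\<^esub> k"
  have "\<exists>h. bij_betw h (G.cclass x) (H.cclass x') \<and> (\<forall>y\<in>G.cclass x. ?r y (h y))"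
  proof (rule bij_from_relation)
    show "\<exists>y'\<in>H.cclass x'. ?r y y'" if "y \<in> G.cclass x" for y
      using that G H by blast
    show "\<exists>y\<in>G.cclass x. ?r y y'" if "y' \<in> H.cclass x'" for y'
      using that G H by blast
    show "b = b'" if "?r a b" "?r a b'" for a b b'
      using that G.inf_pow_eq[OF x(1,2)] by auto
    show "a = a'" if "?r a b" "?r a' b" for a a' b
      using that H.inf_pow_eq[OF x(3,4)] by auto
  qed
  then obtain h where h: "bij_betw h (G.cclass x) (H.cclass x')" "\<And>y. y \<in> G.cclass x \<Longrightarrow> ?r y (h y)"
    by blast
  have "u \<in> G.cyc v \<longleftrightarrow> h u \<in> H.cyc (h v)" if uv: "u \<in> G.cclass x" "v \<in> G.cclass x" for u v
  proof -
    obtain a :: int where a: "u = x [^]\<^bsub>G\<^esub> a" "h u = x' [^]\<^bsub>H\<^esub> a" using h(2)[OF uv(1)] by blast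
    obtain b :: int where b: "v = x [^]\<^bsub>G\<^esub> b" "h v = x' [^]\<^bsub>H\<^esub> b" using h(2)[OF uv(2)] by blast
    have "u \<in> G.cyc v \<longleftrightarrow> b dvd a" unfolding a(1) b(1) by (rule G.inf_pow_cyc[OF x(1,2)])
    moreover have "h u \<in> H.cyc (h v) \<longleftrightarrow> b dvd a" unfolding a(2) b(2) by (rule H.inf_pow_cyc[OF x(3,4)])
    ultimately show ?thesis by simp
  qed
  then show ?thesis using h(1) by blast
qed

context power_graph_iso
begin

text \<open>Reversal turns a common power of the images into an element that has \<open>u\<close> and \<open>v\<close> as powers.\<close>

lemma reversed_common_root:
  assumes x: "x \<in> carrier G" "G.ord x = 0"
    and R: "\<And>u v. \<lbrakk>u \<in> G.cclass x; v \<in> G.cclass x\<rbrakk> \<Longrightarrow> u \<in> G.cyc v \<longleftrightarrow> f v \<in> H.cyc (f u)"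
    and uv: "u \<in> G.cclass x" "v \<in> G.cclass x"
  obtains t where "t \<in> G.cclass x" "u \<in> G.cyc t" "v \<in> G.cyc t"
proof -
  have C: "H.cclass (f x) = f ` G.cclass x" by (rule f_cclass[OF x])
  have fx: "f x \<in> carrier H" using x by simp
  have fuv: "f u \<in> H.cclass (f x)" "f v \<in> H.cclass (f x)" using uv C by auto
  obtain i j :: int where ij: "i \<noteq> 0" "j \<noteq> 0" "f u [^]\<^bsub>H\<^esub> i = f v [^]\<^bsub>H\<^esub> j"
    using H.cclass_commens[OF fuv fx] by (auto simp: H.commens_def)
  have "f u [^]\<^bsub>H\<^esub> i \<in> H.cclass (f x)" by (rule H.cclass_int_pow[OF fx fuv(1) ij(1)])
  then obtain t where t: "t \<in> G.cclass x" "f u [^]\<^bsub>H\<^esub> i = f t" using C by blast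
  have "f t \<in> H.cyc (f u)" unfolding t(2)[symmetric] by (rule H.cyc_I)
  moreover have "f t \<in> H.cyc (f v)" unfolding t(2)[symmetric] ij(3) by (rule H.cyc_I)
  ultimately show ?thesis using that[OF t(1)] R uv t(1) by blast
qed

text \<open>The image of \<open>z\<close> is a power \<open>W\<^sup>k\<close> of the image \<open>W\<close> of \<open>z\<^sup>p\<close>. Nothing lies strictly between \<open>z\<^sup>p\<close> and \<open>z\<close>, so
  \<open>k\<close> is prime up to sign, and the preimage \<open>y\<close> of \<open>W\<close> to the exponent \<open>k\<^sup>2\<close> lies above \<open>z\<close> with only the level of \<open>z\<close>
  between \<open>y\<close> and \<open>z\<^sup>p\<close>. The element \<open>y\<^sup>p\<close> lies between \<open>y\<close> and \<open>z\<^sup>p\<close>, on neither of the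
  extreme levels, and so it is \<open>z\<close> or its inverse.\<close>

lemma reversed_prime_root:
  assumes x: "x \<in> carrier G" "G.ord x = 0"
    and R: "\<And>u v. \<lbrakk>u \<in> G.cclass x; v \<in> G.cclass x\<rbrakk> \<Longrightarrow> u \<in> G.cyc v \<longleftrightarrow> f v \<in> H.cyc (f u)"
    and z: "z \<in> G.cclass x" and p: "prime (p::nat)"
  obtains y where "y \<in> G.cclass x" "y [^]\<^bsub>G\<^esub> int p = z"
proof -
  have C: "H.cclass (f x) = f ` G.cclass x" by (rule f_cclass[OF x])
  have fx: "f x \<in> carrier H" using x by simp
  have gens: "f u \<in> H.gens (f v) \<longleftrightarrow> u \<in> G.gens v" if "u \<in> G.cclass x" "v \<in> G.cclass x" for u v
    using f_gens_inf[of v u] G.cclassD[OF that(1)] G.cclassD[OF that(2)] by simp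
  have p1: "p > 1" using p prime_gt_1_nat by blast
  note Z = G.cclassD[OF z]
  define s where "s = z [^]\<^bsub>G\<^esub> int p"
  have s: "s \<in> G.cclass x" "s \<in> G.cyc z" "s \<notin> G.gens z"
    using G.cclass_int_pow[OF x(1) z, of "int p"] G.inf_gens_pow[OF Z(1,2), of "int p" 1] p1 Z(1)
    by (auto simp: s_def)
  note S = G.cclassD[OF s(1)]
  define W where "W = f s"
  have W: "W \<in> H.cclass (f x)" using s C by (simp add: W_def)
  note WD = H.cclassD[OF W]
  have "f z \<in> H.cyc W" using R[OF s(1) z] s(2) by (simp add: W_def)
  then obtain k :: int where k: "f z = W [^]\<^bsub>H\<^esub> k" by (auto simp: H.cyc_def)
  have preim: "\<exists>t\<in>G.cclass x. f t = W [^]\<^bsub>H\<^esub> a" if "a \<noteq> 0" for a :: int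
    using H.cclass_int_pow[OF fx W that] C by auto
  have k0: "k \<noteq> 0" using k f_inf[OF Z(1,2)] by auto
  have W1: "W = W [^]\<^bsub>H\<^esub> (1::int)" using WD by simp
  have k1: "\<bar>k\<bar> \<noteq> 1"
  proof
    assume "\<bar>k\<bar> = 1"
    then have "W [^]\<^bsub>H\<^esub> k \<in> H.gens (W [^]\<^bsub>H\<^esub> (1::int))" using H.inf_gens_pow[OF WD(1,2)] by simp
    then have "z \<in> G.gens s" using gens[OF z s(1)] k W1 by (simp add: W_def)
    then show False using s(3) G.gens_sym[OF S(1)] by blast
  qed
  (* no element lies strictly between z^p and z, so the index of f z in its neighbour is prime *)
  have kp: "\<bar>a\<bar> = 1 \<or> \<bar>a\<bar> = \<bar>k\<bar>" if a: "a dvd k" for a :: int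
  proof -
    obtain b where b: "k = a * b" using a by blast
    have "a \<noteq> 0" using b k0 by auto
    then obtain t where t: "t \<in> G.cclass x" "f t = W [^]\<^bsub>H\<^esub> a" using preim by blast
    have "f z \<in> H.cyc (f t)" unfolding k t(2) using H.inf_pow_cyc[OF WD(1,2)] a by simp
    then have "t \<in> G.cyc z" using R[OF t(1) z] by simp
    then obtain j :: int where j: "t = z [^]\<^bsub>G\<^esub> j" by (auto simp: G.cyc_def)
    have "f t \<in> H.cyc (f s)" unfolding t(2) W_def[symmetric] by (rule H.cyc_I)
    then have "s \<in> G.cyc t" using R[OF s(1) t(1)] by simp
    then have "j dvd int p" using G.inf_pow_cyc[OF Z(1,2)] by (simp add: s_def j)
    then have "nat \<bar>j\<bar> dvd p" by (simp add: nat_abs_dvd_iff)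
    then have "nat \<bar>j\<bar> = 1 \<or> nat \<bar>j\<bar> = p" using p by (auto simp: prime_nat_iff)
    then have "\<bar>j\<bar> = \<bar>1\<bar> \<or> \<bar>j\<bar> = \<bar>int p\<bar>" by auto
    then have "t \<in> G.gens z \<or> t \<in> G.gens s"
      using G.inf_gens_pow[OF Z(1,2), of j 1] G.inf_gens_pow[OF Z(1,2), of j "int p"] Z(1)
      by (auto simp: s_def j)
    then have "W [^]\<^bsub>H\<^esub> a \<in> H.gens (W [^]\<^bsub>H\<^esub> k) \<or> W [^]\<^bsub>H\<^esub> a \<in> H.gens (W [^]\<^bsub>H\<^esub> (1::int))"
      using gens[OF t(1) z] gens[OF t(1) s(1)] t(2) k W1 by (metis W_def)
    then show ?thesis using H.inf_gens_pow[OF WD(1,2)] by auto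
  qed
  obtain y where y: "y \<in> G.cclass x" "f y = W [^]\<^bsub>H\<^esub> (k * k)" using preim[of "k * k"] k0 by auto
  note Y = G.cclassD[OF y(1)]
  have "f y \<in> H.cyc (f z)" unfolding k y(2) using H.inf_pow_cyc[OF WD(1,2)] by simp
  then have "z \<in> G.cyc y" using R[OF z y(1)] by simp
  then obtain m :: int where m: "z = y [^]\<^bsub>G\<^esub> m" by (auto simp: G.cyc_def)
  have sm: "s = y [^]\<^bsub>G\<^esub> (m * int p)" using m Y by (simp add: s_def G.int_pow_pow)
  have m0: "m \<noteq> 0" using m Z by auto
  define t where "t = y [^]\<^bsub>G\<^esub> int p"
  have t: "t \<in> G.cclass x" using G.cclass_int_pow[OF x(1) y(1), of "int p"] p1 by (simp add: t_def)
  have "s \<in> G.cyc t" unfolding sm t_def using G.inf_pow_cyc[OF Y(1,2)] by simp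
  then have "f t \<in> H.cyc W" using R[OF s(1) t] by (simp add: W_def)
  then obtain e :: int where e: "f t = W [^]\<^bsub>H\<^esub> e" by (auto simp: H.cyc_def)
  have "t \<in> G.cyc y" by (simp add: t_def G.cyc_I)
  then have "f y \<in> H.cyc (f t)" using R[OF t y(1)] by simp
  then have ek: "e dvd k * k" using H.inf_pow_cyc[OF WD(1,2)] by (simp add: y(2) e)
  have nz: "z \<notin> G.gens y"
  proof
    assume "z \<in> G.gens y"
    then have "W [^]\<^bsub>H\<^esub> k \<in> H.gens (W [^]\<^bsub>H\<^esub> (k * k))" using gens[OF z y(1)] k y(2) by simp
    then have "\<bar>k\<bar> = \<bar>k * k\<bar>" using H.inf_gens_pow[OF WD(1,2)] by simp
    then have "\<bar>k\<bar> * \<bar>k\<bar> = \<bar>k\<bar> * 1" by (simp only: abs_mult mult_1_right)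
    then have "\<bar>k\<bar> = 1" using k0 by (simp only: mult_cancel_left) simp
    then show False using k1 by blast
  qed
  have "t \<in> G.gens z"
  proof -
    have pr: "prime (nat \<bar>k\<bar>)"
      unfolding prime_nat_iff
    proof (intro conjI allI impI)
      show "1 < nat \<bar>k\<bar>" using k0 k1 by linarith
      fix a assume "a dvd nat \<bar>k\<bar>"
      then have "int a dvd k" by (simp add: dvd_nat_abs_iff)
      then show "a = 1 \<or> a = nat \<bar>k\<bar>" using kp[of "int a"] by auto
    qed
    have sq: "nat \<bar>k\<bar> ^ 2 = nat \<bar>k * k\<bar>" by (simp only: abs_mult nat_mult_distrib[OF abs_ge_zero] power2_eq_square)
    have "nat \<bar>e\<bar> dvd nat \<bar>k\<bar> ^ 2" unfolding sq using ek by (simp add: nat_abs_dvd_iff)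
    then obtain i where i: "i \<le> 2" "nat \<bar>e\<bar> = nat \<bar>k\<bar> ^ i" using divides_primepow_nat[OF pr] by blast
    then have "i = 0 \<or> i = 1 \<or> i = 2" by linarith
    moreover have "i \<noteq> 0"
    proof
      assume "i = 0"
      then have "\<bar>e\<bar> = \<bar>1\<bar>" using i by simp
      then have "f t \<in> H.gens (f s)" using H.inf_gens_pow[OF WD(1,2), of e 1] e W1 by (simp add: W_def)
      then have "t \<in> G.gens s" using gens[OF t s(1)] by simp
      then have "\<bar>int p\<bar> = \<bar>m * int p\<bar>" using G.inf_gens_pow[OF Y(1,2)] by (simp add: t_def sm)
      then have "\<bar>m\<bar> = \<bar>1\<bar>" using p1 by (simp add: abs_mult)
      then have "z \<in> G.gens y" using G.inf_gens_pow[OF Y(1,2), of m 1] Y by (simp add: m)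
      then show False using nz by simp
    qed
    moreover have "i \<noteq> 2"
    proof
      assume "i = 2"
      then have "nat \<bar>e\<bar> = nat \<bar>k * k\<bar>" using i(2) sq by (simp only:)
      then have "\<bar>e\<bar> = \<bar>k * k\<bar>" by (simp only: eq_nat_nat_iff abs_ge_zero)
      then have "f t \<in> H.gens (f y)" using H.inf_gens_pow[OF WD(1,2)] e y(2) by simp
      then have "t \<in> G.gens y" using gens[OF t y(1)] by simp
      then show False using G.inf_gens_pow[OF Y(1,2), of "int p" 1] Y p1 by (simp add: t_def)
    qed
    ultimately have "i = 1" by blast
    then have "\<bar>e\<bar> = \<bar>k\<bar>" using i by auto
    then have "f t \<in> H.gens (f z)" using H.inf_gens_pow[OF WD(1,2)] e k by simp
    then show ?thesis using gens[OF t z] by simp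
  qed
  then have "\<bar>int p\<bar> = \<bar>m\<bar>" using G.inf_gens_pow[OF Y(1,2)] by (simp add: t_def m)
  then consider "m = int p" | "m = - int p" by linarith
  then show ?thesis
  proof cases
    case 1
    then show ?thesis using that[OF y(1)] m by simp
  next
    case 2
    have "(y [^]\<^bsub>G\<^esub> (-1::int)) [^]\<^bsub>G\<^esub> int p = z" using m 2 Y by (simp only: G.int_pow_pow mult_minus1)
    moreover have "y [^]\<^bsub>G\<^esub> (-1::int) \<in> G.cclass x" by (rule G.cclass_int_pow[OF x(1) y(1)]) simp
    ultimately show ?thesis using that by blast
  qed
qed

lemma reversed_uniquely_divisible:
  assumes x: "x \<in> carrier G" "G.ord x = 0"
    and R: "\<And>u v. \<lbrakk>u \<in> G.cclass x; v \<in> G.cclass x\<rbrakk> \<Longrightarrow> u \<in> G.cyc v \<longleftrightarrow> f v \<in> H.cyc (f u)"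
  shows "G.uniquely_divisible (G.cclass x)"
proof -
  have nat_root: "\<exists>y\<in>G.cclass x. y [^]\<^bsub>G\<^esub> int n = z" if "z \<in> G.cclass x" "n > 0" for z n
    using that
  proof (induction n arbitrary: z rule: less_induct)
    case (less n)
    show ?case
    proof (cases "n = 1")
      case True
      then show ?thesis using less.prems G.cclassD(1) by (intro bexI[of _ z]) auto
    next
      case False
      then obtain p where p: "prime p" "p dvd n" using prime_factor_nat by blast
      then obtain m where m: "n = p * m" by blast
      have "0 < m" "m < n" using less.prems m prime_gt_1_nat[OF p(1)] by auto
      then obtain y where y: "y \<in> G.cclass x" "y [^]\<^bsub>G\<^esub> int m = z" using less.IH less.prems by blast
      obtain w where w: "w \<in> G.cclass x" "w [^]\<^bsub>G\<^esub> int p = y"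
        using reversed_prime_root[OF x R y(1) p(1)] by blast
      have "w [^]\<^bsub>G\<^esub> int n = (w [^]\<^bsub>G\<^esub> int p) [^]\<^bsub>G\<^esub> int m"
        using G.cclassD(1)[OF w(1)] by (simp only: G.int_pow_pow m of_nat_mult)
      then show ?thesis using w y by blast
    qed
  qed
  have root: "\<exists>y\<in>G.cclass x. y [^]\<^bsub>G\<^esub> n = z" if z: "z \<in> G.cclass x" and n: "n \<noteq> 0" for z and n :: int
  proof -
    obtain y where y: "y \<in> G.cclass x" "y [^]\<^bsub>G\<^esub> int (nat \<bar>n\<bar>) = z" using nat_root[OF z, of "nat \<bar>n\<bar>"] n by auto
    show ?thesis
    proof (cases "n > 0")
      case True
      then show ?thesis using y by auto
    next
      case False
      have "(y [^]\<^bsub>G\<^esub> (-1::int)) [^]\<^bsub>G\<^esub> n = y [^]\<^bsub>G\<^esub> int (nat \<bar>n\<bar>)"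
        using False G.cclassD(1)[OF y(1)] by (simp only: G.int_pow_pow) simp
      moreover have "y [^]\<^bsub>G\<^esub> (-1::int) \<in> G.cclass x" by (rule G.cclass_int_pow[OF x(1) y(1)]) simp
      ultimately show ?thesis using y(2) by metis
    qed
  qed
  have uniq: "y = w" if yw: "y \<in> carrier G" "w \<in> carrier G" "y [^]\<^bsub>G\<^esub> n = z" "w [^]\<^bsub>G\<^esub> n = z"
    and z: "z \<in> G.cclass x" and n: "n \<noteq> 0" for y w z and n :: int
  proof -
    have c: "y \<in> G.cclass x" "w \<in> G.cclass x"
      using G.root_cclass[OF x(1) yw(1), of n] G.root_cclass[OF x(1) yw(2), of n] yw z by auto
    obtain t where t: "t \<in> G.cclass x" "y \<in> G.cyc t" "w \<in> G.cyc t"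
      using reversed_common_root[OF x R c] by blast
    show ?thesis using G.directed_unique_root[OF G.cclassD(1,2)[OF t(1)] t(2,3) n] yw by simp
  qed
  show ?thesis unfolding G.uniquely_divisible_def
    using root uniq G.cclassD(1) by (metis (no_types, lifting))
qed

text \<open>The inverse of a reversing isomorphism is reversing as well, so in that case both classes are uniquely
  divisible.\<close>

lemma noncyclic_class_iso:
  assumes x: "x \<in> carrier G" "G.ord x = 0" and nc: "\<And>y. y \<in> G.cclass x \<Longrightarrow> \<not> G.cclass x \<subseteq> G.cyc y"
  shows "\<exists>h. bij_betw h (G.cclass x) (H.cclass (f x)) \<and>
    (\<forall>u\<in>G.cclass x. \<forall>v\<in>G.cclass x. u \<in> G.cyc v \<longleftrightarrow> h u \<in> H.cyc (h v))"
proof (cases "forward x")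
  case True
  then have all: "forward y" if "y \<in> G.cclass x" for y
    using noncyclic_forward_constant[OF x(1) nc that G.cclass_refl[OF x]] by simp
  have "bij_betw f (G.cclass x) (H.cclass (f x))"
    using f_cclass[OF x] f_inj_on[of "G.cclass x"] G.cclassD(1) by (auto simp: bij_betw_def)
  then show ?thesis using all_forward_iff[OF x(1) all] by blast
next
  case False
  have all: "reversing y" if "y \<in> G.cclass x" for y
    using noncyclic_forward_constant[OF x(1) nc that G.cclass_refl[OF x]] forward_or_reversing[of y] G.cclassD(1,2)[OF that] False
    by simp
  have R: "u \<in> G.cyc v \<longleftrightarrow> f v \<in> H.cyc (f u)" if "u \<in> G.cclass x" "v \<in> G.cclass x" for u v
    by (rule all_reversing_iff[OF x(1) all that])
  have divG: "G.uniquely_divisible (G.cclass x)" by (rule reversed_uniquely_divisible[OF x R])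
  have fx: "f x \<in> carrier H" "H.ord (f x) = 0" using f_inf[OF x] by auto
  have R': "u \<in> H.cyc v \<longleftrightarrow> finv v \<in> G.cyc (finv u)" if "u \<in> H.cclass (f x)" "v \<in> H.cclass (f x)" for u v
  proof -
    note U = that[unfolded f_cclass[OF x]]
    from U(1) obtain a where a: "u = f a" "a \<in> G.cclass x" by (rule imageE)
    from U(2) obtain b where b: "v = f b" "b \<in> G.cclass x" by (rule imageE)
    note ab = a(2) b(2) a(1) b(1)
    then show ?thesis using R[OF ab(2,1)] G.cclassD(1) by simp
  qed
  have divH: "H.uniquely_divisible (H.cclass (f x))"
    by (rule power_graph_iso.reversed_uniquely_divisible[OF power_graph_iso_inverse fx R'])
  show ?thesis
    by (rule uniquely_divisible_classes_iso[OF G.is_group H.is_group x fx divG divH])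
qed


lemma class_iso:
  assumes x: "x \<in> carrier G" "G.ord x = 0"
  shows "\<exists>h. bij_betw h (G.cclass x) (H.cclass (f x)) \<and>
    (\<forall>u\<in>G.cclass x. \<forall>v\<in>G.cclass x. u \<in> G.cyc v \<longleftrightarrow> h u \<in> H.cyc (h v))"
proof -
  have fx: "f x \<in> carrier H" "H.ord (f x) = 0" using f_inf[OF x] by auto
  consider "\<forall>y\<in>G.cclass x. \<not> G.cclass x \<subseteq> G.cyc y"
    | "\<forall>y\<in>H.cclass (f x). \<not> H.cclass (f x) \<subseteq> H.cyc y"
    | a b where "a \<in> G.cclass x" "G.cclass x \<subseteq> G.cyc a" "b \<in> H.cclass (f x)" "H.cclass (f x) \<subseteq> H.cyc b"
    by blast
  then show ?thesis
  proof cases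
    case 1
    then show ?thesis using noncyclic_class_iso[OF x] by blast
  next
    case 2
    have "\<exists>h. bij_betw h (H.cclass (f x)) (G.cclass (finv (f x))) \<and>
      (\<forall>u\<in>H.cclass (f x). \<forall>v\<in>H.cclass (f x). u \<in> H.cyc v \<longleftrightarrow> h u \<in> G.cyc (h v))"
      by (rule power_graph_iso.noncyclic_class_iso[OF power_graph_iso_inverse fx]) (use 2 in blast)
    then obtain h where h0: "bij_betw h (H.cclass (f x)) (G.cclass (finv (f x))) \<and>
      (\<forall>u\<in>H.cclass (f x). \<forall>v\<in>H.cclass (f x). u \<in> H.cyc v \<longleftrightarrow> h u \<in> G.cyc (h v))"
      by (rule exE)
    have h: "bij_betw h (H.cclass (f x)) (G.cclass x)"
      using conjunct1[OF h0] by (simp only: finv_f[OF x(1)])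
    have hcyc: "u \<in> H.cyc v \<longleftrightarrow> h u \<in> G.cyc (h v)" if "u \<in> H.cclass (f x)" "v \<in> H.cclass (f x)" for u v
      by (rule bspec[OF bspec[OF conjunct2[OF h0] that(1)] that(2)])
    let ?k = "inv_into (H.cclass (f x)) h"
    have k: "bij_betw ?k (G.cclass x) (H.cclass (f x))" by (rule bij_betw_inv_into[OF h])
    have hk: "h (?k u) = u" if "u \<in> G.cclass x" for u using bij_betw_inv_into_right[OF h that] .
    have "u \<in> G.cyc v \<longleftrightarrow> ?k u \<in> H.cyc (?k v)" if "u \<in> G.cclass x" "v \<in> G.cclass x" for u v
      using hcyc[OF bij_betw_apply[OF k that(1)] bij_betw_apply[OF k that(2)]] hk that by simp
    then show ?thesis using k by blast
  next
    case 3
    have A: "a \<in> carrier G" "G.ord a = 0" "G.cclass a = G.cclass x"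
      using G.cclassD[OF 3(1)] G.cclass_eq[OF x(1) 3(1)] by auto
    have B: "b \<in> carrier H" "H.ord b = 0" "H.cclass b = H.cclass (f x)"
      using H.cclassD[OF 3(3)] H.cclass_eq[OF fx(1) 3(3)] by auto
    show ?thesis
      using cyclic_classes_iso[OF G.is_group H.is_group A(1,2) B(1,2)] 3(2,4) unfolding A(3) B(3) by blast
  qed
qed

text \<open>Elements of different classes are never comparable, so the isomorphisms between
  corresponding classes can be glued.\<close>

lemma infinite_order_iso:
  obtains h where "bij_betw h {x \<in> carrier G. G.ord x = 0} {y \<in> carrier H. H.ord y = 0}"
    and "\<And>u v. \<lbrakk>u \<in> carrier G; G.ord u = 0; v \<in> carrier G; G.ord v = 0\<rbrakk>
      \<Longrightarrow> u \<in> G.cyc v \<longleftrightarrow> h u \<in> H.cyc (h v)"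
proof -
  let ?I = "{x \<in> carrier G. G.ord x = 0}" and ?J = "{y \<in> carrier H. H.ord y = 0}"
  have "\<exists>h. bij_betw h C (f ` C) \<and> (\<forall>u\<in>C. \<forall>v\<in>C. u \<in> G.cyc v \<longleftrightarrow> h u \<in> H.cyc (h v))"
    if "C \<in> G.cclass ` ?I" for C
  proof -
    from that obtain x where x: "C = G.cclass x" "x \<in> ?I" by (rule imageE)
    then have "f ` C = H.cclass (f x)" using f_cclass[of x] by simp
    then show ?thesis using class_iso[of x] x by simp
  qed
  then have "\<forall>C\<in>G.cclass ` ?I. \<exists>h. bij_betw h C (f ` C) \<and>
      (\<forall>u\<in>C. \<forall>v\<in>C. u \<in> G.cyc v \<longleftrightarrow> h u \<in> H.cyc (h v))"
    by (rule ballI)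
  from bchoice[OF this] obtain h where h0: "\<forall>C\<in>G.cclass ` ?I. bij_betw (h C) C (f ` C) \<and>
      (\<forall>u\<in>C. \<forall>v\<in>C. u \<in> G.cyc v \<longleftrightarrow> h C u \<in> H.cyc (h C v))"
    by (rule exE)
  note h = bspec[OF h0]
  define g where "g x = h (G.cclass x) x" for x
  have hb: "bij_betw (h (G.cclass x)) (G.cclass x) (H.cclass (f x))" if "x \<in> ?I" for x
    using h[of "G.cclass x"] that f_cclass[of x] by simp
  have gH: "g x \<in> H.cclass (f x)" if "x \<in> ?I" for x
    using bij_betw_apply[OF hb[OF that], of x] that G.cclass_refl by (simp add: g_def)
  have same: "G.cclass x = G.cclass y" if xy: "x \<in> ?I" "y \<in> ?I" "H.cclass (g x) = H.cclass (g y)" for x y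
  proof -
    have X: "x \<in> carrier G" "G.ord x = 0" and Y: "y \<in> carrier G" "G.ord y = 0" using xy(1,2) by simp_all
    have "H.cclass (f x) = H.cclass (g x)" using H.cclass_eq[OF f_closed[OF X(1)] gH[OF xy(1)]] by simp
    also have "\<dots> = H.cclass (f y)" using H.cclass_eq[OF f_closed[OF Y(1)] gH[OF xy(2)]] xy(3) by simp
    finally have "f x \<in> H.cclass (f y)" using H.cclass_refl[of "f x"] f_inf[OF X] by simp
    then have "f x \<in> f ` G.cclass y" by (simp only: f_cclass[OF Y])
    then obtain w where w: "f x = f w" "w \<in> G.cclass y" by (rule imageE)
    then have "x = w" using f_inj[OF X(1) G.cclassD(1)[OF w(2)]] by simp
    then show ?thesis using G.cclass_eq[OF Y(1) w(2)] by simp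
  qed
  have inj: "inj_on g ?I"
  proof (rule inj_onI)
    fix x y assume xy: "x \<in> ?I" "y \<in> ?I" "g x = g y"
    have c: "G.cclass x = G.cclass y" using same[OF xy(1,2)] xy(3) by simp
    have "h (G.cclass x) x = h (G.cclass x) y" using xy(3) c by (simp add: g_def)
    moreover have "x \<in> G.cclass x" using xy(1) G.cclass_refl[of x] by simp
    moreover have "y \<in> G.cclass x" using xy(2) G.cclass_refl[of y] c by simp
    ultimately show "x = y" by (rule inj_onD[OF bij_betw_imp_inj_on[OF hb[OF xy(1)]]])
  qed
  have surj: "g ` ?I = ?J"
  proof (intro equalityI subsetI)
    fix y assume "y \<in> g ` ?I"
    then obtain x where x: "y = g x" "x \<in> ?I" by (rule imageE)
    show "y \<in> ?J" using H.cclassD(1,2)[OF gH[OF x(2)]] x(1) by simp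
  next
    fix y assume y: "y \<in> ?J"
    then have yc: "y \<in> carrier H" "H.ord y = 0" by simp_all
    obtain x where x: "x \<in> carrier G" "y = f x" by (rule f_surj[OF yc(1)])
    then have xI: "x \<in> ?I" using yc f_ord_zero_iff by simp
    have "y \<in> H.cclass (f x)" using H.cclass_refl[OF yc] x(2) by simp
    then have "y \<in> h (G.cclass x) ` G.cclass x"
      by (simp only: bij_betw_imp_surj_on[OF hb[OF xI]])
    then obtain w where w: "y = h (G.cclass x) w" "w \<in> G.cclass x" by (rule imageE)
    have "G.cclass w = G.cclass x" by (rule G.cclass_eq[OF x(1) w(2)])
    then have "y = g w" using w(1) by (simp add: g_def)
    moreover have "w \<in> ?I" using G.cclassD[OF w(2)] by simp
    ultimately show "y \<in> g ` ?I" by (rule image_eqI)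
  qed
  have pres: "u \<in> G.cyc v \<longleftrightarrow> g u \<in> H.cyc (g v)"
    if uv: "u \<in> carrier G" "G.ord u = 0" "v \<in> carrier G" "G.ord v = 0" for u v
  proof -
    have I: "u \<in> ?I" "v \<in> ?I" using uv by simp_all
    have key: "u \<in> G.cyc v \<longleftrightarrow> g u \<in> H.cyc (g v)" if eq: "G.cclass u = G.cclass v"
    proof -
      have "u \<in> G.cclass v" "v \<in> G.cclass v"
        using eq G.cclass_refl[OF uv(1,2)] G.cclass_refl[OF uv(3,4)] by simp_all
      then have "u \<in> G.cyc v \<longleftrightarrow> h (G.cclass v) u \<in> H.cyc (h (G.cclass v) v)"
        using conjunct2[OF h[OF imageI[OF I(2)]]] by simp
      then show ?thesis by (simp add: g_def eq)
    qed
    have 1: "G.cclass u = G.cclass v" if "u \<in> G.cyc v"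
    proof -
      have "G.adj v u" using that by (simp add: G.adj_def)
      then have "u \<in> G.cclass v"
        by (rule G.cclass_adj[OF uv(3) G.cclass_refl[OF uv(3,4)] uv(1) G.inf_not_one[OF uv(1,2)]])
      then show ?thesis by (rule G.cclass_eq[OF uv(3)])
    qed
    have 2: "G.cclass u = G.cclass v" if "g u \<in> H.cyc (g v)"
    proof -
      note U = H.cclassD[OF gH[OF I(1)]] and V = H.cclassD[OF gH[OF I(2)]]
      have "H.adj (g v) (g u)" using that by (simp add: H.adj_def)
      then have "g u \<in> H.cclass (g v)"
        by (rule H.cclass_adj[OF V(1) H.cclass_refl[OF V(1,2)] U(1,3)])
      then have "H.cclass (g u) = H.cclass (g v)" by (rule H.cclass_eq[OF V(1)])
      then show ?thesis by (rule same[OF I])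
    qed
    show ?thesis using key 1 2 by argo
  qed
  have "bij_betw g ?I ?J" using inj surj by (simp add: bij_betw_def)
  then show thesis by (rule that[OF _ pres])
qed

end

section \<open>From the power graph to the directed power graph\<close>

context group
begin

text \<open>Transposing two dominating vertices is an automorphism of the power graph.\<close>

lemma adj_transpose:
  assumes d: "d \<in> carrier G" "\<And>z. z \<in> carrier G \<Longrightarrow> adj d z" and a: "a \<in> carrier G" and b: "b \<in> carrier G"
  shows "adj (transpose d \<one> a) (transpose d \<one> b) \<longleftrightarrow> adj a b"
  using d a b adj_sym[of _ d] by (auto simp: transpose_def)

lemma cyc_iff_adj_dvd:
  assumes "u \<in> carrier G" "v \<in> carrier G" "ord u \<noteq> 0" "ord v \<noteq> 0"
  shows "u \<in> cyc v \<longleftrightarrow> adj u v \<and> ord u dvd ord v"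
  using adj_iff_ord_dvd[OF assms(1,2) _ assms(3,4)] by (auto simp: adj_def)

lemma not_pure_cases:
  assumes "x \<in> carrier G" "ord x \<noteq> 0" "\<not> pure x"
  obtains "x = \<one>" | z where "mixed z" "x \<in> cyc z"
  using assms by (auto simp: pure_def)

end

context power_graph_iso
begin

text \<open>On torsion elements the combined map agrees with \<open>f\<close> up to twins, so that it preserves comparability,
  and it preserves orders, so that it preserves directions.\<close>

lemma directed_iso:
  assumes no: "\<not> (\<exists>L. subgroup L G \<and> quasicyclic_group (G\<lparr>carrier := L\<rparr>) \<and> intersection_free L G)"
  obtains \<psi> where "bij_betw \<psi> (carrier G) (carrier H)"
    and "\<And>u v. \<lbrakk>u \<in> carrier G; v \<in> carrier G\<rbrakk> \<Longrightarrow> u \<in> G.cyc v \<longleftrightarrow> \<psi> u \<in> H.cyc (\<psi> v)"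
proof -
  obtain hI where bI: "bij_betw hI {x \<in> carrier G. G.ord x = 0} {y \<in> carrier H. H.ord y = 0}"
    and pI: "\<And>u v. \<lbrakk>u \<in> carrier G; G.ord u = 0; v \<in> carrier G; G.ord v = 0\<rbrakk>
      \<Longrightarrow> u \<in> G.cyc v \<longleftrightarrow> hI u \<in> H.cyc (hI v)"
    using infinite_order_iso by blast
  obtain hP where bP: "bij_betw hP (Collect G.pure) (Collect H.pure)"
    and pP: "\<And>x. G.pure x \<Longrightarrow> hP x \<in> H.twins (f x) \<and> H.ord (hP x) = G.ord x"
    using pure_matching[OF no] by auto
  define \<psi> where "\<psi> x = (if G.ord x = 0 then hI x else if G.pure x then hP x else f x)" for x
  let ?I = "{x \<in> carrier G. G.ord x = 0}" and ?J = "{y \<in> carrier H. H.ord y = 0}"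
  let ?O = "{x \<in> carrier G. G.ord x \<noteq> 0 \<and> \<not> G.pure x}" and ?Q = "{y \<in> carrier H. H.ord y \<noteq> 0 \<and> \<not> H.pure y}"
  have "bij_betw \<psi> ?I ?J" using bI by (rule bij_betw_cong[THEN iffD1, rotated]) (simp add: \<psi>_def)
  moreover have "bij_betw \<psi> (Collect G.pure) (Collect H.pure)"
    using bP by (rule bij_betw_cong[THEN iffD1, rotated]) (simp add: \<psi>_def G.pureD)
  moreover have "bij_betw \<psi> ?O ?Q"
  proof -
    have "f ` ?O = ?Q"
    proof (intro equalityI subsetI)
      fix y assume "y \<in> f ` ?O"
      then obtain x where "y = f x" "x \<in> ?O" by (rule imageE)
      then show "y \<in> ?Q" using f_ord_zero_iff[of x] pure_iff[of x] by simp
    next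
      fix y assume y: "y \<in> ?Q"
      then obtain x where x: "x \<in> carrier G" "y = f x" using f_surj[of y] by auto
      then show "y \<in> f ` ?O" using y f_ord_zero_iff[of x] pure_iff[of x] by simp
    qed
    then have "bij_betw f ?O ?Q" using f_inj_on[of ?O] by (simp add: bij_betw_def)
    then show ?thesis by (rule bij_betw_cong[THEN iffD1, rotated]) (simp add: \<psi>_def)
  qed
  ultimately have "bij_betw \<psi> (?I \<union> Collect G.pure \<union> ?O) (?J \<union> Collect H.pure \<union> ?Q)"
    by (intro bij_betw_combine) (auto dest: H.pureD(2))
  moreover have "?I \<union> Collect G.pure \<union> ?O = carrier G" by (auto dest: G.pureD(1))
  moreover have "?J \<union> Collect H.pure \<union> ?Q = carrier H" by (auto dest: H.pureD(1))
  ultimately have bij: "bij_betw \<psi> (carrier G) (carrier H)" by simp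
  have closed: "\<psi> x \<in> carrier H" if "x \<in> carrier G" for x using bij_betw_apply[OF bij that] .
  have tors: "H.ord (\<psi> x) = G.ord x \<and> H.nsub (\<psi> x) (f x) \<and> H.nsub (f x) (\<psi> x)"
    if x: "x \<in> carrier G" "G.ord x \<noteq> 0" for x
  proof (cases "G.pure x")
    case True
    then have "\<psi> x = hP x" using x by (simp add: \<psi>_def)
    then show ?thesis using pP[OF True] by (simp add: H.twins_def)
  next
    case False
    then have e: "\<psi> x = f x" using x by (simp add: \<psi>_def)
    have "H.ord (f x) = G.ord x"
      using x False
    proof (cases rule: G.not_pure_cases)
      case 2
      then show ?thesis by (rule shared_ord)
    qed simp
    then show ?thesis using e by simp
  qed
  have infin: "H.ord (\<psi> x) = 0" if x: "x \<in> carrier G" "G.ord x = 0" for x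
    using bij_betw_apply[OF bI, of x] x by (simp add: \<psi>_def)
  have one: "\<psi> x = \<one>\<^bsub>H\<^esub> \<longleftrightarrow> x = \<one>\<^bsub>G\<^esub>" if x: "x \<in> carrier G" "G.ord x \<noteq> 0" for x
    using tors[OF x] H.ord_one_iff[OF closed[OF x(1)]] G.ord_one_iff[OF x(1)] by simp
  have "u \<in> G.cyc v \<longleftrightarrow> \<psi> u \<in> H.cyc (\<psi> v)" if uv: "u \<in> carrier G" "v \<in> carrier G" for u v
  proof -
    note c = closed[OF uv(1)] closed[OF uv(2)]
    consider "G.ord u = 0" "G.ord v = 0" | "G.ord u = 0" "G.ord v \<noteq> 0"
      | "G.ord u \<noteq> 0" "G.ord v = 0" | "G.ord u \<noteq> 0" "G.ord v \<noteq> 0" by blast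
    then show ?thesis
    proof cases
      case 1
      then show ?thesis using pI[of u v] uv by (simp add: \<psi>_def)
    next
      case 2
      have "u \<notin> G.cyc v" using G.cyc_ord_nonzero[OF uv(2) _ 2(2)] 2(1) by blast
      moreover have "\<psi> u \<notin> H.cyc (\<psi> v)"
      proof
        assume "\<psi> u \<in> H.cyc (\<psi> v)"
        then have "H.ord (\<psi> u) \<noteq> 0" by (rule H.cyc_ord_nonzero[OF c(2)]) (use tors[OF uv(2) 2(2)] 2(2) in simp)
        then show False using infin[OF uv(1) 2(1)] by simp
      qed
      ultimately show ?thesis by simp
    next
      case 3
      have "u \<in> G.cyc v \<longleftrightarrow> u = \<one>\<^bsub>G\<^esub>" using G.cyc_inf[OF uv(2) 3(2), of u] 3(1) by auto
      moreover have "\<psi> u \<in> H.cyc (\<psi> v) \<longleftrightarrow> \<psi> u = \<one>\<^bsub>H\<^esub>"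
        using H.cyc_inf[OF c(2) infin[OF uv(2) 3(2)], of "\<psi> u"] tors[OF uv(1) 3(1)] 3(1) by auto
      ultimately show ?thesis using one[OF uv(1) 3(1)] by simp
    next
      case 4
      note U = tors[OF uv(1) 4(1)] and V = tors[OF uv(2) 4(2)]
      have fc: "f u \<in> carrier H" "f v \<in> carrier H" using uv by simp_all
      have "H.adj (\<psi> u) (\<psi> v) \<longleftrightarrow> H.adj (\<psi> u) (f v)" using V c(1) by (auto simp: H.nsub_def)
      also have "\<dots> \<longleftrightarrow> H.adj (f v) (\<psi> u)" by (rule H.adj_sym)
      also have "\<dots> \<longleftrightarrow> H.adj (f v) (f u)" using U fc(2) by (auto simp: H.nsub_def)
      also have "\<dots> \<longleftrightarrow> G.adj u v" using f_adj[OF uv(2,1)] G.adj_sym by simp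
      finally show ?thesis
        using G.cyc_iff_adj_dvd[OF uv 4] H.cyc_iff_adj_dvd[OF c] U V 4 by simp
    qed
  qed
  with bij show thesis by (rule that)
qed

end

lemma pair_wf_power_graph: "pair_wf_digraph (power_graph G)"
  using pair_bidirected_digraph.axioms(2)[OF pair_bidirected_power_graph]
  by (rule pair_loopfree_digraph.axioms(1))

lemma pair_wf_directed_power_graph: "pair_wf_digraph (directed_power_graph G)"
  using pair_loopfree_directed_power_graph by (rule pair_loopfree_digraph.axioms(1))

theorem corollary3p19:
  fixes G :: "('a, 'm) monoid_scheme" and H :: "('b, 'n) monoid_scheme"
  assumes "group G" and "group H"
    and "digraph_iso (with_proj (power_graph G)) (with_proj (power_graph H))"
    and "\<not> (\<exists>L. subgroup L G \<and> quasicyclic_group (G\<lparr>carrier := L\<rparr>) \<and> intersection_free L G)"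
  shows "digraph_iso (with_proj (directed_power_graph G)) (with_proj (directed_power_graph H))"
proof -
  interpret G: group G by fact
  interpret H: group H by fact
  have arcG: "(x, y) \<in> parcs (power_graph G) \<longleftrightarrow> x \<noteq> y \<and> G.adj x y" if "x \<in> carrier G" "y \<in> carrier G" for x y
    using that by (auto simp: power_graph_def G.adj_def G.cyc_def)
  have arcH: "(x, y) \<in> parcs (power_graph H) \<longleftrightarrow> x \<noteq> y \<and> H.adj x y" if "x \<in> carrier H" "y \<in> carrier H" for x y
    using that by (auto simp: power_graph_def H.adj_def H.cyc_def)
  have "\<exists>f. bij_betw f (pverts (power_graph G)) (pverts (power_graph H)) \<and>
      (\<forall>x\<in>pverts (power_graph G). \<forall>y\<in>pverts (power_graph G).
        (x, y) \<in> parcs (power_graph G) \<longleftrightarrow> (f x, f y) \<in> parcs (power_graph H))"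
    using assms(3) by (simp only: digraph_iso_with_proj_iff pair_wf_power_graph)
  then obtain g where g: "bij_betw g (carrier G) (carrier H)"
    and garc: "\<forall>x\<in>carrier G. \<forall>y\<in>carrier G. (x, y) \<in> parcs (power_graph G) \<longleftrightarrow> (g x, g y) \<in> parcs (power_graph H)"
    by (auto simp: power_graph_def)
  have gc: "g x \<in> carrier H" if "x \<in> carrier G" for x using bij_betw_apply[OF g that] .
  have gadj: "H.adj (g x) (g y) \<longleftrightarrow> G.adj x y" if xy: "x \<in> carrier G" "y \<in> carrier G" for x y
  proof (cases "x = y")
    case False
    then have "g x \<noteq> g y" using g xy by (auto simp: bij_betw_def inj_on_def)
    then show ?thesis using arcG[OF xy] arcH[OF gc[OF xy(1)] gc[OF xy(2)]] garc xy False by simp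
  qed (use xy gc in simp)
  define d where "d = g \<one>\<^bsub>G\<^esub>"
  have d: "d \<in> carrier H" using gc by (simp add: d_def)
  have dom: "H.adj d z" if z: "z \<in> carrier H" for z
  proof -
    have "z \<in> g ` carrier G" using g z by (simp add: bij_betw_def)
    then obtain x where "z = g x" "x \<in> carrier G" by (rule imageE)
    then show ?thesis using gadj[of "\<one>\<^bsub>G\<^esub>" x] by (simp add: d_def)
  qed
  have swap: "bij_betw (transpose d \<one>\<^bsub>H\<^esub>) (carrier H) (carrier H)"
    using d by (simp add: bij_betw_def transpose_image_eq)
  interpret power_graph_iso G H "transpose d \<one>\<^bsub>H\<^esub> \<circ> g"
  proof unfold_locales
    show "bij_betw (transpose d \<one>\<^bsub>H\<^esub> \<circ> g) (carrier G) (carrier H)" by (rule bij_betw_trans[OF g swap])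
    show "H.adj ((transpose d \<one>\<^bsub>H\<^esub> \<circ> g) x) ((transpose d \<one>\<^bsub>H\<^esub> \<circ> g) y) \<longleftrightarrow> G.adj x y"
      if "x \<in> carrier G" "y \<in> carrier G" for x y
      using H.adj_transpose[OF d dom gc[OF that(1)] gc[OF that(2)]] gadj[OF that] by simp
    show "(transpose d \<one>\<^bsub>H\<^esub> \<circ> g) \<one>\<^bsub>G\<^esub> = \<one>\<^bsub>H\<^esub>" by (simp add: d_def)
  qed
  obtain \<psi> where \<psi>: "bij_betw \<psi> (carrier G) (carrier H)"
    and pres: "\<And>u v. \<lbrakk>u \<in> carrier G; v \<in> carrier G\<rbrakk> \<Longrightarrow> u \<in> G.cyc v \<longleftrightarrow> \<psi> u \<in> H.cyc (\<psi> v)"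
    using directed_iso[OF assms(4)] by blast
  have inj: "\<psi> x = \<psi> y \<longleftrightarrow> x = y" if "x \<in> carrier G" "y \<in> carrier G" for x y
    using \<psi> that by (auto simp: bij_betw_def inj_on_def)
  have dG: "(x, y) \<in> parcs (directed_power_graph G) \<longleftrightarrow> x \<noteq> y \<and> y \<in> G.cyc x"
    if "x \<in> carrier G" "y \<in> carrier G" for x y
    using that by (auto simp: directed_power_graph_def G.cyc_def)
  have dH: "(x, y) \<in> parcs (directed_power_graph H) \<longleftrightarrow> x \<noteq> y \<and> y \<in> H.cyc x"
    if "x \<in> carrier H" "y \<in> carrier H" for x y
    using that by (auto simp: directed_power_graph_def H.cyc_def)
  have "bij_betw \<psi> (pverts (directed_power_graph G)) (pverts (directed_power_graph H)) \<and>
    (\<forall>x\<in>pverts (directed_power_graph G). \<forall>y\<in>pverts (directed_power_graph G).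
      (x, y) \<in> parcs (directed_power_graph G) \<longleftrightarrow> (\<psi> x, \<psi> y) \<in> parcs (directed_power_graph H))"
  proof (intro conjI ballI)
    show "bij_betw \<psi> (pverts (directed_power_graph G)) (pverts (directed_power_graph H))"
      using \<psi> by (simp add: directed_power_graph_def)
    fix x y assume "x \<in> pverts (directed_power_graph G)" "y \<in> pverts (directed_power_graph G)"
    then have xy: "x \<in> carrier G" "y \<in> carrier G" by (simp_all add: directed_power_graph_def)
    show "(x, y) \<in> parcs (directed_power_graph G) \<longleftrightarrow> (\<psi> x, \<psi> y) \<in> parcs (directed_power_graph H)"
      using dG[OF xy] dH[OF bij_betw_apply[OF \<psi> xy(1)] bij_betw_apply[OF \<psi> xy(2)]] inj[OF xy] pres[OF xy(2,1)]
      by simp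
  qed
  then show ?thesis
    using digraph_iso_with_proj_iff[OF pair_wf_directed_power_graph pair_wf_directed_power_graph] by blast
qed

end
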